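(* Let $\mathbf{M}$ be a left proper, combinatorial model category, and let $Y$ be a fibrant object of $\mathbf{M}$. Then any morphism $f:X\to Y$ of $\mathbf{M}$ has a homotopy image.
   Context: Combinatorial (relative to a fixed Grothendieck universe) means cofibrantly generated by small sets with locally presentable underlying category. A morphism $g:A\to B$ of $\mathbf{M}$ is a homotopy monomorphism if the natural morphism $A\to A\times^h_B A$ to the homotopy fiber product is an isomorphism of $\mathrm{Ho}\,\mathbf{M}$. A homotopy image of $f:X\to Y$ is a factorization of $f$ into a cofibration $X\to f(X)$ followed by a homotopy monomorphism $f(X)\to Y$ such that for any other factorization $X\to X'\to Y$ of $f$ into a cofibration followed by a homotopy monomorphism, there exists a unique morphism $f(X)\to X'$ in $\mathrm{Ho}\,\mathbf{M}$ compatible with the given morphisms from $X$ and to $Y$. *)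

theory Defs
  imports Main
begin

unbundle cardinal_syntax

section \<open>Universes and smallness\<close>

text \<open>
  Up to bijection, the sets that belong to a Grothendieck universe (containing the set of natural
  numbers) are exactly the sets of cardinality less than some strongly inaccessible cardinal, and
  every such cardinal arises.  A universe is therefore given by a strongly inaccessible cardinal
  \<open>\<kappa>\<close> on some type \<open>'u\<close>.  Every set of cardinality less than \<open>\<kappa>\<close> has a copy in \<open>'u\<close>, so below
  small index categories, posets, ordinals and cardinals are all taken over \<open>'u\<close>.
\<close>

definition universe_cardinal :: "'u rel \<Rightarrow> bool" where
  "universe_cardinal \<kappa> \<longleftrightarrow>
     Card_order \<kappa> \<and> natLeq <o \<kappa> \<and> regularCard \<kappa> \<and> (\<forall>A :: 'u set. |A| <o \<kappa> \<longrightarrow> |Pow A| <o \<kappa>)"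

definition small :: "'u rel \<Rightarrow> 'b set \<Rightarrow> bool" where
  "small \<kappa> A \<longleftrightarrow> |A| <o \<kappa>"


section \<open>Categories, limits and colimits\<close>

record ('o, 'a) cat =
  Obj :: "'o set"
  Arr :: "'a set"
  Dom :: "'a \<Rightarrow> 'o"
  Cod :: "'a \<Rightarrow> 'o"
  Ide :: "'o \<Rightarrow> 'a"
  Comp :: "'a \<Rightarrow> 'a \<Rightarrow> 'a" (infixl \<open>\<cdot>\<index>\<close> 70)

definition hom :: "('o, 'a, 'z) cat_scheme \<Rightarrow> 'o \<Rightarrow> 'o \<Rightarrow> 'a set" where
  "hom C X Y = {f \<in> Arr C. Dom C f = X \<and> Cod C f = Y}"

locale category =
  fixes C :: "('o, 'a, 'z) cat_scheme" (structure)
  assumes Dom_Obj: "f \<in> Arr C \<Longrightarrow> Dom C f \<in> Obj C"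
    and Cod_Obj: "f \<in> Arr C \<Longrightarrow> Cod C f \<in> Obj C"
    and Ide_hom: "X \<in> Obj C \<Longrightarrow> Ide C X \<in> hom C X X"
    and Comp_hom: "f \<in> hom C X Y \<Longrightarrow> g \<in> hom C Y Z \<Longrightarrow> g \<cdot> f \<in> hom C X Z"
    and Comp_Ide_left: "f \<in> hom C X Y \<Longrightarrow> Ide C Y \<cdot> f = f"
    and Comp_Ide_right: "f \<in> hom C X Y \<Longrightarrow> f \<cdot> Ide C X = f"
    and Comp_assoc:
      "f \<in> hom C W X \<Longrightarrow> g \<in> hom C X Y \<Longrightarrow> h \<in> hom C Y Z \<Longrightarrow> h \<cdot> (g \<cdot> f) = (h \<cdot> g) \<cdot> f"

definition is_iso :: "('o, 'a, 'z) cat_scheme \<Rightarrow> 'a \<Rightarrow> bool" where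
  "is_iso C f \<longleftrightarrow> f \<in> Arr C \<and>
     (\<exists>g \<in> hom C (Cod C f) (Dom C f).
        g \<cdot>\<^bsub>C\<^esub> f = Ide C (Dom C f) \<and> f \<cdot>\<^bsub>C\<^esub> g = Ide C (Cod C f))"

definition is_terminal :: "('o, 'a, 'z) cat_scheme \<Rightarrow> 'o \<Rightarrow> bool" where
  "is_terminal C T \<longleftrightarrow> T \<in> Obj C \<and> (\<forall>X \<in> Obj C. \<exists>!f. f \<in> hom C X T)"

definition is_functor ::
  "('i, 'j, 'y) cat_scheme \<Rightarrow> ('o, 'a, 'z) cat_scheme \<Rightarrow> ('i \<Rightarrow> 'o) \<Rightarrow> ('j \<Rightarrow> 'a) \<Rightarrow> bool" where
  "is_functor J C Fo Fa \<longleftrightarrow>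
     (\<forall>i \<in> Obj J. Fo i \<in> Obj C) \<and>
     (\<forall>\<phi> \<in> Arr J. Fa \<phi> \<in> hom C (Fo (Dom J \<phi>)) (Fo (Cod J \<phi>))) \<and>
     (\<forall>i \<in> Obj J. Fa (Ide J i) = Ide C (Fo i)) \<and>
     (\<forall>\<phi> \<in> Arr J. \<forall>\<psi> \<in> Arr J. Cod J \<phi> = Dom J \<psi> \<longrightarrow> Fa (\<psi> \<cdot>\<^bsub>J\<^esub> \<phi>) = Fa \<psi> \<cdot>\<^bsub>C\<^esub> Fa \<phi>)"

definition is_cocone ::
  "('i, 'j, 'y) cat_scheme \<Rightarrow> ('o, 'a, 'z) cat_scheme \<Rightarrow> ('i \<Rightarrow> 'o) \<Rightarrow> ('j \<Rightarrow> 'a)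
     \<Rightarrow> 'o \<Rightarrow> ('i \<Rightarrow> 'a) \<Rightarrow> bool" where
  "is_cocone J C Fo Fa L \<iota> \<longleftrightarrow> L \<in> Obj C \<and> (\<forall>i \<in> Obj J. \<iota> i \<in> hom C (Fo i) L) \<and>
     (\<forall>\<phi> \<in> Arr J. \<iota> (Cod J \<phi>) \<cdot>\<^bsub>C\<^esub> Fa \<phi> = \<iota> (Dom J \<phi>))"

definition is_colimit ::
  "('i, 'j, 'y) cat_scheme \<Rightarrow> ('o, 'a, 'z) cat_scheme \<Rightarrow> ('i \<Rightarrow> 'o) \<Rightarrow> ('j \<Rightarrow> 'a)
     \<Rightarrow> 'o \<Rightarrow> ('i \<Rightarrow> 'a) \<Rightarrow> bool" where
  "is_colimit J C Fo Fa L \<iota> \<longleftrightarrow> is_cocone J C Fo Fa L \<iota> \<and>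
     (\<forall>L' \<iota>'. is_cocone J C Fo Fa L' \<iota>' \<longrightarrow>
        (\<exists>!u. u \<in> hom C L L' \<and> (\<forall>i \<in> Obj J. u \<cdot>\<^bsub>C\<^esub> \<iota> i = \<iota>' i)))"

definition is_cone ::
  "('i, 'j, 'y) cat_scheme \<Rightarrow> ('o, 'a, 'z) cat_scheme \<Rightarrow> ('i \<Rightarrow> 'o) \<Rightarrow> ('j \<Rightarrow> 'a)
     \<Rightarrow> 'o \<Rightarrow> ('i \<Rightarrow> 'a) \<Rightarrow> bool" where
  "is_cone J C Fo Fa L \<pi> \<longleftrightarrow> L \<in> Obj C \<and> (\<forall>i \<in> Obj J. \<pi> i \<in> hom C L (Fo i)) \<and>
     (\<forall>\<phi> \<in> Arr J. Fa \<phi> \<cdot>\<^bsub>C\<^esub> \<pi> (Dom J \<phi>) = \<pi> (Cod J \<phi>))"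

definition is_limit ::
  "('i, 'j, 'y) cat_scheme \<Rightarrow> ('o, 'a, 'z) cat_scheme \<Rightarrow> ('i \<Rightarrow> 'o) \<Rightarrow> ('j \<Rightarrow> 'a)
     \<Rightarrow> 'o \<Rightarrow> ('i \<Rightarrow> 'a) \<Rightarrow> bool" where
  "is_limit J C Fo Fa L \<pi> \<longleftrightarrow> is_cone J C Fo Fa L \<pi> \<and>
     (\<forall>L' \<pi>'. is_cone J C Fo Fa L' \<pi>' \<longrightarrow>
        (\<exists>!u. u \<in> hom C L' L \<and> (\<forall>i \<in> Obj J. \<pi> i \<cdot>\<^bsub>C\<^esub> u = \<pi>' i)))"

definition small_complete :: "'u rel \<Rightarrow> ('o, 'a, 'z) cat_scheme \<Rightarrow> bool" where
  "small_complete \<kappa> C \<longleftrightarrow>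
     (\<forall>(J :: ('u, 'u) cat) Fo Fa.
        category J \<and> small \<kappa> (Obj J) \<and> small \<kappa> (Arr J) \<and> is_functor J C Fo Fa \<longrightarrow>
        (\<exists>L \<pi>. is_limit J C Fo Fa L \<pi>))"

definition small_cocomplete :: "'u rel \<Rightarrow> ('o, 'a, 'z) cat_scheme \<Rightarrow> bool" where
  "small_cocomplete \<kappa> C \<longleftrightarrow>
     (\<forall>(J :: ('u, 'u) cat) Fo Fa.
        category J \<and> small \<kappa> (Obj J) \<and> small \<kappa> (Arr J) \<and> is_functor J C Fo Fa \<longrightarrow>
        (\<exists>L \<iota>. is_colimit J C Fo Fa L \<iota>))"

text \<open>
  \<open>is_pullback C f g p q\<close>: the square \<open>f \<cdot> p = g \<cdot> q\<close> on the cospan \<open>(f, g)\<close> is cartesian;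
  \<open>is_pushout C f g p q\<close>: the square \<open>p \<cdot> f = q \<cdot> g\<close> on the span \<open>(f, g)\<close> is cocartesian.
\<close>

definition is_pullback :: "('o, 'a, 'z) cat_scheme \<Rightarrow> 'a \<Rightarrow> 'a \<Rightarrow> 'a \<Rightarrow> 'a \<Rightarrow> bool" where
  "is_pullback C f g p q \<longleftrightarrow>
     f \<in> Arr C \<and> g \<in> Arr C \<and> Cod C f = Cod C g \<and>
     p \<in> hom C (Dom C p) (Dom C f) \<and> q \<in> hom C (Dom C p) (Dom C g) \<and> f \<cdot>\<^bsub>C\<^esub> p = g \<cdot>\<^bsub>C\<^esub> q \<and>
     (\<forall>Z. \<forall>p' \<in> hom C Z (Dom C f). \<forall>q' \<in> hom C Z (Dom C g). f \<cdot>\<^bsub>C\<^esub> p' = g \<cdot>\<^bsub>C\<^esub> q' \<longrightarrow>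
        (\<exists>!u. u \<in> hom C Z (Dom C p) \<and> p \<cdot>\<^bsub>C\<^esub> u = p' \<and> q \<cdot>\<^bsub>C\<^esub> u = q'))"

definition is_pushout :: "('o, 'a, 'z) cat_scheme \<Rightarrow> 'a \<Rightarrow> 'a \<Rightarrow> 'a \<Rightarrow> 'a \<Rightarrow> bool" where
  "is_pushout C f g p q \<longleftrightarrow>
     f \<in> Arr C \<and> g \<in> Arr C \<and> Dom C f = Dom C g \<and>
     p \<in> hom C (Cod C f) (Cod C p) \<and> q \<in> hom C (Cod C g) (Cod C p) \<and> p \<cdot>\<^bsub>C\<^esub> f = q \<cdot>\<^bsub>C\<^esub> g \<and>
     (\<forall>Z. \<forall>p' \<in> hom C (Cod C f) Z. \<forall>q' \<in> hom C (Cod C g) Z. p' \<cdot>\<^bsub>C\<^esub> f = q' \<cdot>\<^bsub>C\<^esub> g \<longrightarrow>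
        (\<exists>!u. u \<in> hom C (Cod C p) Z \<and> u \<cdot>\<^bsub>C\<^esub> p = p' \<and> u \<cdot>\<^bsub>C\<^esub> q = q'))"

text \<open>
  The covariant functor \<open>hom(K, _)\<close> sends the colimit cocone \<open>(L, \<iota>)\<close> to a colimit of sets.  The
  colimit of the sets \<open>hom(K, F i)\<close> is the quotient of their disjoint union by the equivalence
  relation generated by \<open>(i, u) \<sim> (j, F \<phi> \<cdot> u)\<close> for \<open>\<phi> : i \<rightarrow> j\<close>; the two conjuncts are surjectivity
  and injectivity of the comparison map from that quotient to \<open>hom(K, L)\<close>.
\<close>

definition hom_preserves_colimit ::
  "('o, 'a, 'z) cat_scheme \<Rightarrow> 'o \<Rightarrow> ('i, 'j, 'y) cat_scheme \<Rightarrow> ('i \<Rightarrow> 'o) \<Rightarrow> ('j \<Rightarrow> 'a)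
     \<Rightarrow> 'o \<Rightarrow> ('i \<Rightarrow> 'a) \<Rightarrow> bool" where
  "hom_preserves_colimit C K J Fo Fa L \<iota> \<longleftrightarrow>
     (\<forall>f \<in> hom C K L. \<exists>i \<in> Obj J. \<exists>u \<in> hom C K (Fo i). f = \<iota> i \<cdot>\<^bsub>C\<^esub> u) \<and>
     (\<forall>i \<in> Obj J. \<forall>j \<in> Obj J. \<forall>u \<in> hom C K (Fo i). \<forall>v \<in> hom C K (Fo j).
        \<iota> i \<cdot>\<^bsub>C\<^esub> u = \<iota> j \<cdot>\<^bsub>C\<^esub> v \<longrightarrow>
        equivclp (\<lambda>(i, u) (j, v). \<exists>\<phi> \<in> hom J i j. u \<in> hom C K (Fo i) \<and> v = Fa \<phi> \<cdot>\<^bsub>C\<^esub> u) (i, u) (j, v))"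


section \<open>Locally presentable categories\<close>

definition poset_cat :: "'i rel \<Rightarrow> ('i, 'i \<times> 'i) cat" where
  "poset_cat r = \<lparr>Obj = Field r, Arr = r, Dom = fst, Cod = snd, Ide = (\<lambda>i. (i, i)),
     Comp = (\<lambda>\<psi> \<phi>. (fst \<phi>, snd \<psi>))\<rparr>"

definition small_regular_cardinal :: "'u rel \<Rightarrow> 'u rel \<Rightarrow> bool" where
  "small_regular_cardinal \<kappa> \<mu> \<longleftrightarrow> Card_order \<mu> \<and> cinfinite \<mu> \<and> regularCard \<mu> \<and> \<mu> <o \<kappa>"

definition directed_poset :: "'u rel \<Rightarrow> 'i rel \<Rightarrow> bool" where
  "directed_poset \<mu> r \<longleftrightarrow> Partial_order r \<and>
     (\<forall>A \<subseteq> Field r. |A| <o \<mu> \<longrightarrow> (\<exists>b \<in> Field r. \<forall>a \<in> A. (a, b) \<in> r))"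

definition presentable_object :: "'u rel \<Rightarrow> ('o, 'a, 'z) cat_scheme \<Rightarrow> 'u rel \<Rightarrow> 'o \<Rightarrow> bool" where
  "presentable_object \<kappa> C \<mu> K \<longleftrightarrow> K \<in> Obj C \<and>
     (\<forall>(r :: 'u rel) Fo Fa L \<iota>.
        directed_poset \<mu> r \<and> small \<kappa> (Field r) \<and> is_functor (poset_cat r) C Fo Fa \<and>
        is_colimit (poset_cat r) C Fo Fa L \<iota> \<longrightarrow>
        hom_preserves_colimit C K (poset_cat r) Fo Fa L \<iota>)"

definition locally_presentable :: "'u rel \<Rightarrow> ('o, 'a, 'z) cat_scheme \<Rightarrow> bool" where
  "locally_presentable \<kappa> C \<longleftrightarrow>
     category C \<and> (\<forall>X \<in> Obj C. \<forall>Y \<in> Obj C. small \<kappa> (hom C X Y)) \<and> small_cocomplete \<kappa> C \<and>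
     (\<exists>\<mu>. small_regular_cardinal \<kappa> \<mu> \<and>
        (\<exists>S. small \<kappa> S \<and> (\<forall>K \<in> S. presentable_object \<kappa> C \<mu> K) \<and>
           (\<forall>X \<in> Obj C. \<exists>(r :: 'u rel) Fo Fa \<iota>.
              directed_poset \<mu> r \<and> small \<kappa> (Field r) \<and> is_functor (poset_cat r) C Fo Fa \<and>
              Fo ` Field r \<subseteq> S \<and> is_colimit (poset_cat r) C Fo Fa X \<iota>)))"


section \<open>Relative cell complexes and the small object argument\<close>

text \<open>Ordinals are represented by well-orders, and an ordinal is identified with its field.\<close>

definition is_succ :: "'i rel \<Rightarrow> 'i \<Rightarrow> 'i \<Rightarrow> bool" where
  "is_succ r i j \<longleftrightarrow> i \<in> underS r j \<and> (\<forall>k \<in> underS r j. (k, i) \<in> r)"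

definition is_least :: "'i rel \<Rightarrow> 'i \<Rightarrow> bool" where
  "is_least r i \<longleftrightarrow> i \<in> Field r \<and> underS r i = {}"

definition is_limit_element :: "'i rel \<Rightarrow> 'i \<Rightarrow> bool" where
  "is_limit_element r j \<longleftrightarrow> j \<in> Field r \<and> underS r j \<noteq> {} \<and> (\<nexists>i. is_succ r i j)"

text \<open>A sequence indexed by an ordinal, continuous at limits, with successor steps in \<open>D\<close>.\<close>

definition transfinite_sequence ::
  "('o, 'a, 'z) cat_scheme \<Rightarrow> 'a set \<Rightarrow> 'i rel \<Rightarrow> ('i \<Rightarrow> 'o) \<Rightarrow> ('i \<times> 'i \<Rightarrow> 'a) \<Rightarrow> bool" where
  "transfinite_sequence C D r Fo Fa \<longleftrightarrow> Well_order r \<and> is_functor (poset_cat r) C Fo Fa \<and>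
     (\<forall>j. is_limit_element r j \<longrightarrow>
        is_colimit (poset_cat (Restr r (underS r j))) C Fo Fa (Fo j) (\<lambda>i. Fa (i, j))) \<and>
     (\<forall>i j. is_succ r i j \<longrightarrow> Fa (i, j) \<in> D)"

definition transfinite_compositions :: "'u rel \<Rightarrow> ('o, 'a, 'z) cat_scheme \<Rightarrow> 'a set \<Rightarrow> 'a set" where
  "transfinite_compositions \<kappa> C D = {f. \<exists>(r :: 'u rel) Fo Fa L \<iota> i.
     transfinite_sequence C D r Fo Fa \<and> small \<kappa> (Field r) \<and>
     is_colimit (poset_cat r) C Fo Fa L \<iota> \<and> is_least r i \<and> f = \<iota> i}"

definition relative_cells :: "'u rel \<Rightarrow> ('o, 'a, 'z) cat_scheme \<Rightarrow> 'a set \<Rightarrow> 'a set" where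
  "relative_cells \<kappa> C I =
     transfinite_compositions \<kappa> C {q. \<exists>i \<in> I. \<exists>g p. is_pushout C i g p q}"

text \<open>A limit ordinal in which every subset of cardinality at most \<open>\<mu>\<close> is bounded.\<close>

definition filtered_ordinal :: "'u rel \<Rightarrow> 'i rel \<Rightarrow> bool" where
  "filtered_ordinal \<mu> r \<longleftrightarrow> Well_order r \<and> Field r \<noteq> {} \<and>
     (\<forall>i \<in> Field r. \<exists>j \<in> Field r. i \<in> underS r j) \<and>
     (\<forall>A \<subseteq> Field r. |A| \<le>o \<mu> \<longrightarrow> (\<exists>b \<in> Field r. \<forall>a \<in> A. (a, b) \<in> r))"

definition small_relative_to :: "'u rel \<Rightarrow> ('o, 'a, 'z) cat_scheme \<Rightarrow> 'a set \<Rightarrow> 'o \<Rightarrow> bool" where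
  "small_relative_to \<kappa> C D K \<longleftrightarrow>
     (\<exists>\<mu> :: 'u rel. Card_order \<mu> \<and> \<mu> <o \<kappa> \<and>
        (\<forall>(r :: 'u rel) Fo Fa L \<iota>.
           filtered_ordinal \<mu> r \<and> small \<kappa> (Field r) \<and> transfinite_sequence C D r Fo Fa \<and>
           is_colimit (poset_cat r) C Fo Fa L \<iota> \<longrightarrow>
           hom_preserves_colimit C K (poset_cat r) Fo Fa L \<iota>))"

definition permits_small_object_argument ::
  "'u rel \<Rightarrow> ('o, 'a, 'z) cat_scheme \<Rightarrow> 'a set \<Rightarrow> bool" where
  "permits_small_object_argument \<kappa> C I \<longleftrightarrow>
     (\<forall>i \<in> I. small_relative_to \<kappa> C (relative_cells \<kappa> C I) (Dom C i))"


section \<open>Model categories\<close>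

record ('o, 'a) model = "('o, 'a) cat" +
  Weq :: "'a set"
  Cof :: "'a set"
  Fib :: "'a set"

text \<open>\<open>lifts C i p\<close>: \<open>i\<close> has the left lifting property with respect to \<open>p\<close>.\<close>

definition lifts :: "('o, 'a, 'z) cat_scheme \<Rightarrow> 'a \<Rightarrow> 'a \<Rightarrow> bool" where
  "lifts C i p \<longleftrightarrow>
     (\<forall>u \<in> hom C (Dom C i) (Dom C p). \<forall>v \<in> hom C (Cod C i) (Cod C p). p \<cdot>\<^bsub>C\<^esub> u = v \<cdot>\<^bsub>C\<^esub> i \<longrightarrow>
        (\<exists>h \<in> hom C (Cod C i) (Dom C p). h \<cdot>\<^bsub>C\<^esub> i = u \<and> p \<cdot>\<^bsub>C\<^esub> h = v))"

definition rlp :: "('o, 'a, 'z) cat_scheme \<Rightarrow> 'a set \<Rightarrow> 'a set" where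
  "rlp C I = {p \<in> Arr C. \<forall>i \<in> I. lifts C i p}"

definition is_retract :: "('o, 'a, 'z) cat_scheme \<Rightarrow> 'a \<Rightarrow> 'a \<Rightarrow> bool" where
  "is_retract C f g \<longleftrightarrow> f \<in> Arr C \<and> g \<in> Arr C \<and>
     (\<exists>s \<in> hom C (Dom C f) (Dom C g). \<exists>r \<in> hom C (Dom C g) (Dom C f).
      \<exists>s' \<in> hom C (Cod C f) (Cod C g). \<exists>r' \<in> hom C (Cod C g) (Cod C f).
        g \<cdot>\<^bsub>C\<^esub> s = s' \<cdot>\<^bsub>C\<^esub> f \<and> f \<cdot>\<^bsub>C\<^esub> r = r' \<cdot>\<^bsub>C\<^esub> g \<and>
        r \<cdot>\<^bsub>C\<^esub> s = Ide C (Dom C f) \<and> r' \<cdot>\<^bsub>C\<^esub> s' = Ide C (Cod C f))"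

definition retract_closed :: "('o, 'a, 'z) cat_scheme \<Rightarrow> 'a set \<Rightarrow> bool" where
  "retract_closed C S \<longleftrightarrow> (\<forall>f g. g \<in> S \<and> is_retract C f g \<longrightarrow> f \<in> S)"

definition model_category :: "'u rel \<Rightarrow> ('o, 'a, 'z) model_scheme \<Rightarrow> bool" where
  "model_category \<kappa> M \<longleftrightarrow>
     category M \<and> small_complete \<kappa> M \<and> small_cocomplete \<kappa> M \<and>
     Weq M \<subseteq> Arr M \<and> Cof M \<subseteq> Arr M \<and> Fib M \<subseteq> Arr M \<and>
     (\<forall>X Y Z. \<forall>f \<in> hom M X Y. \<forall>g \<in> hom M Y Z.
        (f \<in> Weq M \<and> g \<in> Weq M \<longrightarrow> g \<cdot>\<^bsub>M\<^esub> f \<in> Weq M) \<and>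
        (f \<in> Weq M \<and> g \<cdot>\<^bsub>M\<^esub> f \<in> Weq M \<longrightarrow> g \<in> Weq M) \<and>
        (g \<in> Weq M \<and> g \<cdot>\<^bsub>M\<^esub> f \<in> Weq M \<longrightarrow> f \<in> Weq M)) \<and>
     retract_closed M (Weq M) \<and> retract_closed M (Cof M) \<and> retract_closed M (Fib M) \<and>
     (\<forall>i \<in> Cof M. \<forall>p \<in> Fib M. i \<in> Weq M \<or> p \<in> Weq M \<longrightarrow> lifts M i p) \<and>
     (\<forall>f \<in> Arr M. \<exists>i \<in> Cof M \<inter> Weq M. \<exists>p \<in> Fib M. Cod M i = Dom M p \<and> p \<cdot>\<^bsub>M\<^esub> i = f) \<and>
     (\<forall>f \<in> Arr M. \<exists>i \<in> Cof M. \<exists>p \<in> Fib M \<inter> Weq M. Cod M i = Dom M p \<and> p \<cdot>\<^bsub>M\<^esub> i = f)"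

definition left_proper :: "('o, 'a, 'z) model_scheme \<Rightarrow> bool" where
  "left_proper M \<longleftrightarrow> (\<forall>i w w' i'. i \<in> Cof M \<and> w \<in> Weq M \<and> is_pushout M i w w' i' \<longrightarrow> w' \<in> Weq M)"

definition cofibrantly_generated :: "'u rel \<Rightarrow> ('o, 'a, 'z) model_scheme \<Rightarrow> bool" where
  "cofibrantly_generated \<kappa> M \<longleftrightarrow>
     (\<exists>I J. small \<kappa> I \<and> small \<kappa> J \<and> I \<subseteq> Arr M \<and> J \<subseteq> Arr M \<and>
        permits_small_object_argument \<kappa> M I \<and> permits_small_object_argument \<kappa> M J \<and>
        Fib M = rlp M J \<and> Fib M \<inter> Weq M = rlp M I)"

definition combinatorial_model_category :: "'u rel \<Rightarrow> ('o, 'a, 'z) model_scheme \<Rightarrow> bool" where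
  "combinatorial_model_category \<kappa> M \<longleftrightarrow>
     model_category \<kappa> M \<and> cofibrantly_generated \<kappa> M \<and> locally_presentable \<kappa> M"

definition fibrant :: "('o, 'a, 'z) model_scheme \<Rightarrow> 'o \<Rightarrow> bool" where
  "fibrant M X \<longleftrightarrow> X \<in> Obj M \<and> (\<exists>T. is_terminal M T \<and> (\<exists>f \<in> hom M X T. f \<in> Fib M))"


section \<open>The homotopy category\<close>

text \<open>
  \<open>Ho M\<close> is the localization of \<open>M\<close> at its weak equivalences: morphisms are zigzags (words in the
  morphisms of \<open>M\<close> and formal inverses of weak equivalences), modulo the congruence generated by
  the identities and compositions of \<open>M\<close> and by the cancellation of inverses.  Words are written in
  diagrammatic order, the letter applied first standing at the head of the list.
\<close>

datatype 'a letter = Fwd 'a | Inv 'a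

primrec is_letter :: "('o, 'a, 'z) model_scheme \<Rightarrow> 'o \<Rightarrow> 'a letter \<Rightarrow> 'o \<Rightarrow> bool" where
  "is_letter M X (Fwd f) Y \<longleftrightarrow> f \<in> hom M X Y"
| "is_letter M X (Inv w) Y \<longleftrightarrow> w \<in> Weq M \<and> w \<in> hom M Y X"

primrec is_zigzag :: "('o, 'a, 'z) model_scheme \<Rightarrow> 'o \<Rightarrow> 'a letter list \<Rightarrow> 'o \<Rightarrow> bool" where
  "is_zigzag M X [] Y \<longleftrightarrow> X \<in> Obj M \<and> X = Y"
| "is_zigzag M X (l # ls) Y \<longleftrightarrow> (\<exists>Z. is_letter M X l Z \<and> is_zigzag M Z ls Y)"

inductive zigzag_step :: "('o, 'a, 'z) model_scheme \<Rightarrow> 'a letter list \<Rightarrow> 'a letter list \<Rightarrow> bool"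
  for M where
  comp: "f \<in> hom M X Y \<Longrightarrow> g \<in> hom M Y Z \<Longrightarrow> zigzag_step M [Fwd f, Fwd g] [Fwd (g \<cdot>\<^bsub>M\<^esub> f)]"
| ide: "X \<in> Obj M \<Longrightarrow> zigzag_step M [Fwd (Ide M X)] []"
| cancel_right: "w \<in> Weq M \<Longrightarrow> zigzag_step M [Fwd w, Inv w] []"
| cancel_left: "w \<in> Weq M \<Longrightarrow> zigzag_step M [Inv w, Fwd w] []"

inductive zigzag_eq ::
  "('o, 'a, 'z) model_scheme \<Rightarrow> 'o \<Rightarrow> 'o \<Rightarrow> 'a letter list \<Rightarrow> 'a letter list \<Rightarrow> bool"
  for M X Y where
  step: "zigzag_step M l r \<Longrightarrow> is_zigzag M X (u @ l @ v) Y \<Longrightarrow> is_zigzag M X (u @ r @ v) Y \<Longrightarrow>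
           zigzag_eq M X Y (u @ l @ v) (u @ r @ v)"
| refl: "is_zigzag M X p Y \<Longrightarrow> zigzag_eq M X Y p p"
| sym: "zigzag_eq M X Y p q \<Longrightarrow> zigzag_eq M X Y q p"
| trans: "zigzag_eq M X Y p q \<Longrightarrow> zigzag_eq M X Y q r \<Longrightarrow> zigzag_eq M X Y p r"

definition zigzag_class ::
  "('o, 'a, 'z) model_scheme \<Rightarrow> 'o \<Rightarrow> 'o \<Rightarrow> 'a letter list \<Rightarrow> 'a letter list set" where
  "zigzag_class M X Y p = {q. zigzag_eq M X Y p q}"

definition Ho :: "('o, 'a, 'z) model_scheme \<Rightarrow> ('o, 'o \<times> 'a letter list set \<times> 'o) cat" where
  "Ho M = \<lparr>Obj = Obj M,
     Arr = {(X, zigzag_class M X Y p, Y) | X Y p. is_zigzag M X p Y},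
     Dom = (\<lambda>(X, c, Y). X),
     Cod = (\<lambda>(X, c, Y). Y),
     Ide = (\<lambda>X. (X, zigzag_class M X X [], X)),
     Comp = (\<lambda>(_, d, Z) (X, c, _). (X, \<Union>p \<in> c. \<Union>q \<in> d. zigzag_class M X Z (p @ q), Z))\<rparr>"

definition to_Ho :: "('o, 'a, 'z) model_scheme \<Rightarrow> 'a \<Rightarrow> 'o \<times> 'a letter list set \<times> 'o" where
  "to_Ho M f = (Dom M f, zigzag_class M (Dom M f) (Cod M f) [Fwd f], Cod M f)"


section \<open>Homotopy fiber products and homotopy images\<close>

text \<open>
  The homotopy fiber product of \<open>g : A \<rightarrow> B\<close> and \<open>h : A' \<rightarrow> B\<close> is the value at this cospan of the
  right derived functor of the fiber product.  It is computed as the fiber product of a fibrant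
  replacement of the cospan: weak equivalences \<open>a\<close>, \<open>a'\<close>, \<open>b\<close> from \<open>A\<close>, \<open>A'\<close>, \<open>B\<close> to a cospan of
  fibrations \<open>g'\<close>, \<open>h'\<close> with fibrant target.
  \<open>is_homotopy_fiber_product M g h a a' p q\<close> says that \<open>p\<close>, \<open>q\<close> are the projections of such a
  fiber product.  Up to canonical isomorphism in \<open>Ho M\<close> it does not depend on the replacement.
\<close>

definition is_homotopy_fiber_product ::
  "('o, 'a, 'z) model_scheme \<Rightarrow> 'a \<Rightarrow> 'a \<Rightarrow> 'a \<Rightarrow> 'a \<Rightarrow> 'a \<Rightarrow> 'a \<Rightarrow> bool" where
  "is_homotopy_fiber_product M g h a a' p q \<longleftrightarrow>
     g \<in> Arr M \<and> h \<in> Arr M \<and> Cod M g = Cod M h \<and>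
     (\<exists>B' b g' h'. fibrant M B' \<and> b \<in> hom M (Cod M g) B' \<and>
        g' \<in> hom M (Cod M a) B' \<and> h' \<in> hom M (Cod M a') B' \<and>
        Dom M a = Dom M g \<and> Dom M a' = Dom M h \<and>
        a \<in> Weq M \<and> a' \<in> Weq M \<and> b \<in> Weq M \<and> g' \<in> Fib M \<and> h' \<in> Fib M \<and>
        g' \<cdot>\<^bsub>M\<^esub> a = b \<cdot>\<^bsub>M\<^esub> g \<and> h' \<cdot>\<^bsub>M\<^esub> a' = b \<cdot>\<^bsub>M\<^esub> h \<and>
        is_pullback M g' h' p q)"

text \<open>
  The morphism \<open>d\<close> with \<open>p \<cdot> d = a\<close> and \<open>q \<cdot> d = a'\<close> is the natural (diagonal) morphism from \<open>A\<close> to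
  the homotopy fiber product of \<open>g\<close> with itself.
\<close>

definition homotopy_mono :: "('o, 'a, 'z) model_scheme \<Rightarrow> 'a \<Rightarrow> bool" where
  "homotopy_mono M g \<longleftrightarrow> g \<in> Arr M \<and>
     (\<exists>a a' p q. is_homotopy_fiber_product M g g a a' p q \<and>
        (\<exists>d \<in> hom M (Dom M g) (Dom M p). p \<cdot>\<^bsub>M\<^esub> d = a \<and> q \<cdot>\<^bsub>M\<^esub> d = a' \<and> is_iso (Ho M) (to_Ho M d)))"

definition cof_hmono_factorization :: "('o, 'a, 'z) model_scheme \<Rightarrow> 'a \<Rightarrow> 'a \<Rightarrow> 'a \<Rightarrow> bool" where
  "cof_hmono_factorization M f i m \<longleftrightarrow>
     i \<in> Cof M \<and> homotopy_mono M m \<and> Cod M i = Dom M m \<and> m \<cdot>\<^bsub>M\<^esub> i = f"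

definition is_homotopy_image :: "('o, 'a, 'z) model_scheme \<Rightarrow> 'a \<Rightarrow> 'a \<Rightarrow> 'a \<Rightarrow> bool" where
  "is_homotopy_image M f i m \<longleftrightarrow> cof_hmono_factorization M f i m \<and>
     (\<forall>i' m'. cof_hmono_factorization M f i' m' \<longrightarrow>
        (\<exists>!h. h \<in> hom (Ho M) (Cod M i) (Cod M i') \<and>
           h \<cdot>\<^bsub>Ho M\<^esub> to_Ho M i = to_Ho M i' \<and>
           to_Ho M m' \<cdot>\<^bsub>Ho M\<^esub> h = to_Ho M m))"

end

theory Submission
  imports Defs
begin

text \<open>
  For a generating set \<open>I\<close> of cofibrations, a fibration \<open>m : A \<rightarrow> Y\<close> over a fibrant object is a homotopy
  monomorphism iff the projection \<open>A \<times>\<^sub>Y A \<rightarrow> A\<close> is a trivial fibration, that is, iff \<open>m\<close> has the right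
  lifting property for those squares from \<open>i \<in> I\<close> whose bottom map lifts to \<open>A\<close>.  Hence such an \<open>m\<close> is
  determined up to weak equivalence over \<open>Y\<close> by the set of maps from codomains of \<open>I\<close> to \<open>Y\<close> that
  lift to \<open>A\<close>: if every map that lifts to \<open>A'\<close> also lifts to \<open>A\<close>, then \<open>A \<times>\<^sub>Y A' \<rightarrow> A'\<close> is a trivial
  fibration.  So up to equivalence there is only a small set of such \<open>m\<close> through which \<open>f\<close>
  factors.  Their fiber product over \<open>Y\<close> is again a homotopy monomorphism, and factoring the induced
  map from \<open>X\<close> into a cofibration and a trivial fibration gives the homotopy image.  The map in the
  homotopy category is unique because homotopy monomorphisms are monic there.
\<close>

section \<open>Small sets\<close>

text \<open>The class of competing \<open>m\<close> may be large, but \<open>lifting_maps m\<close>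
  is a subset of the union of the sets \<open>hom M (Cod M i) Y\<close> over \<open>i\<close> in
  \<open>I\<close>. That union is small because \<open>\<kappa>\<close> is regular, and it has a
  small power set because \<open>\<kappa>\<close> is a strong limit. One representative for each
  value that occurs is enough for the fiber product. The main obstacle is that \<open>Ho M\<close>
  is built from bare zigzags, which gives no direct way to see when two maps become equal. For maps
  from a cofibrant to a fibrant object, equality in \<open>Ho M\<close> is shown to be right
  homotopy (\<open>\<gamma>_eq_htp\<close>), by letting zigzags act on homotopy classes. Two
  consequences carry the argument: homotopy monomorphisms over \<open>Y\<close> are monic in
  \<open>Ho M\<close>, and a fibration between fibrant objects that becomes invertible in
  \<open>Ho M\<close> is a weak equivalence. The second one turns the isomorphism demanded by
  \<open>homotopy_mono\<close> into a lifting property against \<open>I\<close>.\<close>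

lemma universe_infinite:
  assumes "universe_cardinal \<kappa>"
  shows "Card_order \<kappa>" "infinite (Field \<kappa>)" "Cinfinite \<kappa>"
proof -
  show c: "Card_order \<kappa>" using assms by (simp add: universe_cardinal_def)
  have "natLeq \<le>o \<kappa>" using assms by (simp add: universe_cardinal_def ordLess_imp_ordLeq)
  then show "Cinfinite \<kappa>" using c natLeq_Cinfinite by (metis cinfinite_mono)
  then show "infinite (Field \<kappa>)" by (simp add: cinfinite_def)
qed

text \<open>The completeness hypothesis and the strong limit clause speak only about
  \<open>'u\<close>. This supplies the relabelling that brings a small set of any type into
  \<open>'u\<close>.\<close>

lemma small_embed:
  fixes \<kappa> :: "'u rel"
  assumes "universe_cardinal \<kappa>" "small \<kappa> A"
  obtains g :: "'a \<Rightarrow> 'u" where "inj_on g A" "small \<kappa> (g ` A)"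
proof -
  have "|A| \<le>o |Field \<kappa>|"
    using assms universe_infinite(1)[OF assms(1)]
    by (meson card_of_Field_ordIso ordIso_symmetric ordLess_imp_ordLeq ordLess_ordIso_trans small_def)
  then obtain g :: "'a \<Rightarrow> 'u" where "inj_on g A" unfolding card_of_ordLeq[symmetric] by auto
  moreover have "small \<kappa> (g ` A)"
    using assms(2) by (meson card_of_image ordLeq_ordLess_trans small_def)
  ultimately show ?thesis using that by blast
qed

lemma small_subset: "small \<kappa> B \<Longrightarrow> A \<subseteq> B \<Longrightarrow> small \<kappa> A"
  by (meson card_of_mono1 ordLeq_ordLess_trans small_def)

lemma small_image: "small \<kappa> A \<Longrightarrow> small \<kappa> (f ` A)"
  by (meson card_of_image ordLeq_ordLess_trans small_def)

lemma small_finite: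
  assumes "universe_cardinal \<kappa>" "finite A"
  shows "small \<kappa> A"
proof -
  have "Well_order \<kappa>" using universe_infinite(1)[OF assms(1)] by (rule card_order_on_well_order_on)
  then show ?thesis
    unfolding small_def
    by (intro finite_ordLess_infinite card_of_Well_order)
      (simp_all add: assms universe_infinite(2)[OF assms(1)] Field_card_of)
qed

lemma small_Un: "universe_cardinal \<kappa> \<Longrightarrow> small \<kappa> A \<Longrightarrow> small \<kappa> B \<Longrightarrow> small \<kappa> (A \<union> B)"
  unfolding small_def using universe_infinite card_of_Un_ordLess_infinite_Field by blast

lemma small_UNION:
  assumes "universe_cardinal \<kappa>" "small \<kappa> I" "\<And>i. i \<in> I \<Longrightarrow> small \<kappa> (A i)"
  shows "small \<kappa> (\<Union>i\<in>I. A i)"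
  using assms card_of_UNION_ordLess_infinite_Field_regularCard[of \<kappa> I A] universe_infinite(3)[OF assms(1)]
  by (auto simp: small_def universe_cardinal_def)

text \<open>\<open>universe_cardinal\<close> bounds power sets of sets over \<open>'u\<close> only,
  hence the detour through a copy of \<open>A\<close> there.\<close>

lemma small_Pow:
  fixes \<kappa> :: "'u rel" and A :: "'a set"
  assumes "universe_cardinal \<kappa>" "small \<kappa> A"
  shows "small \<kappa> (Pow A)"
proof -
  obtain g :: "'a \<Rightarrow> 'u" where g: "inj_on g A" "small \<kappa> (g ` A)"
    using small_embed[OF assms] by blast
  have "small \<kappa> (Pow (g ` A))" using assms(1) g(2) by (simp add: universe_cardinal_def small_def)
  moreover have "|Pow A| \<le>o |Pow (g ` A)|"
    using inj_on_image_Pow[OF g(1)] image_Pow_mono[of g A "g ` A"] card_of_ordLeq by blast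
  ultimately show ?thesis by (meson ordLeq_ordLess_trans small_def)
qed

section \<open>Categories and wide pullbacks\<close>

lemma in_hom [simp]: "f \<in> hom C X Y \<longleftrightarrow> f \<in> Arr C \<and> Dom C f = X \<and> Cod C f = Y"
  by (simp add: hom_def)

context category
begin

lemma comp_simps [simp]:
  assumes "f \<in> Arr C" "g \<in> Arr C" "Cod C f = Dom C g"
  shows "g \<cdot> f \<in> Arr C" "Dom C (g \<cdot> f) = Dom C f" "Cod C (g \<cdot> f) = Cod C g"
  using Comp_hom[of f "Dom C f" "Dom C g" g "Cod C g"] assms by auto

lemma ide_simps [simp]:
  assumes "X \<in> Obj C"
  shows "Ide C X \<in> Arr C" "Dom C (Ide C X) = X" "Cod C (Ide C X) = X"
  using Ide_hom[OF assms] by auto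

lemma comp_ide [simp]:
  "f \<in> Arr C \<Longrightarrow> Cod C f = X \<Longrightarrow> Ide C X \<cdot> f = f"
  "f \<in> Arr C \<Longrightarrow> Dom C f = X \<Longrightarrow> f \<cdot> Ide C X = f"
  using Comp_Ide_left[of f "Dom C f" X] Comp_Ide_right[of f X "Cod C f"] by auto

lemma assoc:
  "f \<in> Arr C \<Longrightarrow> g \<in> Arr C \<Longrightarrow> h \<in> Arr C \<Longrightarrow> Cod C f = Dom C g \<Longrightarrow> Cod C g = Dom C h \<Longrightarrow>
    (h \<cdot> g) \<cdot> f = h \<cdot> (g \<cdot> f)"
  using Comp_assoc[of f "Dom C f" "Dom C g" g "Dom C h" h "Cod C h"] by auto

lemmas arr_Obj [simp] = Dom_Obj Cod_Obj

text \<open>\<open>small_complete\<close> quantifies over index categories with objects and arrows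
  in \<open>'u\<close>. The category \<open>K\<close> below is \<open>J\<close> renamed along
  injections into \<open>'u\<close>, and cones over the two diagrams correspond under the
  renaming.\<close>

lemma limit_exists:
  fixes \<kappa> :: "'u rel" and J :: "('i, 'j) cat"
  assumes u: "universe_cardinal \<kappa>" and sc: "small_complete \<kappa> C" and J: "category J"
    and so: "small \<kappa> (Obj J)" and sa: "small \<kappa> (Arr J)" and F: "is_functor J C Fo Fa"
  obtains L \<pi> where "is_limit J C Fo Fa L \<pi>"
proof -
  interpret J: category J by (rule J)
  obtain g :: "'i \<Rightarrow> 'u" where g: "inj_on g (Obj J)" "small \<kappa> (g ` Obj J)"
    using small_embed[OF u so] by blast
  obtain k :: "'j \<Rightarrow> 'u" where k: "inj_on k (Arr J)" "small \<kappa> (k ` Arr J)"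
    using small_embed[OF u sa] by blast
  define g' where "g' = inv_into (Obj J) g"
  define k' where "k' = inv_into (Arr J) k"
  have g': "\<And>i. i \<in> Obj J \<Longrightarrow> g' (g i) = i" using g by (simp add: g'_def)
  have k': "\<And>i. i \<in> Arr J \<Longrightarrow> k' (k i) = i" using k by (simp add: k'_def)
  define K :: "('u, 'u) cat" where "K = \<lparr>Obj = g ` Obj J, Arr = k ` Arr J,
    Dom = (\<lambda>a. g (Dom J (k' a))), Cod = (\<lambda>a. g (Cod J (k' a))), Ide = (\<lambda>x. k (Ide J (g' x))),
    Comp = (\<lambda>b a. k (k' b \<cdot>\<^bsub>J\<^esub> k' a))\<rparr>"
  have K_simps: "Obj K = g ` Obj J" "Arr K = k ` Arr J" "Dom K = (\<lambda>a. g (Dom J (k' a)))"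
    "Cod K = (\<lambda>a. g (Cod J (k' a)))" "Ide K = (\<lambda>x. k (Ide J (g' x)))"
    "Comp K = (\<lambda>b a. k (k' b \<cdot>\<^bsub>J\<^esub> k' a))"
    by (simp_all add: K_def)
  have geq: "\<And>x y. x \<in> Obj J \<Longrightarrow> y \<in> Obj J \<Longrightarrow> g x = g y \<longleftrightarrow> x = y"
    using g(1) by (auto dest: inj_onD)
  have "category K"
    by unfold_locales (auto simp: K_simps g' k' geq J.assoc)
  moreover have "is_functor K C (Fo \<circ> g') (Fa \<circ> k')"
    using F by (auto simp: is_functor_def K_simps g' k' geq)
  ultimately obtain L \<pi> where L: "is_limit K C (Fo \<circ> g') (Fa \<circ> k') L \<pi>"
    using sc g(2) k(2) unfolding small_complete_def by (metis K_simps(1,2))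
  have "is_limit J C Fo Fa L (\<pi> \<circ> g)"
    unfolding is_limit_def
  proof (intro conjI allI impI)
    show "is_cone J C Fo Fa L (\<pi> \<circ> g)"
      using L by (auto simp: is_limit_def is_cone_def K_simps g' k')
    fix L' \<pi>' assume "is_cone J C Fo Fa L' \<pi>'"
    then have "is_cone K C (Fo \<circ> g') (Fa \<circ> k') L' (\<pi>' \<circ> g')"
      by (auto simp: is_cone_def K_simps g' k')
    then have "\<exists>!u. u \<in> hom C L' L \<and> (\<forall>i\<in>Obj K. \<pi> i \<cdot> u = (\<pi>' \<circ> g') i)"
      using L unfolding is_limit_def by blast
    then show "\<exists>!u. u \<in> hom C L' L \<and> (\<forall>i\<in>Obj J. (\<pi> \<circ> g) i \<cdot> u = \<pi>' i)"
      by (simp add: K_simps g')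
  qed
  then show ?thesis using that by blast
qed

text \<open>The fiber product over \<open>Y\<close> of the whole family, \<open>b\<close> being its
  structure map to \<open>Y\<close>. Since \<open>b\<close> is part of the data, an empty
  \<open>S\<close> is covered as well: then \<open>b\<close> is an isomorphism onto
  \<open>Y\<close>.\<close>

definition wide_pullback :: "'i set \<Rightarrow> 'o \<Rightarrow> ('i \<Rightarrow> 'a) \<Rightarrow> 'a \<Rightarrow> ('i \<Rightarrow> 'a) \<Rightarrow> bool" where
  "wide_pullback S Y m b \<pi> \<longleftrightarrow> b \<in> hom C (Dom C b) Y \<and>
     (\<forall>s\<in>S. \<pi> s \<in> hom C (Dom C b) (Dom C (m s)) \<and> m s \<cdot> \<pi> s = b) \<and>
     (\<forall>Z b' \<pi>'. b' \<in> hom C Z Y \<and> (\<forall>s\<in>S. \<pi>' s \<in> hom C Z (Dom C (m s)) \<and> m s \<cdot> \<pi>' s = b') \<longrightarrow>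
        (\<exists>!u. u \<in> hom C Z (Dom C b) \<and> b \<cdot> u = b' \<and> (\<forall>s\<in>S. \<pi> s \<cdot> u = \<pi>' s)))"

lemma wide_pullback_exists:
  fixes S :: "'i set"
  assumes u: "universe_cardinal \<kappa>" and sc: "small_complete \<kappa> C" and S: "small \<kappa> S"
    and Y: "Y \<in> Obj C" and m: "\<And>s. s \<in> S \<Longrightarrow> m s \<in> Arr C \<and> Cod C (m s) = Y"
  obtains b \<pi> where "wide_pullback S Y m b \<pi>"
proof -
  \<comment> \<open>\<open>None\<close> is the vertex of \<open>Y\<close>. The arrow
    \<open>(x, False)\<close> is the identity at \<open>x\<close>, and \<open>(Some s, True)\<close>
    is the unique arrow from \<open>Some s\<close> to \<open>None\<close>.\<close>
  define J :: "('i option, 'i option \<times> bool) cat" where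
    "J = \<lparr>Obj = Some ` S \<union> {None}, Arr = (\<lambda>x. (x, False)) ` (Some ` S \<union> {None}) \<union> (\<lambda>s. (Some s, True)) ` S,
      Dom = fst, Cod = (\<lambda>(x, c). if c then None else x), Ide = (\<lambda>x. (x, False)),
      Comp = (\<lambda>g f. (fst f, snd f \<or> snd g))\<rparr>"
  define Fo where "Fo = (\<lambda>x. case x of None \<Rightarrow> Y | Some s \<Rightarrow> Dom C (m s))"
  define Fa where "Fa = (\<lambda>(x, c). if c then m (the x) else Ide C (Fo x))"
  have "category J" by unfold_locales (auto simp: J_def)
  moreover have "small \<kappa> (Obj J)" "small \<kappa> (Arr J)"
    unfolding J_def using S u by (simp_all add: small_Un small_image small_finite del: image_Un Un_insert_right)
  moreover have "is_functor J C Fo Fa"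
    using m Y by (auto simp: is_functor_def J_def Fo_def Fa_def)
  ultimately obtain L \<pi> where L: "is_limit J C Fo Fa L \<pi>"
    using limit_exists[OF u sc] by blast
  have cone: "is_cone J C Fo Fa Z \<rho> \<longleftrightarrow> \<rho> None \<in> hom C Z Y \<and>
      (\<forall>s\<in>S. \<rho> (Some s) \<in> hom C Z (Dom C (m s)) \<and> m s \<cdot> \<rho> (Some s) = \<rho> None)" for Z \<rho>
    using m Y unfolding is_cone_def J_def Fo_def Fa_def by (fastforce simp: ball_Un)
  have dom: "Dom C (\<pi> None) = L" using L by (auto simp: is_limit_def cone)
  have "wide_pullback S Y m (\<pi> None) (\<lambda>s. \<pi> (Some s))"
    unfolding wide_pullback_def
  proof (intro conjI allI impI)
    show "\<pi> None \<in> hom C (Dom C (\<pi> None)) Y"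
      "\<forall>s\<in>S. \<pi> (Some s) \<in> hom C (Dom C (\<pi> None)) (Dom C (m s)) \<and> m s \<cdot> \<pi> (Some s) = \<pi> None"
      using L by (auto simp: is_limit_def cone)
    fix Z b' \<pi>'
    assume "b' \<in> hom C Z Y \<and> (\<forall>s\<in>S. \<pi>' s \<in> hom C Z (Dom C (m s)) \<and> m s \<cdot> \<pi>' s = b')"
    then have "is_cone J C Fo Fa Z (case_option b' \<pi>')" by (simp add: cone)
    then have "\<exists>!u. u \<in> hom C Z L \<and> (\<forall>i\<in>Obj J. \<pi> i \<cdot> u = case_option b' \<pi>' i)"
      using L unfolding is_limit_def by blast
    then show "\<exists>!u. u \<in> hom C Z (Dom C (\<pi> None)) \<and> \<pi> None \<cdot> u = b' \<and> (\<forall>s\<in>S. \<pi> (Some s) \<cdot> u = \<pi>' s)"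
      by (simp add: dom J_def)
  qed
  then show ?thesis using that by blast
qed

lemma pullback_exists:
  assumes u: "universe_cardinal \<kappa>" and sc: "small_complete \<kappa> C"
    and fg: "f \<in> Arr C" "g \<in> Arr C" "Cod C f = Cod C g"
  obtains p q where "is_pullback C f g p q"
proof -
  define m where "m = (\<lambda>c. if c then f else g)"
  have "\<And>s. m s \<in> Arr C \<and> Cod C (m s) = Cod C f" "Cod C f \<in> Obj C" using fg by (simp_all add: m_def)
  then obtain b \<pi> where W: "wide_pullback UNIV (Cod C f) m b \<pi>"
    using wide_pullback_exists[OF u sc small_finite[OF u finite_UNIV]] by metis
  have \<pi>: "\<pi> True \<in> Arr C" "\<pi> False \<in> Arr C" "Dom C (\<pi> True) = Dom C b" "Dom C (\<pi> False) = Dom C b"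
    "Cod C (\<pi> True) = Dom C f" "Cod C (\<pi> False) = Dom C g" "f \<cdot> \<pi> True = b" "g \<cdot> \<pi> False = b"
    using W unfolding wide_pullback_def m_def by (auto dest: bspec[of _ _ True] bspec[of _ _ False])
  have "is_pullback C f g (\<pi> True) (\<pi> False)"
    unfolding is_pullback_def
  proof (intro conjI allI ballI impI)
    fix Z p' q' assume a: "p' \<in> hom C Z (Dom C f)" "q' \<in> hom C Z (Dom C g)" "f \<cdot> p' = g \<cdot> q'"
    have "\<exists>!u. u \<in> hom C Z (Dom C b) \<and> b \<cdot> u = f \<cdot> p' \<and> (\<forall>c\<in>UNIV. \<pi> c \<cdot> u = (if c then p' else q'))"
      using W[unfolded wide_pullback_def, THEN conjunct2, THEN conjunct2, rule_format,
          of "f \<cdot> p'" Z "\<lambda>c. if c then p' else q'"] a fg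
      by (simp add: m_def)
    moreover have "b \<cdot> u = f \<cdot> p'" if "u \<in> hom C Z (Dom C b)" "\<pi> True \<cdot> u = p'" for u
      using that \<pi> fg assoc[of u "\<pi> True" f] by auto
    ultimately have "\<exists>!u. u \<in> hom C Z (Dom C b) \<and> \<pi> True \<cdot> u = p' \<and> \<pi> False \<cdot> u = q'"
      unfolding UNIV_bool by (auto simp del: in_hom)
    then show "\<exists>!u. u \<in> hom C Z (Dom C (\<pi> True)) \<and> \<pi> True \<cdot> u = p' \<and> \<pi> False \<cdot> u = q'"
      by (simp only: \<pi>)
  qed (use \<pi> fg in auto)
  then show ?thesis using that by blast
qed

lemma pullback_lift:
  assumes "is_pullback C f g p q" "x \<in> Arr C" "y \<in> Arr C" "Dom C x = Dom C y"
    "Cod C x = Dom C f" "Cod C y = Dom C g" "f \<cdot> x = g \<cdot> y"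
  obtains u where "u \<in> Arr C" "Dom C u = Dom C x" "Cod C u = Dom C p" "p \<cdot> u = x" "q \<cdot> u = y"
proof -
  have "x \<in> hom C (Dom C x) (Dom C f)" "y \<in> hom C (Dom C x) (Dom C g)" using assms by auto
  then have "\<exists>!u. u \<in> hom C (Dom C x) (Dom C p) \<and> p \<cdot> u = x \<and> q \<cdot> u = y"
    using assms(1,7) unfolding is_pullback_def by blast
  then show ?thesis using that by auto
qed

lemma pullback_simps:
  assumes "is_pullback C f g p q"
  shows "f \<in> Arr C" "g \<in> Arr C" "p \<in> Arr C" "q \<in> Arr C" "Cod C f = Cod C g" "Cod C p = Dom C f"
    "Cod C q = Dom C g" "Dom C q = Dom C p" "f \<cdot> p = g \<cdot> q"
  using assms unfolding is_pullback_def by auto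

lemma pullback_unique:
  assumes P: "is_pullback C f g p q" and "u \<in> Arr C" "v \<in> Arr C" "Dom C u = Dom C v"
    "Cod C u = Dom C p" "Cod C v = Dom C p" "p \<cdot> u = p \<cdot> v" "q \<cdot> u = q \<cdot> v"
  shows "u = v"
proof -
  note s = pullback_simps[OF P]
  have "f \<cdot> (p \<cdot> v) = g \<cdot> (q \<cdot> v)" using s assms by (simp flip: assoc)
  then have "\<exists>!w. w \<in> hom C (Dom C v) (Dom C p) \<and> p \<cdot> w = p \<cdot> v \<and> q \<cdot> w = q \<cdot> v"
    using P s assms unfolding is_pullback_def by simp
  then show ?thesis using assms by auto
qed

lemma pullback_sym: "is_pullback C f g p q \<Longrightarrow> is_pullback C g f q p"
  unfolding is_pullback_def by (simp, metis)

end

section \<open>Right lifting properties\<close>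

context category
begin

text \<open>A rewriting device: in right-associated composites the left side of a known equation
  \<open>g \<cdot> f = k\<close> no longer occurs literally, and \<open>extend\<close> restates the
  equation with a further map on the right.\<close>

lemma extend:
  "g \<cdot> f = k \<Longrightarrow> f \<in> Arr C \<Longrightarrow> g \<in> Arr C \<Longrightarrow> x \<in> Arr C \<Longrightarrow> Cod C x = Dom C f \<Longrightarrow> Cod C f = Dom C g \<Longrightarrow>
    g \<cdot> (f \<cdot> x) = k \<cdot> x"
  by (simp flip: assoc)

lemma rlp_lift:
  assumes "p \<in> rlp C K" "i \<in> K" "u \<in> Arr C" "v \<in> Arr C" "Dom C u = Dom C i" "Cod C u = Dom C p"
    "Dom C v = Cod C i" "Cod C v = Cod C p" "p \<cdot> u = v \<cdot> i"
  obtains h where "h \<in> Arr C" "Dom C h = Cod C i" "Cod C h = Dom C p" "h \<cdot> i = u" "p \<cdot> h = v"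
proof -
  have "lifts C i p" using assms(1,2) by (simp add: rlp_def)
  then have "\<exists>h\<in>hom C (Cod C i) (Dom C p). h \<cdot> i = u \<and> p \<cdot> h = v"
    using assms(3-) unfolding lifts_def by (elim ballE[of _ _ u] ballE[of _ _ v]) auto
  then show ?thesis using that by auto
qed

lemma rlpI:
  assumes "p \<in> Arr C"
    "\<And>i u v. i \<in> K \<Longrightarrow> u \<in> Arr C \<Longrightarrow> v \<in> Arr C \<Longrightarrow> Dom C u = Dom C i \<Longrightarrow> Cod C u = Dom C p \<Longrightarrow>
      Dom C v = Cod C i \<Longrightarrow> Cod C v = Cod C p \<Longrightarrow> p \<cdot> u = v \<cdot> i \<Longrightarrow>
      \<exists>h. h \<in> Arr C \<and> Dom C h = Cod C i \<and> Cod C h = Dom C p \<and> h \<cdot> i = u \<and> p \<cdot> h = v"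
  shows "p \<in> rlp C K"
  using assms unfolding rlp_def lifts_def by (auto simp: Bex_def)

lemma rlp_comp:
  assumes K: "K \<subseteq> Arr C" and p: "p \<in> rlp C K" and q: "q \<in> rlp C K" and c: "Cod C p = Dom C q"
  shows "q \<cdot> p \<in> rlp C K"
proof (rule rlpI)
  have a: "p \<in> Arr C" "q \<in> Arr C" using p q by (auto simp: rlp_def)
  then show "q \<cdot> p \<in> Arr C" using c by simp
  fix i u v assume i: "i \<in> K" "u \<in> Arr C" "v \<in> Arr C" "Dom C u = Dom C i" "Cod C u = Dom C (q \<cdot> p)"
    "Dom C v = Cod C i" "Cod C v = Cod C (q \<cdot> p)" "(q \<cdot> p) \<cdot> u = v \<cdot> i"
  have i': "i \<in> Arr C" using K i by auto
  obtain k where k: "k \<in> Arr C" "Dom C k = Cod C i" "Cod C k = Dom C q" "k \<cdot> i = p \<cdot> u" "q \<cdot> k = v"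
    using rlp_lift[OF q \<open>i \<in> K\<close>, of "p \<cdot> u" v] i a c by (auto simp: assoc)
  obtain h where "h \<in> Arr C" "Dom C h = Cod C i" "Cod C h = Dom C p" "h \<cdot> i = u" "p \<cdot> h = k"
    using rlp_lift[OF p \<open>i \<in> K\<close>, of u k] i k a c by auto
  then show "\<exists>h. h \<in> Arr C \<and> Dom C h = Cod C i \<and> Cod C h = Dom C (q \<cdot> p) \<and> h \<cdot> i = u \<and> (q \<cdot> p) \<cdot> h = v"
    using k a c by (auto simp: assoc)
qed

lemma rlp_pullback:
  assumes K: "K \<subseteq> Arr C" and P: "is_pullback C f g p q" and f: "f \<in> rlp C K"
  shows "q \<in> rlp C K"
proof (rule rlpI)
  note s = pullback_simps[OF P]
  show "q \<in> Arr C" by (rule s)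
  fix i u v assume i: "i \<in> K" "u \<in> Arr C" "v \<in> Arr C" "Dom C u = Dom C i" "Cod C u = Dom C q"
    "Dom C v = Cod C i" "Cod C v = Cod C q" "q \<cdot> u = v \<cdot> i"
  have i': "i \<in> Arr C" using K i by auto
  have "f \<cdot> (p \<cdot> u) = (g \<cdot> v) \<cdot> i" using i i' s by (simp add: extend[OF s(9)] assoc)
  then obtain k where k: "k \<in> Arr C" "Dom C k = Cod C i" "Cod C k = Dom C f" "k \<cdot> i = p \<cdot> u" "f \<cdot> k = g \<cdot> v"
    using rlp_lift[OF f \<open>i \<in> K\<close>, of "p \<cdot> u" "g \<cdot> v"] i i' s by auto
  obtain h where h: "h \<in> Arr C" "Dom C h = Cod C i" "Cod C h = Dom C p" "p \<cdot> h = k" "q \<cdot> h = v"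
    using pullback_lift[OF P, of k v] k i s by auto
  have "h \<cdot> i = u"
    by (rule pullback_unique[OF P]) (use h i i' k s in \<open>auto simp flip: assoc\<close>)
  then show "\<exists>h. h \<in> Arr C \<and> Dom C h = Cod C i \<and> Cod C h = Dom C q \<and> h \<cdot> i = u \<and> q \<cdot> h = v"
    using h s by auto
qed

end

section \<open>Cofibrantly generated model categories\<close>

text \<open>Fixing generating sets makes fibrations and trivial fibrations lifting conditions, hence
  stable under base change. The description of trivial fibrations by \<open>I\<close> is what allows
  homotopy monomorphisms to be tested on a small set.\<close>

locale generated_model_category = category M
  for M :: "('o, 'a, 'z) model_scheme" (structure) +
  fixes \<kappa> :: "'u rel" and I J :: "'a set"
  assumes universe: "universe_cardinal \<kappa>"
    and model: "model_category \<kappa> M"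
    and I_arr: "I \<subseteq> Arr M" and J_arr: "J \<subseteq> Arr M"
    and Fib_eq: "Fib M = rlp M J"
    and TFib_eq: "Fib M \<inter> Weq M = rlp M I"
begin

abbreviation "TFib \<equiv> Fib M \<inter> Weq M"
abbreviation "TCof \<equiv> Cof M \<inter> Weq M"

lemma complete: "small_complete \<kappa> M" and cocomplete: "small_cocomplete \<kappa> M"
  using model by (auto simp: model_category_def)

lemma class_arr [simp]:
  "f \<in> Weq M \<Longrightarrow> f \<in> Arr M" "f \<in> Cof M \<Longrightarrow> f \<in> Arr M" "f \<in> Fib M \<Longrightarrow> f \<in> Arr M"
  using model by (auto simp: model_category_def)

lemma two_of_three:
  assumes "f \<in> Arr M" "g \<in> Arr M" "Cod M f = Dom M g"
  shows "f \<in> Weq M \<Longrightarrow> g \<in> Weq M \<Longrightarrow> g \<cdot> f \<in> Weq M"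
    "f \<in> Weq M \<Longrightarrow> g \<cdot> f \<in> Weq M \<Longrightarrow> g \<in> Weq M"
    "g \<in> Weq M \<Longrightarrow> g \<cdot> f \<in> Weq M \<Longrightarrow> f \<in> Weq M"
proof -
  have H: "\<forall>X Y Z. \<forall>f \<in> hom M X Y. \<forall>g \<in> hom M Y Z.
        (f \<in> Weq M \<and> g \<in> Weq M \<longrightarrow> g \<cdot> f \<in> Weq M) \<and>
        (f \<in> Weq M \<and> g \<cdot> f \<in> Weq M \<longrightarrow> g \<in> Weq M) \<and>
        (g \<in> Weq M \<and> g \<cdot> f \<in> Weq M \<longrightarrow> f \<in> Weq M)"
    using model unfolding model_category_def by (elim conjE) assumption
  have "(f \<in> Weq M \<and> g \<in> Weq M \<longrightarrow> g \<cdot> f \<in> Weq M) \<and>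
        (f \<in> Weq M \<and> g \<cdot> f \<in> Weq M \<longrightarrow> g \<in> Weq M) \<and>
        (g \<in> Weq M \<and> g \<cdot> f \<in> Weq M \<longrightarrow> f \<in> Weq M)"
    by (rule bspec[OF bspec[OF H[THEN spec, THEN spec, THEN spec]]]) (use assms in auto)
  then show "f \<in> Weq M \<Longrightarrow> g \<in> Weq M \<Longrightarrow> g \<cdot> f \<in> Weq M"
    "f \<in> Weq M \<Longrightarrow> g \<cdot> f \<in> Weq M \<Longrightarrow> g \<in> Weq M"
    "g \<in> Weq M \<Longrightarrow> g \<cdot> f \<in> Weq M \<Longrightarrow> f \<in> Weq M" by auto
qed

lemma factor_TCof_Fib:
  assumes "f \<in> Arr M"
  obtains i p where "i \<in> Cof M" "i \<in> Weq M" "p \<in> Fib M" "Cod M i = Dom M p" "p \<cdot> i = f"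
    "Dom M i = Dom M f" "Cod M p = Cod M f"
proof -
  have "\<forall>f \<in> Arr M. \<exists>i \<in> TCof. \<exists>p \<in> Fib M. Cod M i = Dom M p \<and> p \<cdot> i = f"
    using model unfolding model_category_def by (elim conjE) assumption
  then obtain i p where "i \<in> TCof" "p \<in> Fib M" "Cod M i = Dom M p" "p \<cdot> i = f"
    using assms by meson
  then show ?thesis using that by auto
qed

lemma factor_Cof_TFib:
  assumes "f \<in> Arr M"
  obtains i p where "i \<in> Cof M" "p \<in> Fib M" "p \<in> Weq M" "Cod M i = Dom M p" "p \<cdot> i = f"
    "Dom M i = Dom M f" "Cod M p = Cod M f"
proof -
  have "\<forall>f \<in> Arr M. \<exists>i \<in> Cof M. \<exists>p \<in> TFib. Cod M i = Dom M p \<and> p \<cdot> i = f"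
    using model unfolding model_category_def by (elim conjE) assumption
  then obtain i p where "i \<in> Cof M" "p \<in> TFib" "Cod M i = Dom M p" "p \<cdot> i = f"
    using assms by meson
  then show ?thesis using that by auto
qed

lemma lift:
  assumes "i \<in> Cof M" "p \<in> Fib M" "i \<in> Weq M \<or> p \<in> Weq M" "u \<in> Arr M" "v \<in> Arr M" "Dom M u = Dom M i"
    "Cod M u = Dom M p" "Dom M v = Cod M i" "Cod M v = Cod M p" "p \<cdot> u = v \<cdot> i"
  obtains h where "h \<in> Arr M" "Dom M h = Cod M i" "Cod M h = Dom M p" "h \<cdot> i = u" "p \<cdot> h = v"
proof -
  have "\<forall>i \<in> Cof M. \<forall>p \<in> Fib M. i \<in> Weq M \<or> p \<in> Weq M \<longrightarrow> lifts M i p"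
    using model unfolding model_category_def by (elim conjE) assumption
  then have "lifts M i p" using assms by blast
  then have "\<exists>h\<in>hom M (Cod M i) (Dom M p). h \<cdot> i = u \<and> p \<cdot> h = v"
    using assms(4-) unfolding lifts_def by (elim ballE[of _ _ u] ballE[of _ _ v]) auto
  then show ?thesis using that by auto
qed

text \<open>No axiom states this directly. Factoring the identity gives some weak equivalence
  \<open>i\<close> out of \<open>X\<close>, and two-of-three applies to the composite of
  \<open>i\<close> with the identity.\<close>

lemma weq_ide [simp]:
  assumes "X \<in> Obj M"
  shows "Ide M X \<in> Weq M"
proof -
  obtain i p where "i \<in> Weq M" "Dom M i = X"
    using factor_TCof_Fib[of "Ide M X"] assms by (metis ide_simps(1,2))
  then show ?thesis using two_of_three(3)[of "Ide M X" i] assms by simp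
qed

lemma weq_retract:
  assumes "s \<in> Arr M" "p \<in> Arr M" "Cod M s = Dom M p" "p \<cdot> s = Ide M (Dom M s)"
  shows "s \<in> Weq M \<longleftrightarrow> p \<in> Weq M"
  using assms two_of_three[of s p] by (metis arr_Obj(1) weq_ide)

lemma fib_comp: "p \<in> Fib M \<Longrightarrow> q \<in> Fib M \<Longrightarrow> Cod M p = Dom M q \<Longrightarrow> q \<cdot> p \<in> Fib M"
  unfolding Fib_eq by (rule rlp_comp[OF J_arr])

lemma pb:
  assumes "f \<in> Arr M" "g \<in> Arr M" "Cod M f = Cod M g"
  obtains p q where "is_pullback M f g p q"
  using pullback_exists[OF universe complete assms] by blast

lemma fib_pullback: "is_pullback M f g p q \<Longrightarrow> f \<in> Fib M \<Longrightarrow> q \<in> Fib M"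
  "is_pullback M f g p q \<Longrightarrow> g \<in> Fib M \<Longrightarrow> p \<in> Fib M"
  unfolding Fib_eq using rlp_pullback[OF J_arr] pullback_sym by blast+

lemma tfib_pullback: "is_pullback M f g p q \<Longrightarrow> f \<in> Fib M \<Longrightarrow> f \<in> Weq M \<Longrightarrow> q \<in> Weq M"
  "is_pullback M f g p q \<Longrightarrow> g \<in> Fib M \<Longrightarrow> g \<in> Weq M \<Longrightarrow> p \<in> Weq M"
  using rlp_pullback[OF I_arr] pullback_sym TFib_eq by (metis IntI IntD2)+

text \<open>By the retract argument, this says that the map from the initial object is a cofibration.\<close>

definition cofibrant :: "'o \<Rightarrow> bool" where
  "cofibrant W \<longleftrightarrow> W \<in> Obj M \<and>
     (\<forall>p v. p \<in> Fib M \<and> p \<in> Weq M \<and> v \<in> Arr M \<and> Dom M v = W \<and> Cod M v = Cod M p \<longrightarrow>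
        (\<exists>h. h \<in> Arr M \<and> Dom M h = W \<and> Cod M h = Dom M p \<and> p \<cdot> h = v))"

lemma cofibrant_lift:
  assumes "cofibrant (Dom M v)" "p \<in> Fib M" "p \<in> Weq M" "v \<in> Arr M" "Cod M v = Cod M p"
  obtains h where "h \<in> Arr M" "Dom M h = Dom M v" "Cod M h = Dom M p" "p \<cdot> h = v"
  using assms unfolding cofibrant_def by blast

lemma cofibrant_section:
  assumes "cofibrant (Cod M p)" "p \<in> Fib M" "p \<in> Weq M"
  obtains h where "h \<in> Arr M" "Dom M h = Cod M p" "Cod M h = Dom M p" "p \<cdot> h = Ide M (Cod M p)"
  using cofibrant_lift[of "Ide M (Cod M p)" p] assms by auto

lemma cofibrant_cof:
  assumes c: "c \<in> Cof M" and V: "cofibrant (Dom M c)"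
  shows "cofibrant (Cod M c)"
  unfolding cofibrant_def
proof (intro conjI allI impI)
  show "Cod M c \<in> Obj M" using c by simp
  fix p v assume a: "p \<in> Fib M \<and> p \<in> Weq M \<and> v \<in> Arr M \<and> Dom M v = Cod M c \<and> Cod M v = Cod M p"
  then obtain h where h: "h \<in> Arr M" "Dom M h = Dom M c" "Cod M h = Dom M p" "p \<cdot> h = v \<cdot> c"
    using cofibrant_lift[of "v \<cdot> c" p] V c by auto
  obtain k where "k \<in> Arr M" "Dom M k = Cod M c" "Cod M k = Dom M p" "k \<cdot> c = h" "p \<cdot> k = v"
    using lift[of c p h v] h c a by auto
  then show "\<exists>h. h \<in> Arr M \<and> Dom M h = Cod M c \<and> Cod M h = Dom M p \<and> p \<cdot> h = v" by blast
qed

section \<open>Cofibrant replacement of objects and maps\<close>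

lemma initial_exists:
  obtains E where "E \<in> Obj M" "\<And>X. X \<in> Obj M \<Longrightarrow> \<exists>!u. u \<in> hom M E X"
proof -
  define K :: "('u, 'u) cat" where
    "K = \<lparr>Obj = {}, Arr = {}, Dom = id, Cod = id, Ide = id, Comp = (\<lambda>_. id)\<rparr>"
  have "category K" by unfold_locales (auto simp: K_def)
  moreover have "small \<kappa> (Obj K)" "small \<kappa> (Arr K)" by (auto simp: K_def small_finite universe)
  moreover have "is_functor K M undefined undefined" by (auto simp: K_def is_functor_def)
  ultimately obtain L \<iota> where L: "is_colimit K M undefined undefined L \<iota>"
    using cocomplete unfolding small_cocomplete_def by blast
  then have "L \<in> Obj M" by (simp add: is_colimit_def is_cocone_def)
  moreover have "\<exists>!u. u \<in> hom M L X" if "X \<in> Obj M" for X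
  proof -
    have "is_cocone K M undefined undefined X undefined"
      using that by (auto simp: is_cocone_def K_def)
    then have "\<exists>!u. u \<in> hom M L X \<and> (\<forall>i\<in>Obj K. u \<cdot> \<iota> i = undefined i)"
      using L unfolding is_colimit_def by blast
    then show ?thesis by (simp add: K_def)
  qed
  ultimately show ?thesis using that by blast
qed

text \<open>Obtained by factoring the map from the initial object. That \<open>e\<close> is a
  trivial fibration, and not merely a weak equivalence, allows maps out of cofibrant objects to be
  lifted along it strictly.\<close>

lemma cofibrant_replacement_exists:
  assumes X: "X \<in> Obj M"
  shows "\<exists>e. e \<in> Fib M \<and> e \<in> Weq M \<and> Cod M e = X \<and> cofibrant (Dom M e)"
proof -
  obtain E where E: "E \<in> Obj M" "\<And>X. X \<in> Obj M \<Longrightarrow> \<exists>!u. u \<in> hom M E X" using initial_exists by blast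
  obtain u where u: "u \<in> Arr M" "Dom M u = E" "Cod M u = X" using E(2)[OF X] by auto
  have "cofibrant E"
    unfolding cofibrant_def
  proof (intro conjI allI impI)
    fix p v assume a: "p \<in> Fib M \<and> p \<in> Weq M \<and> v \<in> Arr M \<and> Dom M v = E \<and> Cod M v = Cod M p"
    then have "Dom M p \<in> Obj M" "Cod M p \<in> Obj M" by auto
    then obtain h where h: "h \<in> hom M E (Dom M p)" using E(2) by blast
    then have "p \<cdot> h = v" using E(2)[OF \<open>Cod M p \<in> Obj M\<close>] a by auto
    then show "\<exists>h. h \<in> Arr M \<and> Dom M h = E \<and> Cod M h = Dom M p \<and> p \<cdot> h = v" using h by auto
  qed (rule E)
  moreover obtain i p where "i \<in> Cof M" "p \<in> Fib M" "p \<in> Weq M" "Cod M i = Dom M p" "p \<cdot> i = u"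
    "Dom M i = Dom M u" "Cod M p = Cod M u" using factor_Cof_TFib[OF u(1)] by blast
  ultimately show ?thesis using u cofibrant_cof[of i] by auto
qed

definition crep :: "'o \<Rightarrow> 'a" where
  "crep X = (SOME e. e \<in> Fib M \<and> e \<in> Weq M \<and> Cod M e = X \<and> cofibrant (Dom M e))"

lemma crep [simp]:
  assumes "X \<in> Obj M"
  shows "crep X \<in> Fib M" "crep X \<in> Weq M" "Cod M (crep X) = X" "cofibrant (Dom M (crep X))"
  using someI_ex[OF cofibrant_replacement_exists[OF assms]] by (auto simp: crep_def)

lemma crep_arr [simp]: "X \<in> Obj M \<Longrightarrow> crep X \<in> Arr M" by simp

text \<open>The lift is chosen arbitrarily, so identities and composites are respected only up to
  homotopy; \<open>map_rel_ide\<close> and \<open>map_rel_funct\<close> deal with this.\<close>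

definition crep_map :: "'a \<Rightarrow> 'a" where
  "crep_map f = (SOME h. h \<in> Arr M \<and> Dom M h = Dom M (crep (Dom M f)) \<and> Cod M h = Dom M (crep (Cod M f)) \<and>
     crep (Cod M f) \<cdot> h = f \<cdot> crep (Dom M f))"

lemma crep_map [simp]:
  assumes "f \<in> Arr M"
  shows "crep_map f \<in> Arr M" "Dom M (crep_map f) = Dom M (crep (Dom M f))"
    "Cod M (crep_map f) = Dom M (crep (Cod M f))"
    and crep_map_eq: "crep (Cod M f) \<cdot> crep_map f = f \<cdot> crep (Dom M f)"
proof -
  have "\<exists>h. h \<in> Arr M \<and> Dom M h = Dom M (crep (Dom M f)) \<and> Cod M h = Dom M (crep (Cod M f)) \<and>
     crep (Cod M f) \<cdot> h = f \<cdot> crep (Dom M f)"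
    using cofibrant_lift[of "f \<cdot> crep (Dom M f)" "crep (Cod M f)"] assms by (metis comp_simps crep crep_arr arr_Obj)
  from someI_ex[OF this]
  show "crep_map f \<in> Arr M" "Dom M (crep_map f) = Dom M (crep (Dom M f))"
    "Cod M (crep_map f) = Dom M (crep (Cod M f))"
    "crep (Cod M f) \<cdot> crep_map f = f \<cdot> crep (Dom M f)" by (simp_all add: crep_map_def)
qed

lemma crep_map_weq: "f \<in> Weq M \<Longrightarrow> crep_map f \<in> Weq M"
  using two_of_three(3)[of "crep_map f" "crep (Cod M f)"] two_of_three(1)[of "crep (Dom M f)" f]
  by (simp add: crep_map_eq)

section \<open>Fibrant objects\<close>

lemma fibrant_Obj: "fibrant M Y \<Longrightarrow> Y \<in> Obj M"
  by (simp add: fibrant_def)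

text \<open>Lift against the fibration from \<open>Y\<close> to a terminal object; the square
  commutes because its corner is terminal.\<close>

lemma fibrant_extend:
  assumes "fibrant M Y" "c \<in> Cof M" "c \<in> Weq M" "x \<in> Arr M" "Dom M x = Dom M c" "Cod M x = Y"
  obtains h where "h \<in> Arr M" "Dom M h = Cod M c" "Cod M h = Y" "h \<cdot> c = x"
proof -
  obtain T t where T: "is_terminal M T" and t: "t \<in> Fib M" "Dom M t = Y" "Cod M t = T"
    using assms(1) by (auto simp: fibrant_def)
  obtain v where v: "v \<in> hom M (Cod M c) T"
    using T assms(2) unfolding is_terminal_def by (meson arr_Obj(2) class_arr(2))
  have "t \<cdot> x \<in> hom M (Dom M c) T" "v \<cdot> c \<in> hom M (Dom M c) T" using v t assms by auto
  then have "t \<cdot> x = v \<cdot> c" using T assms(2) by (metis arr_Obj(1) class_arr(2) is_terminal_def)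
  then obtain h where "h \<in> Arr M" "Dom M h = Cod M c" "Cod M h = Dom M t" "h \<cdot> c = x"
    by (rule lift[of c t x v, rotated 9]) (use v t assms(2-) in simp_all)
  then show ?thesis using that t by simp
qed

lemma fibrant_fib:
  assumes "m \<in> Fib M" "fibrant M (Cod M m)"
  shows "fibrant M (Dom M m)"
proof -
  obtain T t where "is_terminal M T" "t \<in> Fib M" "Dom M t = Cod M m" "Cod M t = T"
    using assms(2) by (auto simp: fibrant_def)
  then show ?thesis unfolding fibrant_def using fib_comp[of m t] assms(1)
    by (intro conjI exI[of _ T] bexI[of _ "t \<cdot> m"]) auto
qed

section \<open>Path objects and homotopies\<close>

text \<open>The last clause says that the map from the path object to \<open>Y \<times> Y\<close>
  with components \<open>p\<^sub>0\<close> and \<open>p\<^sub>1\<close> lifts against trivial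
  cofibrations, as a fibration does, without naming a product in \<open>M\<close>.\<close>

definition path_object :: "'o \<Rightarrow> 'a \<Rightarrow> 'a \<Rightarrow> 'a \<Rightarrow> bool" where
  "path_object Y s p\<^sub>0 p\<^sub>1 \<longleftrightarrow> s \<in> Weq M \<and> Dom M s = Y \<and> Dom M p\<^sub>0 = Cod M s \<and> Dom M p\<^sub>1 = Cod M s \<and>
     Cod M p\<^sub>0 = Y \<and> Cod M p\<^sub>1 = Y \<and> p\<^sub>0 \<in> Fib M \<and> p\<^sub>0 \<in> Weq M \<and> p\<^sub>1 \<in> Fib M \<and> p\<^sub>1 \<in> Weq M \<and>
     p\<^sub>0 \<cdot> s = Ide M Y \<and> p\<^sub>1 \<cdot> s = Ide M Y \<and>
     (\<forall>c u v\<^sub>0 v\<^sub>1. c \<in> Cof M \<and> c \<in> Weq M \<and> u \<in> hom M (Dom M c) (Cod M s) \<and>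
        v\<^sub>0 \<in> hom M (Cod M c) Y \<and> v\<^sub>1 \<in> hom M (Cod M c) Y \<and> p\<^sub>0 \<cdot> u = v\<^sub>0 \<cdot> c \<and> p\<^sub>1 \<cdot> u = v\<^sub>1 \<cdot> c \<longrightarrow>
        (\<exists>h. h \<in> hom M (Cod M c) (Cod M s) \<and> h \<cdot> c = u \<and> p\<^sub>0 \<cdot> h = v\<^sub>0 \<and> p\<^sub>1 \<cdot> h = v\<^sub>1))"

lemma path_object_lift:
  assumes "path_object Y s p\<^sub>0 p\<^sub>1" "c \<in> Cof M" "c \<in> Weq M" "u \<in> hom M (Dom M c) (Cod M s)"
    "v\<^sub>0 \<in> hom M (Cod M c) Y" "v\<^sub>1 \<in> hom M (Cod M c) Y" "p\<^sub>0 \<cdot> u = v\<^sub>0 \<cdot> c" "p\<^sub>1 \<cdot> u = v\<^sub>1 \<cdot> c"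
  obtains h where "h \<in> Arr M" "Dom M h = Cod M c" "Cod M h = Cod M s" "h \<cdot> c = u" "p\<^sub>0 \<cdot> h = v\<^sub>0" "p\<^sub>1 \<cdot> h = v\<^sub>1"
  using assms unfolding path_object_def by (metis in_hom)

lemma path_object_simps:
  assumes "path_object Y s p\<^sub>0 p\<^sub>1"
  shows "Y \<in> Obj M" "s \<in> Weq M" "Dom M s = Y" "Dom M p\<^sub>0 = Cod M s" "Dom M p\<^sub>1 = Cod M s" "Cod M p\<^sub>0 = Y" "Cod M p\<^sub>1 = Y"
    "p\<^sub>0 \<in> Fib M" "p\<^sub>0 \<in> Weq M" "p\<^sub>1 \<in> Fib M" "p\<^sub>1 \<in> Weq M" "p\<^sub>0 \<cdot> s = Ide M Y" "p\<^sub>1 \<cdot> s = Ide M Y"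
    "s \<in> Arr M" "p\<^sub>0 \<in> Arr M" "p\<^sub>1 \<in> Arr M"
  using assms unfolding path_object_def by auto

text \<open>The product \<open>Y \<times> Y\<close> is the pullback of \<open>t\<close> with itself
  over a terminal object. Its diagonal \<open>d\<close> is factored as a trivial cofibration
  \<open>s\<close> followed by a fibration \<open>r\<close>; the ends are weak equivalences because
  \<open>s\<close> is a section of both.\<close>

lemma path_object_exists:
  assumes Y: "fibrant M Y"
  obtains s p\<^sub>0 p\<^sub>1 where "path_object Y s p\<^sub>0 p\<^sub>1"
proof -
  note Yo = fibrant_Obj[OF Y]
  obtain T t where T: "is_terminal M T" and t: "t \<in> Fib M" "Dom M t = Y" "Cod M t = T"
    using Y by (auto simp: fibrant_def)
  have Tu: "x = y" if "x \<in> Arr M" "y \<in> Arr M" "Dom M x = Dom M y" "Cod M x = T" "Cod M y = T" for x y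
    using T that unfolding is_terminal_def by (metis arr_Obj(1) in_hom)
  obtain a b where P: "is_pullback M t t a b" using pb[of t t] t by auto
  note ab = pullback_simps[OF P]
  have abf: "a \<in> Fib M" "b \<in> Fib M" using fib_pullback[OF P] t by auto
  obtain d where d: "d \<in> Arr M" "Dom M d = Y" "Cod M d = Dom M a" "a \<cdot> d = Ide M Y" "b \<cdot> d = Ide M Y"
    using pullback_lift[OF P, of "Ide M Y" "Ide M Y"] t Yo by auto
  obtain s r where s: "s \<in> Cof M" "s \<in> Weq M" "r \<in> Fib M" "Cod M s = Dom M r" "r \<cdot> s = d"
    "Dom M s = Dom M d" "Cod M r = Cod M d" using factor_TCof_Fib[OF d(1)] by blast
  have w: "a \<cdot> r \<in> Weq M" "b \<cdot> r \<in> Weq M"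
    using weq_retract[of s "a \<cdot> r"] weq_retract[of s "b \<cdot> r"] s d ab by (auto simp: assoc)
  have "path_object Y s (a \<cdot> r) (b \<cdot> r)"
    unfolding path_object_def
  proof (intro conjI allI impI)
    show "a \<cdot> r \<in> Fib M" "b \<cdot> r \<in> Fib M" using s d ab abf by (auto intro!: fib_comp)
    show "a \<cdot> r \<cdot> s = Ide M Y" "b \<cdot> r \<cdot> s = Ide M Y" using s d ab by (auto simp: assoc)
    fix c u v\<^sub>0 v\<^sub>1
    assume A: "c \<in> Cof M \<and> c \<in> Weq M \<and> u \<in> hom M (Dom M c) (Cod M s) \<and>
        v\<^sub>0 \<in> hom M (Cod M c) Y \<and> v\<^sub>1 \<in> hom M (Cod M c) Y \<and> a \<cdot> r \<cdot> u = v\<^sub>0 \<cdot> c \<and> b \<cdot> r \<cdot> u = v\<^sub>1 \<cdot> c"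
    have "t \<cdot> v\<^sub>0 = t \<cdot> v\<^sub>1" by (rule Tu) (use A t in auto)
    then obtain v where v: "v \<in> Arr M" "Dom M v = Cod M c" "Cod M v = Dom M a" "a \<cdot> v = v\<^sub>0" "b \<cdot> v = v\<^sub>1"
      using pullback_lift[OF P, of v\<^sub>0 v\<^sub>1] A t by auto
    have "r \<cdot> u = v \<cdot> c"
      by (rule pullback_unique[OF P]) (use A v s d ab in \<open>auto simp flip: assoc\<close>)
    then obtain h where h: "h \<in> Arr M" "Dom M h = Cod M c" "Cod M h = Dom M r" "h \<cdot> c = u" "r \<cdot> h = v"
      using lift[of c r u v] A v s d ab by auto
    then show "\<exists>h. h \<in> hom M (Cod M c) (Cod M s) \<and> h \<cdot> c = u \<and> a \<cdot> r \<cdot> h = v\<^sub>0 \<and> b \<cdot> r \<cdot> h = v\<^sub>1"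
      using A v s d ab by (auto simp: assoc)
  qed (use s d ab w Yo t in auto)
  then show ?thesis using that by blast
qed

text \<open>The source data form only a weak path object on \<open>C\<close>: two retractions of a
  weak equivalence \<open>s\<close>, with no fibration condition. Replacing \<open>s\<close> by a
  trivial cofibration \<open>c\<close> lets \<open>s' \<cdot> g\<close> extend over it into a
  genuine path object of \<open>Y\<close>, while cofibrancy lifts \<open>H\<close> through the
  remaining trivial fibration. This handles change of path object, reversal, gluing and
  postcomposition at once.\<close>

lemma homotopy_post:
  assumes W: "cofibrant (Dom M H)" and s: "s \<in> Weq M" "Dom M s = C"
    and p: "p\<^sub>0 \<in> hom M (Cod M s) C" "p\<^sub>1 \<in> hom M (Cod M s) C" "p\<^sub>0 \<cdot> s = Ide M C" "p\<^sub>1 \<cdot> s = Ide M C"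
    and H: "H \<in> Arr M" "Cod M H = Cod M s" and g: "g \<in> hom M C Y"
    and P: "path_object Y s' p\<^sub>0' p\<^sub>1'"
  obtains H' where "H' \<in> Arr M" "Dom M H' = Dom M H" "Cod M H' = Cod M s'"
    "p\<^sub>0' \<cdot> H' = g \<cdot> (p\<^sub>0 \<cdot> H)" "p\<^sub>1' \<cdot> H' = g \<cdot> (p\<^sub>1 \<cdot> H)"
proof -
  note P' = path_object_simps[OF P]
  obtain c t where c: "c \<in> Cof M" "t \<in> Fib M" "t \<in> Weq M" "Cod M c = Dom M t" "t \<cdot> c = s"
    "Dom M c = Dom M s" "Cod M t = Cod M s" using factor_Cof_TFib[of s] s by auto
  have cw: "c \<in> Weq M" using two_of_three(3)[of c t] c s by auto
  obtain K where K: "K \<in> Arr M" "Dom M K = Dom M H" "Cod M K = Dom M t" "t \<cdot> K = H"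
    using cofibrant_lift[OF W c(2,3)] H c by auto
  obtain h where h: "h \<in> Arr M" "Dom M h = Cod M c" "Cod M h = Cod M s'" "h \<cdot> c = s' \<cdot> g"
    "p\<^sub>0' \<cdot> h = g \<cdot> (p\<^sub>0 \<cdot> t)" "p\<^sub>1' \<cdot> h = g \<cdot> (p\<^sub>1 \<cdot> t)"
    by (rule path_object_lift[OF P c(1) cw, of "s' \<cdot> g" "g \<cdot> (p\<^sub>0 \<cdot> t)" "g \<cdot> (p\<^sub>1 \<cdot> t)"])
      (use c s p g P' in \<open>auto simp: assoc extend[OF P'(12)] extend[OF P'(13)]\<close>)
  show ?thesis
    by (rule that[of "h \<cdot> K"])
      (use h K c s p g P' in \<open>auto simp: assoc extend[OF h(5)] extend[OF h(6)]\<close>)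
qed

text \<open>Right homotopy through some path object. For maps out of a cofibrant object the choice
  is immaterial, since \<open>homotopy_post\<close> with the identity of \<open>Y\<close> moves a
  homotopy to any other path object.\<close>

definition htp :: "'o \<Rightarrow> 'a \<Rightarrow> 'a \<Rightarrow> bool" where
  "htp Y a b \<longleftrightarrow> (\<exists>s p\<^sub>0 p\<^sub>1 H. path_object Y s p\<^sub>0 p\<^sub>1 \<and> H \<in> Arr M \<and> Cod M H = Cod M s \<and> p\<^sub>0 \<cdot> H = a \<and> p\<^sub>1 \<cdot> H = b)"

lemma htp_simps:
  assumes "htp Y a b"
  shows "a \<in> Arr M" "b \<in> Arr M" "Dom M a = Dom M b" "Cod M a = Y" "Cod M b = Y"
proof -
  obtain s p\<^sub>0 p\<^sub>1 H where P: "path_object Y s p\<^sub>0 p\<^sub>1" and H: "H \<in> Arr M" "Cod M H = Cod M s" "p\<^sub>0 \<cdot> H = a" "p\<^sub>1 \<cdot> H = b"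
    using assms unfolding htp_def by blast
  show "a \<in> Arr M" "b \<in> Arr M" "Dom M a = Dom M b" "Cod M a = Y" "Cod M b = Y"
    using H(1,2) path_object_simps[OF P] by (simp_all flip: H(3,4))
qed

lemma htpE:
  assumes "htp Y a b"
  obtains s p\<^sub>0 p\<^sub>1 H where "path_object Y s p\<^sub>0 p\<^sub>1" "H \<in> Arr M" "Cod M H = Cod M s" "p\<^sub>0 \<cdot> H = a" "p\<^sub>1 \<cdot> H = b"
    "Dom M H = Dom M a"
proof -
  obtain s p\<^sub>0 p\<^sub>1 H where P: "path_object Y s p\<^sub>0 p\<^sub>1" and H: "H \<in> Arr M" "Cod M H = Cod M s" "p\<^sub>0 \<cdot> H = a" "p\<^sub>1 \<cdot> H = b"
    using assms unfolding htp_def by blast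
  have "Dom M H = Dom M a" using H(1,2) path_object_simps[OF P] by (simp flip: H(3))
  then show ?thesis by (rule that[OF P H])
qed

lemma htp_pre:
  assumes "htp Y a b" "x \<in> Arr M" "Cod M x = Dom M a"
  shows "htp Y (a \<cdot> x) (b \<cdot> x)"
proof -
  obtain s p\<^sub>0 p\<^sub>1 H where P: "path_object Y s p\<^sub>0 p\<^sub>1" and H: "H \<in> Arr M" "Cod M H = Cod M s" "p\<^sub>0 \<cdot> H = a" "p\<^sub>1 \<cdot> H = b" "Dom M H = Dom M a"
    using assms(1) by (rule htpE)
  note P' = path_object_simps[OF P]
  show ?thesis unfolding htp_def
    by (rule exI[of _ s], rule exI[of _ p\<^sub>0], rule exI[of _ p\<^sub>1], rule exI[of _ "H \<cdot> x"])
      (use P P' H htp_simps[OF assms(1)] assms(2,3) in \<open>simp add: extend[OF H(3)] extend[OF H(4)]\<close>)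
qed

lemma htp_weak:
  assumes "fibrant M Y" "cofibrant (Dom M H)" "s \<in> Weq M" "Dom M s = C"
    "p\<^sub>0 \<in> hom M (Cod M s) C" "p\<^sub>1 \<in> hom M (Cod M s) C" "p\<^sub>0 \<cdot> s = Ide M C" "p\<^sub>1 \<cdot> s = Ide M C"
    "H \<in> Arr M" "Cod M H = Cod M s" "g \<in> hom M C Y"
  shows "htp Y (g \<cdot> (p\<^sub>0 \<cdot> H)) (g \<cdot> (p\<^sub>1 \<cdot> H))"
proof -
  obtain s' p\<^sub>0' p\<^sub>1' where P: "path_object Y s' p\<^sub>0' p\<^sub>1'" using path_object_exists[OF assms(1)] .
  show ?thesis using homotopy_post[OF assms(2-11) P] P unfolding htp_def by metis
qed

lemma htp_refl:
  assumes "fibrant M Y" "a \<in> Arr M" "Cod M a = Y"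
  shows "htp Y a a"
proof -
  obtain s p\<^sub>0 p\<^sub>1 where P: "path_object Y s p\<^sub>0 p\<^sub>1" using path_object_exists[OF assms(1)] .
  note P' = path_object_simps[OF P]
  show ?thesis unfolding htp_def
    by (rule exI[of _ s], rule exI[of _ p\<^sub>0], rule exI[of _ p\<^sub>1], rule exI[of _ "s \<cdot> a"])
      (use P P' assms in \<open>auto simp: extend[OF P'(12)] extend[OF P'(13)]\<close>)
qed

lemma htp_sym:
  assumes "fibrant M Y" "cofibrant (Dom M a)" "htp Y a b"
  shows "htp Y b a"
proof -
  obtain s p\<^sub>0 p\<^sub>1 H where P: "path_object Y s p\<^sub>0 p\<^sub>1" and H: "H \<in> Arr M" "Cod M H = Cod M s" "p\<^sub>0 \<cdot> H = a" "p\<^sub>1 \<cdot> H = b" "Dom M H = Dom M a"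
    using assms(3) by (rule htpE)
  note P' = path_object_simps[OF P]
  have "htp Y (Ide M Y \<cdot> (p\<^sub>1 \<cdot> H)) (Ide M Y \<cdot> (p\<^sub>0 \<cdot> H))"
    using htp_weak[of Y H s Y p\<^sub>1 p\<^sub>0 "Ide M Y"] assms(1,2) P' H by simp
  then show ?thesis unfolding H using htp_simps[OF assms(3)] by simp
qed

lemma htp_trans:
  assumes "fibrant M Y" "cofibrant (Dom M a)" "htp Y a b" "htp Y b c"
  shows "htp Y a c"
proof -
  obtain s p\<^sub>0 p\<^sub>1 H where P: "path_object Y s p\<^sub>0 p\<^sub>1" and H: "H \<in> Arr M" "Cod M H = Cod M s" "p\<^sub>0 \<cdot> H = a" "p\<^sub>1 \<cdot> H = b" "Dom M H = Dom M a"
    using assms(3) by (rule htpE)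
  obtain s' q\<^sub>0 q\<^sub>1 H' where Q: "path_object Y s' q\<^sub>0 q\<^sub>1" and H': "H' \<in> Arr M" "Cod M H' = Cod M s'" "q\<^sub>0 \<cdot> H' = b" "q\<^sub>1 \<cdot> H' = c" "Dom M H' = Dom M b"
    using assms(4) by (rule htpE)
  note P' = path_object_simps[OF P] note Q' = path_object_simps[OF Q]
  \<comment> \<open>Gluing the two path objects end to start. The result need not satisfy
    \<open>path_object\<close>; it suffices for \<open>htp_weak\<close> that its outer ends are
    retractions of the weak equivalence \<open>d\<close>.\<close>
  obtain u v where R: "is_pullback M p\<^sub>1 q\<^sub>0 u v" using pb[of p\<^sub>1 q\<^sub>0] P' Q' by auto
  note R' = pullback_simps[OF R]
  have uw: "u \<in> Weq M" using tfib_pullback[OF R] Q' by auto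
  obtain d where d: "d \<in> Arr M" "Dom M d = Y" "Cod M d = Dom M u" "u \<cdot> d = s" "v \<cdot> d = s'"
    using pullback_lift[OF R, of s s'] P' Q' by auto
  have dw: "d \<in> Weq M" using two_of_three(3)[of d u] d uw R' P' by auto
  have Da: "Dom M H = Dom M a" "Dom M H' = Dom M b" "Dom M a = Dom M b" using H H' P' Q' by auto
  obtain K where K: "K \<in> Arr M" "Dom M K = Dom M H" "Cod M K = Dom M u" "u \<cdot> K = H" "v \<cdot> K = H'"
    using pullback_lift[OF R, of H H'] P' Q' H H' Da by auto
  have "htp Y (Ide M Y \<cdot> ((p\<^sub>0 \<cdot> u) \<cdot> K)) (Ide M Y \<cdot> ((q\<^sub>1 \<cdot> v) \<cdot> K))"
    by (rule htp_weak[OF assms(1) _ dw])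
      (use d R' P' Q' K assms(2) Da in \<open>auto simp: assoc\<close>)
  then show ?thesis using K R' P' Q' H H' htp_simps[OF assms(3)] htp_simps[OF assms(4)] by (simp add: assoc)
qed

lemma htp_trans2:
  assumes "fibrant M Y" "cofibrant (Dom M a)" "htp Y a b" "htp Y a c"
  shows "htp Y b c"
  using assms htp_sym htp_trans htp_simps by metis

text \<open>The fiber product of \<open>e\<close> with itself, together with its diagonal, is a weak
  path object on \<open>Dom M e\<close>, and the pair of \<open>a\<close> and \<open>b\<close> is a
  homotopy in it. Hence the choice of a lift along a trivial fibration does not matter up to
  homotopy.\<close>

lemma htp_tfib_eq:
  assumes Y: "fibrant M Y" and e: "e \<in> Fib M" "e \<in> Weq M" and a: "a \<in> Arr M" "b \<in> Arr M" "Dom M a = Dom M b"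
    "cofibrant (Dom M a)" "Cod M a = Dom M e" "Cod M b = Dom M e" "e \<cdot> a = e \<cdot> b"
    and y: "y \<in> Arr M" "Dom M y = Dom M e" "Cod M y = Y"
  shows "htp Y (y \<cdot> a) (y \<cdot> b)"
proof -
  obtain u v where R: "is_pullback M e e u v" using pb[of e e] e by auto
  note R' = pullback_simps[OF R]
  obtain d where d: "d \<in> Arr M" "Dom M d = Dom M e" "Cod M d = Dom M u" "u \<cdot> d = Ide M (Dom M e)" "v \<cdot> d = Ide M (Dom M e)"
    using pullback_lift[OF R, of "Ide M (Dom M e)" "Ide M (Dom M e)"] e by auto
  have dw: "d \<in> Weq M" using weq_retract[of d u] tfib_pullback[OF R] e d R' by auto
  obtain K where K: "K \<in> Arr M" "Dom M K = Dom M a" "Cod M K = Dom M u" "u \<cdot> K = a" "v \<cdot> K = b"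
    using pullback_lift[OF R, of a b] a by auto
  have "htp Y (y \<cdot> (u \<cdot> K)) (y \<cdot> (v \<cdot> K))"
    by (rule htp_weak[OF Y _ dw]) (use d R' K a y in auto)
  then show ?thesis using K by simp
qed

text \<open>Write \<open>w\<close> as a trivial cofibration \<open>c\<close> followed by a trivial
  fibration \<open>t\<close>. The homotopy extends over \<open>c\<close> by the lifting clause of
  the path object, and \<open>t\<close> is removed by a section, which exists because
  \<open>Cod M w\<close> is cofibrant.\<close>

lemma htp_weq_inj:
  assumes Y: "fibrant M Y" and w: "w \<in> Weq M" "cofibrant (Dom M w)" "cofibrant (Cod M w)"
    and xy: "x \<in> Arr M" "y \<in> Arr M" "Dom M x = Cod M w" "Dom M y = Cod M w" "Cod M x = Y" "Cod M y = Y"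
    and h: "htp Y (x \<cdot> w) (y \<cdot> w)"
  shows "htp Y x y"
proof -
  obtain c t where c: "c \<in> Cof M" "t \<in> Fib M" "t \<in> Weq M" "Cod M c = Dom M t" "t \<cdot> c = w"
    "Dom M c = Dom M w" "Cod M t = Cod M w" using factor_Cof_TFib[of w] w by auto
  have cw: "c \<in> Weq M" using two_of_three(3)[of c t] c w by auto
  obtain \<sigma> where \<sigma>: "\<sigma> \<in> Arr M" "Dom M \<sigma> = Cod M w" "Cod M \<sigma> = Dom M t" "t \<cdot> \<sigma> = Ide M (Cod M w)"
    using cofibrant_section[of t] c w by auto
  obtain s p\<^sub>0 p\<^sub>1 H where P: "path_object Y s p\<^sub>0 p\<^sub>1" and H: "H \<in> Arr M" "Cod M H = Cod M s" "p\<^sub>0 \<cdot> H = x \<cdot> w" "p\<^sub>1 \<cdot> H = y \<cdot> w" "Dom M H = Dom M (x \<cdot> w)"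
    using h by (rule htpE)
  note P' = path_object_simps[OF P]
  have DH: "Dom M H = Dom M w" using H(5) xy w by simp
  obtain K where "K \<in> Arr M" "Dom M K = Cod M c" "Cod M K = Cod M s" "K \<cdot> c = H" "p\<^sub>0 \<cdot> K = x \<cdot> t" "p\<^sub>1 \<cdot> K = y \<cdot> t"
    by (rule path_object_lift[OF P c(1) cw, of H "x \<cdot> t" "y \<cdot> t"])
      (use H DH c xy in \<open>auto simp: assoc\<close>)
  then have "htp Y (x \<cdot> t) (y \<cdot> t)" using P unfolding htp_def by blast
  then have "htp Y ((x \<cdot> t) \<cdot> \<sigma>) ((y \<cdot> t) \<cdot> \<sigma>)" by (rule htp_pre) (use xy c \<sigma> in auto)
  then show ?thesis using xy c \<sigma> by (auto simp: assoc)
qed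

text \<open>With the same factorization, \<open>x\<close> extends strictly over \<open>c\<close>
  because \<open>Y\<close> is fibrant. Composing the extension with a section of \<open>t\<close>
  costs only a homotopy.\<close>

lemma htp_weq_surj:
  assumes Y: "fibrant M Y" and w: "w \<in> Weq M" "cofibrant (Dom M w)" "cofibrant (Cod M w)"
    and x: "x \<in> Arr M" "Dom M x = Dom M w" "Cod M x = Y"
  obtains y where "y \<in> Arr M" "Dom M y = Cod M w" "Cod M y = Y" "htp Y (y \<cdot> w) x"
proof -
  obtain c t where c: "c \<in> Cof M" "t \<in> Fib M" "t \<in> Weq M" "Cod M c = Dom M t" "t \<cdot> c = w"
    "Dom M c = Dom M w" "Cod M t = Cod M w" using factor_Cof_TFib[of w] w by auto
  have cw: "c \<in> Weq M" using two_of_three(3)[of c t] c w by auto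
  have cof: "cofibrant (Cod M c)" using cofibrant_cof[of c] c w by auto
  obtain \<sigma> where \<sigma>: "\<sigma> \<in> Arr M" "Dom M \<sigma> = Cod M w" "Cod M \<sigma> = Dom M t" "t \<cdot> \<sigma> = Ide M (Cod M w)"
    using cofibrant_section[of t] c w by auto
  obtain z where z: "z \<in> Arr M" "Dom M z = Cod M c" "Cod M z = Y" "z \<cdot> c = x"
    using fibrant_extend[OF Y c(1) cw x(1)] x c by auto
  \<comment> \<open>\<open>\<sigma> \<cdot> t\<close> and the identity become equal after
    composition with the trivial fibration \<open>t\<close>.\<close>
  have "htp Y (z \<cdot> (\<sigma> \<cdot> t)) (z \<cdot> Ide M (Cod M c))"
    by (rule htp_tfib_eq[OF Y c(2,3)]) (use c \<sigma> z cof in \<open>auto simp: extend[OF \<sigma>(4)]\<close>)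
  then have "htp Y (z \<cdot> (\<sigma> \<cdot> t)) z" using z by simp
  then have "htp Y ((z \<cdot> (\<sigma> \<cdot> t)) \<cdot> c) (z \<cdot> c)" by (rule htp_pre) (use c \<sigma> z in auto)
  then have "htp Y ((z \<cdot> \<sigma>) \<cdot> w) x" using z c \<sigma> by (auto simp: assoc)
  then show ?thesis using that[of "z \<cdot> \<sigma>"] z \<sigma> c by auto
qed

end

section \<open>The homotopy category\<close>

context generated_model_category
begin

lemma letter_Obj: "is_letter M X l Y \<Longrightarrow> X \<in> Obj M \<and> Y \<in> Obj M"
  by (cases l) auto

lemma zigzag_Obj: "is_zigzag M X p Y \<Longrightarrow> X \<in> Obj M \<and> Y \<in> Obj M"
  by (induction p arbitrary: X) (auto dest: letter_Obj)

lemma zigzag_append: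
  "is_zigzag M X (p @ q) Z \<longleftrightarrow> (\<exists>Y. is_zigzag M X p Y \<and> is_zigzag M Y q Z)"
  by (induction p arbitrary: X) (auto dest: zigzag_Obj)

lemma zigzag_eq_zigzag: "zigzag_eq M X Y p q \<Longrightarrow> is_zigzag M X p Y \<and> is_zigzag M X q Y"
  by (induction rule: zigzag_eq.induct) auto

lemma zigzag_eq_append:
  "zigzag_eq M X Y p q \<Longrightarrow> is_zigzag M W u X \<Longrightarrow> is_zigzag M Y v Z \<Longrightarrow> zigzag_eq M W Z (u @ p @ v) (u @ q @ v)"
proof (induction rule: zigzag_eq.induct)
  case (step l r u' v')
  have "is_zigzag M W ((u @ u') @ l @ v' @ v) Z" "is_zigzag M W ((u @ u') @ r @ v' @ v) Z"
    using step(2-5) by (auto simp: zigzag_append)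
  from zigzag_eq.step[OF step(1) this] show ?case by simp
next
  case (refl p)
  then show ?case by (intro zigzag_eq.refl) (simp add: zigzag_append, blast)
qed (blast intro: zigzag_eq.intros)+

definition cls :: "'o \<Rightarrow> 'a letter list \<Rightarrow> 'o \<Rightarrow> 'o \<times> 'a letter list set \<times> 'o" where
  "cls X p Y = (X, zigzag_class M X Y p, Y)"

lemma cls_eq:
  assumes "is_zigzag M X p Y"
  shows "cls X p Y = cls X q Y \<longleftrightarrow> zigzag_eq M X Y p q"
proof
  assume "cls X p Y = cls X q Y"
  then show "zigzag_eq M X Y p q"
    using zigzag_eq.refl[OF assms] by (auto simp: cls_def zigzag_class_def intro: zigzag_eq.sym)
next
  assume "zigzag_eq M X Y p q"
  then show "cls X p Y = cls X q Y"
    by (auto simp: cls_def zigzag_class_def intro: zigzag_eq.sym zigzag_eq.trans)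
qed

lemma Ho_simps [simp]:
  "Obj (Ho M) = Obj M" "Dom (Ho M) (cls X p Y) = X" "Cod (Ho M) (cls X p Y) = Y"
  "Ide (Ho M) X = cls X [] X"
  by (simp_all add: Ho_def cls_def)

lemma Ho_arr: "a \<in> Arr (Ho M) \<longleftrightarrow> (\<exists>X p Y. is_zigzag M X p Y \<and> a = cls X p Y)"
  by (auto simp: Ho_def cls_def)

lemma Ho_arrE:
  assumes "a \<in> Arr (Ho M)"
  obtains p where "is_zigzag M (Dom (Ho M) a) p (Cod (Ho M) a)" "a = cls (Dom (Ho M) a) p (Cod (Ho M) a)"
  using assms by (auto simp: Ho_arr)

lemma Ho_homE:
  assumes "a \<in> hom (Ho M) X Y"
  obtains p where "is_zigzag M X p Y" "a = cls X p Y"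
  using assms by (auto elim: Ho_arrE)

lemma cls_arr [simp]: "is_zigzag M X p Y \<Longrightarrow> cls X p Y \<in> Arr (Ho M)"
  by (auto simp: Ho_arr)

text \<open>The union in the composition of \<open>Ho M\<close> runs over classes that all coincide,
  by the congruence \<open>zigzag_eq_append\<close>.\<close>

lemma cls_comp:
  assumes p: "is_zigzag M X p Y" and q: "is_zigzag M Y q Z"
  shows "cls Y q Z \<cdot>\<^bsub>Ho M\<^esub> cls X p Y = cls X (p @ q) Z"
proof -
  have 1: "zigzag_class M X Z (p' @ q') = zigzag_class M X Z (p @ q)"
    if "zigzag_eq M X Y p p'" "zigzag_eq M Y Z q q'" for p' q'
  proof -
    have "zigzag_eq M X Z (p @ q) (p' @ q)"
      using zigzag_eq_append[OF that(1), of X "[]" q Z] p q by (auto dest: zigzag_Obj)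
    moreover have "zigzag_eq M X Z (p' @ q) (p' @ q')"
      using zigzag_eq_append[OF that(2), of X p' "[]" Z] zigzag_eq_zigzag[OF that(1)] q by (auto dest: zigzag_Obj)
    ultimately have "cls X (p @ q) Z = cls X (p' @ q') Z"
      using p q by (subst cls_eq) (auto simp: zigzag_append intro: zigzag_eq.trans)
    then show ?thesis by (simp add: cls_def)
  qed
  have 2: "p \<in> zigzag_class M X Y p" "q \<in> zigzag_class M Y Z q"
    using p q by (auto simp: zigzag_class_def intro: zigzag_eq.refl)
  have 3: "(\<Union>q'\<in>zigzag_class M Y Z q. zigzag_class M X Z (p' @ q')) = zigzag_class M X Z (p @ q)"
    if "p' \<in> zigzag_class M X Y p" for p'
    using 2(2) that by (intro SUP_eq_const 1) (auto simp: zigzag_class_def)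
  have "(\<Union>p'\<in>zigzag_class M X Y p. \<Union>q'\<in>zigzag_class M Y Z q. zigzag_class M X Z (p' @ q')) =
      zigzag_class M X Z (p @ q)"
    using 2(1) by (intro SUP_eq_const[OF _ 3]) auto
  then show ?thesis by (simp add: cls_def Ho_def)
qed

sublocale Ho: category "Ho M"
proof
  show "Dom (Ho M) f \<in> Obj (Ho M)" "Cod (Ho M) f \<in> Obj (Ho M)" if "f \<in> Arr (Ho M)" for f
    using that zigzag_Obj by (auto simp: Ho_arr)
  show "Ide (Ho M) X \<in> hom (Ho M) X X" if "X \<in> Obj (Ho M)" for X
    using that by auto
  show "g \<cdot>\<^bsub>Ho M\<^esub> f \<in> hom (Ho M) X Z" if fg: "f \<in> hom (Ho M) X Y" "g \<in> hom (Ho M) Y Z" for f g X Y Z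
  proof -
    obtain p q where "is_zigzag M X p Y" "f = cls X p Y" "is_zigzag M Y q Z" "g = cls Y q Z"
      using Ho_homE[OF fg(1)] Ho_homE[OF fg(2)] by metis
    moreover from this have "is_zigzag M X (p @ q) Z" by (auto simp: zigzag_append)
    ultimately show ?thesis by (simp add: cls_comp)
  qed
  show "Ide (Ho M) Y \<cdot>\<^bsub>Ho M\<^esub> f = f" "f \<cdot>\<^bsub>Ho M\<^esub> Ide (Ho M) X = f" if f: "f \<in> hom (Ho M) X Y" for f X Y
  proof -
    obtain p where p: "is_zigzag M X p Y" "f = cls X p Y" using Ho_homE[OF f] .
    then show "Ide (Ho M) Y \<cdot>\<^bsub>Ho M\<^esub> f = f" "f \<cdot>\<^bsub>Ho M\<^esub> Ide (Ho M) X = f"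
      using cls_comp[of X p Y "[]" Y] cls_comp[of X "[]" X p Y] zigzag_Obj[OF p(1)] by auto
  qed
  show "h \<cdot>\<^bsub>Ho M\<^esub> (g \<cdot>\<^bsub>Ho M\<^esub> f) = h \<cdot>\<^bsub>Ho M\<^esub> g \<cdot>\<^bsub>Ho M\<^esub> f"
    if fgh: "f \<in> hom (Ho M) W X" "g \<in> hom (Ho M) X Y" "h \<in> hom (Ho M) Y Z" for f g h W X Y Z
  proof -
    obtain p q r where "is_zigzag M W p X" "f = cls W p X" "is_zigzag M X q Y" "g = cls X q Y"
      "is_zigzag M Y r Z" "h = cls Y r Z"
      using Ho_homE[OF fgh(1)] Ho_homE[OF fgh(2)] Ho_homE[OF fgh(3)] by metis
    moreover from this have "is_zigzag M W (p @ q) Y" "is_zigzag M X (q @ r) Z" by (auto simp: zigzag_append)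
    ultimately show ?thesis by (simp add: cls_comp)
  qed
qed

section \<open>The localization functor and the inverses of weak equivalences\<close>

abbreviation Ho_comp :: "'o \<times> 'a letter list set \<times> 'o \<Rightarrow> _ \<Rightarrow> 'o \<times> 'a letter list set \<times> 'o" (infixl "\<diamondop>" 70)
  where "b \<diamondop> a \<equiv> b \<cdot>\<^bsub>Ho M\<^esub> a"

abbreviation \<gamma> :: "'a \<Rightarrow> 'o \<times> 'a letter list set \<times> 'o" where "\<gamma> \<equiv> to_Ho M"

lemma \<gamma>_cls: "\<gamma> f = cls (Dom M f) [Fwd f] (Cod M f)"
  by (simp add: to_Ho_def cls_def)

lemma \<gamma>_simps [simp]:
  assumes "f \<in> Arr M"
  shows "\<gamma> f \<in> Arr (Ho M)" "Dom (Ho M) (\<gamma> f) = Dom M f" "Cod (Ho M) (\<gamma> f) = Cod M f"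
  using assms by (auto simp: \<gamma>_cls intro!: cls_arr)

lemma \<gamma>_ide [simp]: "X \<in> Obj M \<Longrightarrow> \<gamma> (Ide M X) = cls X [] X"
  using zigzag_eq.step[OF zigzag_step.ide, of X M X "[]" "[]" X]
  by (auto simp: \<gamma>_cls cls_eq)

lemma \<gamma>_comp:
  assumes "f \<in> Arr M" "g \<in> Arr M" "Cod M f = Dom M g"
  shows "\<gamma> (g \<cdot> f) = \<gamma> g \<diamondop> \<gamma> f"
proof -
  have "\<gamma> g \<diamondop> \<gamma> f = cls (Dom M f) [Fwd f, Fwd g] (Cod M g)"
    using assms cls_comp[of "Dom M f" "[Fwd f]" "Cod M f" "[Fwd g]" "Cod M g"] by (auto simp: \<gamma>_cls)
  also have "\<dots> = cls (Dom M f) [Fwd (g \<cdot> f)] (Cod M g)"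
  proof (subst cls_eq)
    show "zigzag_eq M (Dom M f) (Cod M g) [Fwd f, Fwd g] [Fwd (g \<cdot> f)]"
      using zigzag_eq.step[OF zigzag_step.comp[of f M "Dom M f" "Cod M f" g "Cod M g"], of "Dom M f" "[]" "[]" "Cod M g"] assms
      by simp
  qed (use assms in simp)
  finally show ?thesis using assms by (simp add: \<gamma>_cls)
qed

definition \<gamma>_inv :: "'a \<Rightarrow> 'o \<times> 'a letter list set \<times> 'o" where
  "\<gamma>_inv w = cls (Cod M w) [Inv w] (Dom M w)"

lemma \<gamma>_inv [simp]:
  assumes w: "w \<in> Weq M"
  shows "\<gamma>_inv w \<in> Arr (Ho M)" "Dom (Ho M) (\<gamma>_inv w) = Cod M w" "Cod (Ho M) (\<gamma>_inv w) = Dom M w"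
    "\<gamma>_inv w \<diamondop> \<gamma> w = cls (Dom M w) [] (Dom M w)" "\<gamma> w \<diamondop> \<gamma>_inv w = cls (Cod M w) [] (Cod M w)"
proof -
  show "\<gamma>_inv w \<in> Arr (Ho M)" "Dom (Ho M) (\<gamma>_inv w) = Cod M w" "Cod (Ho M) (\<gamma>_inv w) = Dom M w"
    using w by (auto simp: \<gamma>_inv_def intro!: cls_arr)
  have "\<gamma>_inv w \<diamondop> \<gamma> w = cls (Dom M w) ([Fwd w] @ [Inv w]) (Dom M w)"
    unfolding \<gamma>_inv_def \<gamma>_cls by (rule cls_comp) (use w in auto)
  also have "\<dots> = cls (Dom M w) [] (Dom M w)"
    using zigzag_eq.step[OF zigzag_step.cancel_right[OF w], of "Dom M w" "[]" "[]" "Dom M w"] w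
    by (subst cls_eq) auto
  finally show "\<gamma>_inv w \<diamondop> \<gamma> w = cls (Dom M w) [] (Dom M w)" .
  have "\<gamma> w \<diamondop> \<gamma>_inv w = cls (Cod M w) ([Inv w] @ [Fwd w]) (Cod M w)"
    unfolding \<gamma>_inv_def \<gamma>_cls by (rule cls_comp) (use w in auto)
  also have "\<dots> = cls (Cod M w) [] (Cod M w)"
    using zigzag_eq.step[OF zigzag_step.cancel_left[OF w], of "Cod M w" "[]" "[]" "Cod M w"] w
    by (subst cls_eq) auto
  finally show "\<gamma> w \<diamondop> \<gamma>_inv w = cls (Cod M w) [] (Cod M w)" .
qed

lemma Ho_ide [simp]:
  "a \<in> Arr (Ho M) \<Longrightarrow> Cod (Ho M) a = X \<Longrightarrow> cls X [] X \<diamondop> a = a"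
  "a \<in> Arr (Ho M) \<Longrightarrow> Dom (Ho M) a = X \<Longrightarrow> a \<diamondop> cls X [] X = a"
  using Ho.comp_ide[of a X] by simp_all

lemma \<gamma>_weq_iso:
  assumes w: "w \<in> Weq M"
  shows "is_iso (Ho M) (\<gamma> w)"
  unfolding is_iso_def using w by (auto intro!: bexI[of _ "\<gamma>_inv w"])

lemma Ho_epi:
  assumes w: "w \<in> Weq M" and "a \<in> Arr (Ho M)" "b \<in> Arr (Ho M)" "Dom (Ho M) a = Cod M w" "Dom (Ho M) b = Cod M w"
    "a \<diamondop> \<gamma> w = b \<diamondop> \<gamma> w"
  shows "a = b"
proof -
  have "c = (c \<diamondop> \<gamma> w) \<diamondop> \<gamma>_inv w" if "c \<in> Arr (Ho M)" "Dom (Ho M) c = Cod M w" for c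
    using that w by (simp add: Ho.assoc)
  then show ?thesis using assms(2-6) by metis
qed

lemma Ho_mono:
  assumes w: "w \<in> Weq M" and "a \<in> Arr (Ho M)" "b \<in> Arr (Ho M)" "Cod (Ho M) a = Dom M w" "Cod (Ho M) b = Dom M w"
    "\<gamma> w \<diamondop> a = \<gamma> w \<diamondop> b"
  shows "a = b"
proof -
  have "c = \<gamma>_inv w \<diamondop> (\<gamma> w \<diamondop> c)" if "c \<in> Arr (Ho M)" "Cod (Ho M) c = Dom M w" for c
    using that w by (simp flip: Ho.assoc)
  then show ?thesis using assms(2-6) by metis
qed

text \<open>Applied to pairs of maps with a common section: the ends of a path object, or the
  projections of a fiber product whose diagonal is a weak equivalence.\<close>

lemma \<gamma>_sections:
  assumes "s \<in> Weq M" "p \<in> Arr M" "q \<in> Arr M" "Dom M p = Cod M s" "Dom M q = Cod M s" "p \<cdot> s = q \<cdot> s"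
  shows "\<gamma> p = \<gamma> q"
  by (rule Ho_epi[of s]) (use assms in \<open>auto simp flip: \<gamma>_comp\<close>)

lemma htp_\<gamma>:
  assumes "htp Y a b"
  shows "\<gamma> a = \<gamma> b"
proof -
  obtain s p\<^sub>0 p\<^sub>1 H where P: "path_object Y s p\<^sub>0 p\<^sub>1" and H: "H \<in> Arr M" "Cod M H = Cod M s" "p\<^sub>0 \<cdot> H = a" "p\<^sub>1 \<cdot> H = b"
    using assms by (rule htpE)
  note P' = path_object_simps[OF P]
  have "\<gamma> p\<^sub>0 = \<gamma> p\<^sub>1" using \<gamma>_sections[of s p\<^sub>0 p\<^sub>1] P' by simp
  moreover have "\<gamma> a = \<gamma> p\<^sub>0 \<diamondop> \<gamma> H" "\<gamma> b = \<gamma> p\<^sub>1 \<diamondop> \<gamma> H"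
    using H P' by (simp_all flip: \<gamma>_comp)
  ultimately show ?thesis by simp
qed

text \<open>Induction from the target side. A forward letter is absorbed by composing with its lift
  to the replacements; a backward letter asks for an extension along a weak equivalence between
  cofibrant objects, which \<open>htp_weq_surj\<close> provides up to homotopy because
  \<open>Y\<close> is fibrant.\<close>

lemma zigzag_represented:
  assumes Y: "fibrant M Y" and p: "is_zigzag M Z p Y"
  shows "\<exists>y. y \<in> Arr M \<and> Dom M y = Dom M (crep Z) \<and> Cod M y = Y \<and> cls Z p Y \<diamondop> \<gamma> (crep Z) = \<gamma> y"
  using p
proof (induction p arbitrary: Z)
  case Nil
  then show ?case by (intro exI[of _ "crep Z"]) auto
next
  case (Cons l p)
  obtain W where l: "is_letter M Z l W" and p: "is_zigzag M W p Y" using Cons.prems by auto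
  obtain y where y: "y \<in> Arr M" "Dom M y = Dom M (crep W)" "Cod M y = Y" "cls W p Y \<diamondop> \<gamma> (crep W) = \<gamma> y"
    using Cons.IH[OF p] by blast
  have Z: "Z \<in> Obj M" "W \<in> Obj M" using letter_Obj[OF l] by auto
  have c: "cls Z (l # p) Y = cls W p Y \<diamondop> cls Z [l] W"
    using cls_comp[of Z "[l]" W p Y] l p Z by auto
  have cl: "cls Z [l] W \<in> Arr (Ho M)" using l Z by (auto intro!: cls_arr)
  show ?case
  proof (cases l)
    case (Fwd f)
    then have f: "f \<in> Arr M" "Dom M f = Z" "Cod M f = W" using l by auto
    have "cls Z [l] W = \<gamma> f" using f Fwd by (simp add: \<gamma>_cls)
    then have "cls Z (l # p) Y \<diamondop> \<gamma> (crep Z) = cls W p Y \<diamondop> (\<gamma> f \<diamondop> \<gamma> (crep Z))"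
      using c Z p f by (simp add: Ho.assoc)
    also have "\<gamma> f \<diamondop> \<gamma> (crep Z) = \<gamma> (crep W) \<diamondop> \<gamma> (crep_map f)"
      using f Z crep_map_eq[OF f(1)] by (simp flip: \<gamma>_comp)
    also have "cls W p Y \<diamondop> \<dots> = \<gamma> (y \<cdot> crep_map f)"
      using y p f Z by (simp add: \<gamma>_comp flip: Ho.assoc)
    finally show ?thesis using y f Z by (intro exI[of _ "y \<cdot> crep_map f"]) simp
  next
    case (Inv w)
    then have w: "w \<in> Weq M" "Dom M w = W" "Cod M w = Z" using l by auto
    have cw: "cls Z [l] W = \<gamma>_inv w" using w Inv by (simp add: \<gamma>_inv_def)
    have qw: "crep_map w \<in> Weq M" by (rule crep_map_weq[OF w(1)])
    obtain z where z: "z \<in> Arr M" "Dom M z = Dom M (crep Z)" "Cod M z = Y" "htp Y (z \<cdot> crep_map w) y"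
      by (rule htp_weq_surj[OF Y qw, of y]) (use w y Z in auto)
    have "cls Z (l # p) Y \<diamondop> \<gamma> (crep Z) = \<gamma> z"
    proof (rule Ho_epi[OF qw])
      have "(cls Z (l # p) Y \<diamondop> \<gamma> (crep Z)) \<diamondop> \<gamma> (crep_map w) = cls W p Y \<diamondop> (\<gamma>_inv w \<diamondop> (\<gamma> (crep Z) \<diamondop> \<gamma> (crep_map w)))"
        using c cw Z p w by (simp add: Ho.assoc)
      also have "\<gamma> (crep Z) \<diamondop> \<gamma> (crep_map w) = \<gamma> w \<diamondop> \<gamma> (crep W)"
        using w Z crep_map_eq[of w] by (simp flip: \<gamma>_comp)
      also have "\<gamma>_inv w \<diamondop> \<dots> = \<gamma> (crep W)" using w Z by (simp flip: Ho.assoc)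
      also have "cls W p Y \<diamondop> \<gamma> (crep W) = \<gamma> (z \<cdot> crep_map w)" using y(4) htp_\<gamma>[OF z(4)] by simp
      also have "\<dots> = \<gamma> z \<diamondop> \<gamma> (crep_map w)" using z w Z by (simp add: \<gamma>_comp)
      finally show "cls Z (l # p) Y \<diamondop> \<gamma> (crep Z) \<diamondop> \<gamma> (crep_map w) = \<gamma> z \<diamondop> \<gamma> (crep_map w)" .
    qed (use c cw cl z w Z p in auto)
    then show ?thesis using z by blast
  qed
qed

lemma Ho_represented:
  assumes "h \<in> Arr (Ho M)" "fibrant M (Cod (Ho M) h)"
  obtains y where "y \<in> Arr M" "Dom M y = Dom M (crep (Dom (Ho M) h))" "Cod M y = Cod (Ho M) h"
    "h \<diamondop> \<gamma> (crep (Dom (Ho M) h)) = \<gamma> y"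
proof -
  obtain p where "is_zigzag M (Dom (Ho M) h) p (Cod (Ho M) h)" "h = cls (Dom (Ho M) h) p (Cod (Ho M) h)"
    using Ho_arrE[OF assms(1)] .
  then show ?thesis using zigzag_represented[OF assms(2)] that by metis
qed

text \<open>
  Zigzags act on the homotopy classes of maps from cofibrant replacements to a fixed fibrant object.
  The action factors through the homotopy category, so that maps which are equal there are homotopic.
\<close>

definition class_rel :: "'o \<Rightarrow> 'o \<Rightarrow> ('a \<times> 'a) set" where
  "class_rel Y X = {(y, y'). y \<in> hom M (Dom M (crep X)) Y \<and> y' \<in> hom M (Dom M (crep X)) Y \<and> htp Y y y'}"

text \<open>The graph of precomposition with \<open>crep_map f\<close>, saturated under homotopy and
  directed from classes over \<open>Dom M f\<close> to classes over \<open>Cod M f\<close>. As a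
  relation it can be reversed, so a formal inverse acts by the converse, and a word acts by relation
  composition in its own order.\<close>

definition map_rel :: "'o \<Rightarrow> 'a \<Rightarrow> ('a \<times> 'a) set" where
  "map_rel Y f = {(y, y'). y \<in> hom M (Dom M (crep (Dom M f))) Y \<and> y' \<in> hom M (Dom M (crep (Cod M f))) Y \<and>
     htp Y (y' \<cdot> crep_map f) y}"

primrec letter_rel :: "'o \<Rightarrow> 'a letter \<Rightarrow> ('a \<times> 'a) set" where
  "letter_rel Y (Fwd f) = map_rel Y f"
| "letter_rel Y (Inv w) = (map_rel Y w)\<inverse>"

primrec letter_cod :: "'a letter \<Rightarrow> 'o" where
  "letter_cod (Fwd f) = Cod M f"
| "letter_cod (Inv w) = Dom M w"

primrec zigzag_rel :: "'o \<Rightarrow> 'o \<Rightarrow> 'a letter list \<Rightarrow> ('a \<times> 'a) set" where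
  "zigzag_rel Y X [] = class_rel Y X"
| "zigzag_rel Y X (l # p) = letter_rel Y l O zigzag_rel Y (letter_cod l) p"

section \<open>The action of zigzags respects the defining relations of the homotopy
  category\<close>

context
  fixes Y assumes Y: "fibrant M Y"
begin

lemma class_rel_comp:
  assumes "X \<in> Obj M"
  shows "class_rel Y X O class_rel Y X = class_rel Y X"
proof -
  note c = crep(4)[OF assms]
  have "htp Y y z" if "htp Y y x" "htp Y x z" "Dom M y = Dom M (crep X)" for x y z
    by (rule htp_trans[OF Y _ that(1,2)]) (simp add: that(3) c)
  moreover have "htp Y y y" if "y \<in> Arr M" "Cod M y = Y" for y using htp_refl[OF Y that] .
  ultimately show ?thesis unfolding class_rel_def relcomp_unfold in_hom by blast
qed

text \<open>Saturation under homotopy on both sides: \<open>class_rel\<close> takes the place of the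
  identity relation, and it is the value of the empty word.\<close>

lemma map_rel_comp:
  assumes f: "f \<in> Arr M"
  shows "class_rel Y (Dom M f) O map_rel Y f = map_rel Y f" "map_rel Y f O class_rel Y (Cod M f) = map_rel Y f"
proof -
  have D: "Dom M f \<in> Obj M" "Cod M f \<in> Obj M" using f by auto
  note c = crep(4)[OF D(1)]
  have "(y, z) \<in> class_rel Y (Dom M f) O map_rel Y f \<longleftrightarrow> (y, z) \<in> map_rel Y f" for y z
  proof
    assume "(y, z) \<in> class_rel Y (Dom M f) O map_rel Y f"
    then obtain y' where "htp Y y y'" "htp Y (z \<cdot> crep_map f) y'" "y \<in> hom M (Dom M (crep (Dom M f))) Y"
      "z \<in> hom M (Dom M (crep (Cod M f))) Y"
      by (auto simp: class_rel_def map_rel_def)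
    then show "(y, z) \<in> map_rel Y f"
      using c f htp_trans[OF Y _ _ htp_sym[OF Y, of y y'], of "z \<cdot> crep_map f"] by (simp add: map_rel_def)
  next
    assume "(y, z) \<in> map_rel Y f"
    then show "(y, z) \<in> class_rel Y (Dom M f) O map_rel Y f"
      using htp_refl[OF Y] by (auto simp: class_rel_def map_rel_def relcomp_unfold)
  qed
  then show "class_rel Y (Dom M f) O map_rel Y f = map_rel Y f" by auto
  have "(y, z) \<in> map_rel Y f O class_rel Y (Cod M f) \<longleftrightarrow> (y, z) \<in> map_rel Y f" for y z
  proof
    assume "(y, z) \<in> map_rel Y f O class_rel Y (Cod M f)"
    then obtain y' where y': "htp Y (y' \<cdot> crep_map f) y" "htp Y y' z" "y \<in> hom M (Dom M (crep (Dom M f))) Y"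
      "z \<in> hom M (Dom M (crep (Cod M f))) Y" "y' \<in> hom M (Dom M (crep (Cod M f))) Y"
      by (auto simp: class_rel_def map_rel_def)
    have "htp Y (y' \<cdot> crep_map f) (z \<cdot> crep_map f)" by (rule htp_pre) (use y' f in auto)
    then have "htp Y (z \<cdot> crep_map f) y"
      by (rule htp_trans2[OF Y, rotated]) (use y' f c in auto)
    then show "(y, z) \<in> map_rel Y f" using y' by (simp add: map_rel_def)
  next
    assume "(y, z) \<in> map_rel Y f"
    then show "(y, z) \<in> map_rel Y f O class_rel Y (Cod M f)"
      using htp_refl[OF Y] by (auto simp: class_rel_def map_rel_def relcomp_unfold)
  qed
  then show "map_rel Y f O class_rel Y (Cod M f) = map_rel Y f" by auto
qed

lemma class_rel_converse: "X \<in> Obj M \<Longrightarrow> (class_rel Y X)\<inverse> = class_rel Y X"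
  unfolding class_rel_def converse_unfold in_hom using htp_sym[OF Y] crep(4)[of X] by auto

lemma letter_rel_comp:
  assumes "is_letter M X l Z"
  shows "class_rel Y X O letter_rel Y l = letter_rel Y l" "letter_rel Y l O class_rel Y Z = letter_rel Y l"
    "letter_cod l = Z"
proof -
  have *: "class_rel Y X O (map_rel Y w)\<inverse> = (map_rel Y w)\<inverse>" "(map_rel Y w)\<inverse> O class_rel Y Z = (map_rel Y w)\<inverse>"
    if "w \<in> Arr M" "Dom M w = Z" "Cod M w = X" for w
    using map_rel_comp[OF that(1)] class_rel_converse that
    by (metis converse_relcomp arr_Obj)+
  have "class_rel Y X O letter_rel Y l = letter_rel Y l \<and> letter_rel Y l O class_rel Y Z = letter_rel Y l \<and>
    letter_cod l = Z"
  proof (cases l)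
    case (Fwd f)
    then have f: "f \<in> Arr M" "Dom M f = X" "Cod M f = Z" using assms by auto
    show ?thesis using map_rel_comp[OF f(1)] unfolding f Fwd by (simp add: f)
  next
    case (Inv w)
    then have w: "w \<in> Arr M" "Dom M w = Z" "Cod M w = X" using assms by auto
    show ?thesis using *[OF w] unfolding Inv by (simp add: w)
  qed
  then show "class_rel Y X O letter_rel Y l = letter_rel Y l" "letter_rel Y l O class_rel Y Z = letter_rel Y l"
    "letter_cod l = Z" by blast+
qed

lemma zigzag_rel_comp:
  assumes "is_zigzag M X p Z"
  shows "class_rel Y X O zigzag_rel Y X p = zigzag_rel Y X p"
  using assms
proof (cases p)
  case (Cons l q)
  then obtain W where l: "is_letter M X l W" using assms by auto
  show ?thesis unfolding Cons zigzag_rel.simps O_assoc[symmetric] letter_rel_comp(1)[OF l] ..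
qed (use assms class_rel_comp in auto)

lemma zigzag_rel_append:
  "is_zigzag M X p Z \<Longrightarrow> is_zigzag M Z q W \<Longrightarrow> zigzag_rel Y X (p @ q) = zigzag_rel Y X p O zigzag_rel Y Z q"
proof (induction p arbitrary: X)
  case (Cons l p)
  then obtain V where l: "is_letter M X l V" "is_zigzag M V p Z" by auto
  show ?case using Cons.IH[OF l(2) Cons.prems(2)] letter_rel_comp(3)[OF l(1)] by (simp add: O_assoc)
qed (use zigzag_rel_comp in auto)

lemma map_rel_funct:
  assumes f: "f \<in> Arr M" and g: "g \<in> Arr M" and c: "Cod M f = Dom M g"
  shows "map_rel Y f O map_rel Y g = map_rel Y (g \<cdot> f)"
proof -
  have D: "Dom M f \<in> Obj M" "Dom M g \<in> Obj M" "Cod M g \<in> Obj M" using f g by auto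
  \<comment> \<open>Both \<open>crep_map (g \<cdot> f)\<close> and
    \<open>crep_map g \<cdot> crep_map f\<close> lift the same map along
    \<open>crep (Cod M g)\<close>.\<close>
  have e: "htp Y (z \<cdot> crep_map (g \<cdot> f)) (z \<cdot> (crep_map g \<cdot> crep_map f))" if "z \<in> hom M (Dom M (crep (Cod M g))) Y" for z
  proof (rule htp_tfib_eq[OF Y, of "crep (Cod M g)"])
    have "crep (Cod M g) \<cdot> (crep_map g \<cdot> crep_map f) = (g \<cdot> crep (Dom M g)) \<cdot> crep_map f"
      using f g c D by (simp add: extend[OF crep_map_eq[OF g]])
    also have "\<dots> = g \<cdot> (f \<cdot> crep (Dom M f))"
      using f g c D crep_map_eq[OF f] by (simp add: assoc)
    also have "\<dots> = crep (Cod M g) \<cdot> crep_map (g \<cdot> f)"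
      using f g c D crep_map_eq[of "g \<cdot> f"] by (simp add: assoc)
    finally show "crep (Cod M g) \<cdot> crep_map (g \<cdot> f) = crep (Cod M g) \<cdot> (crep_map g \<cdot> crep_map f)" by simp
  qed (use f g c D that in auto)
  have "(y, z) \<in> map_rel Y f O map_rel Y g \<longleftrightarrow> (y, z) \<in> map_rel Y (g \<cdot> f)" for y z
  proof
    assume "(y, z) \<in> map_rel Y f O map_rel Y g"
    then obtain x where x: "htp Y (x \<cdot> crep_map f) y" "htp Y (z \<cdot> crep_map g) x" "y \<in> hom M (Dom M (crep (Dom M f))) Y"
      "z \<in> hom M (Dom M (crep (Cod M g))) Y" "x \<in> hom M (Dom M (crep (Cod M f))) Y"
      using c by (auto simp: map_rel_def)
    have "htp Y ((z \<cdot> crep_map g) \<cdot> crep_map f) (x \<cdot> crep_map f)"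
      by (rule htp_pre[OF x(2)]) (use x f g c in auto)
    then have "htp Y (z \<cdot> (crep_map g \<cdot> crep_map f)) (x \<cdot> crep_map f)" using x f g c by (simp add: assoc)
    then have "htp Y (z \<cdot> crep_map (g \<cdot> f)) (x \<cdot> crep_map f)"
      using e[OF x(4)] x f g c D by (intro htp_trans[OF Y _ e[OF x(4)]]) auto
    then have "htp Y (z \<cdot> crep_map (g \<cdot> f)) y"
      using x f g c D by (intro htp_trans[OF Y _ _ x(1)]) auto
    then show "(y, z) \<in> map_rel Y (g \<cdot> f)" using x f g c by (simp add: map_rel_def)
  next
    assume "(y, z) \<in> map_rel Y (g \<cdot> f)"
    then have x: "htp Y (z \<cdot> crep_map (g \<cdot> f)) y" "y \<in> hom M (Dom M (crep (Dom M f))) Y"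
      "z \<in> hom M (Dom M (crep (Cod M g))) Y" using f g c by (auto simp: map_rel_def)
    have "htp Y (z \<cdot> (crep_map g \<cdot> crep_map f)) y"
      by (rule htp_trans2[OF Y _ e[OF x(3)] x(1)]) (use x f g c D in auto)
    moreover have "htp Y (z \<cdot> crep_map g) (z \<cdot> crep_map g)"
      by (rule htp_refl[OF Y]) (use x f g c in auto)
    ultimately show "(y, z) \<in> map_rel Y f O map_rel Y g"
      using x f g c by (auto simp: map_rel_def relcomp_unfold assoc intro!: exI[of _ "z \<cdot> crep_map g"])
  qed
  then show ?thesis by auto
qed

lemma map_rel_ide:
  assumes X: "X \<in> Obj M"
  shows "map_rel Y (Ide M X) = class_rel Y X"
proof -
  have e: "htp Y (z \<cdot> crep_map (Ide M X)) z" if "z \<in> hom M (Dom M (crep X)) Y" for z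
  proof -
    have "htp Y (z \<cdot> crep_map (Ide M X)) (z \<cdot> Ide M (Dom M (crep X)))"
      by (rule htp_tfib_eq[OF Y, of "crep X"]) (use X that crep_map_eq[of "Ide M X"] in auto)
    then show ?thesis using that by auto
  qed
  have "htp Y (z \<cdot> crep_map (Ide M X)) y \<longleftrightarrow> htp Y y z"
    if y: "y \<in> hom M (Dom M (crep X)) Y" and z: "z \<in> hom M (Dom M (crep X)) Y" for y z
  proof
    have c: "cofibrant (Dom M y)" "cofibrant (Dom M z)" "cofibrant (Dom M (z \<cdot> crep_map (Ide M X)))"
      using X y z by auto
    show "htp Y y z" if "htp Y (z \<cdot> crep_map (Ide M X)) y"
      using htp_sym[OF Y c(2) htp_trans2[OF Y c(3) e[OF z] that]] .
    show "htp Y (z \<cdot> crep_map (Ide M X)) y" if "htp Y y z"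
      using htp_trans[OF Y c(3) e[OF z] htp_sym[OF Y c(1) that]] .
  qed
  then show ?thesis using X by (auto simp: map_rel_def class_rel_def)
qed

text \<open>Precomposition with a weak equivalence between cofibrant objects is bijective on
  homotopy classes into \<open>Y\<close>. Surjectivity enters the first equation and injectivity the
  second.\<close>

lemma map_rel_weq:
  assumes w: "w \<in> Weq M"
  shows "map_rel Y w O (map_rel Y w)\<inverse> = class_rel Y (Dom M w)" "(map_rel Y w)\<inverse> O map_rel Y w = class_rel Y (Cod M w)"
proof -
  have D: "Dom M w \<in> Obj M" "Cod M w \<in> Obj M" using w by auto
  note c = crep(4)[OF D(1)] crep(4)[OF D(2)]
  have "(y, z) \<in> map_rel Y w O (map_rel Y w)\<inverse> \<longleftrightarrow> (y, z) \<in> class_rel Y (Dom M w)" for y z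
  proof
    assume "(y, z) \<in> map_rel Y w O (map_rel Y w)\<inverse>"
    then obtain x where x: "htp Y (x \<cdot> crep_map w) y" "htp Y (x \<cdot> crep_map w) z" "y \<in> hom M (Dom M (crep (Dom M w))) Y"
      "z \<in> hom M (Dom M (crep (Dom M w))) Y" "x \<in> hom M (Dom M (crep (Cod M w))) Y"
      by (auto simp: map_rel_def)
    have "htp Y y z" by (rule htp_trans2[OF Y _ x(1,2)]) (use x w c in auto)
    then show "(y, z) \<in> class_rel Y (Dom M w)" using x by (simp add: class_rel_def)
  next
    assume "(y, z) \<in> class_rel Y (Dom M w)"
    then have y: "y \<in> hom M (Dom M (crep (Dom M w))) Y" "z \<in> hom M (Dom M (crep (Dom M w))) Y" "htp Y y z"
      by (auto simp: class_rel_def)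
    obtain x where x: "x \<in> Arr M" "Dom M x = Cod M (crep_map w)" "Cod M x = Y" "htp Y (x \<cdot> crep_map w) y"
      by (rule htp_weq_surj[OF Y crep_map_weq[OF w], of y]) (use w y D in auto)
    have "htp Y (x \<cdot> crep_map w) z" by (rule htp_trans[OF Y _ x(4) y(3)]) (use x w c in auto)
    then show "(y, z) \<in> map_rel Y w O (map_rel Y w)\<inverse>"
      using x y w by (auto simp: map_rel_def relcomp_unfold)
  qed
  then show "map_rel Y w O (map_rel Y w)\<inverse> = class_rel Y (Dom M w)" by auto
  have "(y, z) \<in> (map_rel Y w)\<inverse> O map_rel Y w \<longleftrightarrow> (y, z) \<in> class_rel Y (Cod M w)" for y z
  proof
    assume "(y, z) \<in> (map_rel Y w)\<inverse> O map_rel Y w"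
    then obtain x where x: "htp Y (y \<cdot> crep_map w) x" "htp Y (z \<cdot> crep_map w) x" "y \<in> hom M (Dom M (crep (Cod M w))) Y"
      "z \<in> hom M (Dom M (crep (Cod M w))) Y" "x \<in> hom M (Dom M (crep (Dom M w))) Y"
      by (auto simp: map_rel_def)
    have h: "htp Y x (z \<cdot> crep_map w)" by (rule htp_sym[OF Y _ x(2)]) (use x w c in auto)
    have h': "htp Y (y \<cdot> crep_map w) (z \<cdot> crep_map w)"
      by (rule htp_trans[OF Y _ x(1) h]) (use x w c in auto)
    have "htp Y y z"
      by (rule htp_weq_inj[OF Y crep_map_weq[OF w] _ _ _ _ _ _ _ _ h']) (use x w c in auto)
    then show "(y, z) \<in> class_rel Y (Cod M w)" using x by (simp add: class_rel_def)
  next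
    assume "(y, z) \<in> class_rel Y (Cod M w)"
    then have y: "y \<in> hom M (Dom M (crep (Cod M w))) Y" "z \<in> hom M (Dom M (crep (Cod M w))) Y" "htp Y y z"
      by (auto simp: class_rel_def)
    have "htp Y z y" by (rule htp_sym[OF Y _ y(3)]) (use y c in auto)
    then have "htp Y (z \<cdot> crep_map w) (y \<cdot> crep_map w)" by (rule htp_pre) (use y w in auto)
    moreover have "htp Y (y \<cdot> crep_map w) (y \<cdot> crep_map w)" by (rule htp_refl[OF Y]) (use y w in auto)
    ultimately show "(y, z) \<in> (map_rel Y w)\<inverse> O map_rel Y w"
      using y w by (auto simp: map_rel_def relcomp_unfold intro!: exI[of _ "y \<cdot> crep_map w"])
  qed
  then show "(map_rel Y w)\<inverse> O map_rel Y w = class_rel Y (Cod M w)" by auto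
qed

lemma zigzag_step_rel:
  assumes "zigzag_step M l r" "is_zigzag M X l Z"
  shows "is_zigzag M X r Z \<and> zigzag_rel Y X l = zigzag_rel Y X r"
  using assms
proof cases
  case (comp f A B g C)
  then show ?thesis using assms(2) map_rel_funct[of f g] by (auto simp flip: O_assoc)
next
  case (ide A)
  then show ?thesis using assms(2) map_rel_ide class_rel_comp by auto
next
  case (cancel_right w)
  then have "X = Dom M w" "Z = Dom M w" "X \<in> Obj M" using assms(2) by auto
  then show ?thesis using cancel_right map_rel_weq(1)[of w] class_rel_comp[of X] by (simp flip: O_assoc)
next
  case (cancel_left w)
  then have "X = Cod M w" "Z = Cod M w" "X \<in> Obj M" using assms(2) by auto
  then show ?thesis using cancel_left map_rel_weq(2)[of w] class_rel_comp[of X] by (simp flip: O_assoc)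
qed

lemma zigzag_eq_rel: "zigzag_eq M X Z p q \<Longrightarrow> zigzag_rel Y X p = zigzag_rel Y X q"
proof (induction rule: zigzag_eq.induct)
  case (step l r u v)
  obtain A B where AB: "is_zigzag M X u A" "is_zigzag M A l B" "is_zigzag M B v Z"
    using step(2) by (auto simp: zigzag_append)
  moreover have "is_zigzag M A r B \<and> zigzag_rel Y A l = zigzag_rel Y A r"
    by (rule zigzag_step_rel[OF step(1) AB(2)])
  moreover have "is_zigzag M A (l @ v) Z" "is_zigzag M A (r @ v) Z"
    using AB calculation(4) by (auto simp: zigzag_append)
  ultimately show ?case by (metis zigzag_rel_append)
qed auto

end

text \<open>A Yoneda argument: equal classes act equally, and the action is evaluated at the element
  \<open>crep Y\<close>, which stands for the identity of \<open>Y\<close>. The replacement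
  \<open>e\<close> of the source is finally split off by a section.\<close>

lemma \<gamma>_eq_htp:
  assumes Y: "fibrant M Y" and ab: "a \<in> Arr M" "b \<in> Arr M" "Dom M a = Dom M b" "Cod M a = Y" "Cod M b = Y"
    and Z: "cofibrant (Dom M a)" and eq: "\<gamma> a = \<gamma> b"
  shows "htp Y a b"
proof -
  define e where "e = crep (Dom M a)"
  have D: "Dom M a \<in> Obj M" "Y \<in> Obj M" using ab by auto
  have e: "e \<in> Fib M" "e \<in> Weq M" "Cod M e = Dom M a" "cofibrant (Dom M e)" using D by (simp_all add: e_def)
  have q: "crep Y \<cdot> crep_map a = a \<cdot> e" "crep Y \<cdot> crep_map b = b \<cdot> e"
    using crep_map_eq[of a] crep_map_eq[of b] ab by (simp_all add: e_def)
  have "zigzag_eq M (Dom M a) Y [Fwd a] [Fwd b]"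
    using eq cls_eq[of "Dom M a" "[Fwd a]" Y "[Fwd b]"] ab D by (simp add: \<gamma>_cls)
  then have "zigzag_rel Y (Dom M a) [Fwd a] = zigzag_rel Y (Dom M a) [Fwd b]" by (rule zigzag_eq_rel[OF Y])
  then have "map_rel Y a = map_rel Y b" using map_rel_comp(2)[OF Y ab(1)] map_rel_comp(2)[OF Y ab(2)] ab by simp
  \<comment> \<open>Here the defining square of \<open>crep_map a\<close> is a strict equation, so
    reflexivity of homotopy suffices.\<close>
  moreover have "(a \<cdot> e, crep Y) \<in> map_rel Y a"
    using ab D e q htp_refl[OF Y, of "a \<cdot> e"] by (auto simp: map_rel_def e_def)
  ultimately have "(a \<cdot> e, crep Y) \<in> map_rel Y b" by simp
  then have "htp Y (b \<cdot> e) (a \<cdot> e)" using ab q by (simp add: map_rel_def)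
  then have h: "htp Y (a \<cdot> e) (b \<cdot> e)" by (rule htp_sym[OF Y, rotated]) (use ab e in auto)
  obtain \<sigma> where \<sigma>: "\<sigma> \<in> Arr M" "Dom M \<sigma> = Cod M e" "Cod M \<sigma> = Dom M e" "e \<cdot> \<sigma> = Ide M (Cod M e)"
    using cofibrant_section[of e] e Z by auto
  have "htp Y ((a \<cdot> e) \<cdot> \<sigma>) ((b \<cdot> e) \<cdot> \<sigma>)" by (rule htp_pre[OF h]) (use ab e \<sigma> in auto)
  then show ?thesis using ab e \<sigma> by (simp add: assoc)
qed

end

section \<open>Lifting homotopies along fibrations, and fibrations that become invertible\<close>

context generated_model_category
begin

text \<open>Path lifting for the fibration \<open>m\<close>: a homotopy that starts at
  \<open>m \<cdot> a\<close> transports \<open>a\<close> to a map lying strictly over the end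
  \<open>b\<close>. It is used to turn equations that hold up to homotopy over
  \<open>Cod M m\<close> into strict ones without changing the class in \<open>Ho M\<close>.\<close>

lemma homotopy_lift:
  assumes m: "m \<in> Fib M" and a: "a \<in> Arr M" "Cod M a = Dom M m" "cofibrant (Dom M a)"
    and h: "htp (Cod M m) (m \<cdot> a) b"
  obtains a' where "a' \<in> Arr M" "Dom M a' = Dom M a" "Cod M a' = Dom M m" "m \<cdot> a' = b" "\<gamma> a' = \<gamma> a"
proof -
  obtain s p\<^sub>0 p\<^sub>1 H where P: "path_object (Cod M m) s p\<^sub>0 p\<^sub>1" and H: "H \<in> Arr M" "Cod M H = Cod M s"
    "p\<^sub>0 \<cdot> H = m \<cdot> a" "p\<^sub>1 \<cdot> H = b" "Dom M H = Dom M (m \<cdot> a)"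
    using h by (rule htpE)
  note P' = path_object_simps[OF P]
  have DH: "Dom M H = Dom M a" using H(5) m a by simp
  \<comment> \<open>The mapping path object of \<open>m\<close>: points of \<open>Dom M m\<close>
    with a path starting at their image. The map \<open>n\<close> below sends a point to its
    constant path.\<close>
  obtain u v where N: "is_pullback M m p\<^sub>0 u v" using pb[of m p\<^sub>0] m P' by auto
  note N' = pullback_simps[OF N]
  have u: "u \<in> Weq M" using tfib_pullback(2)[OF N] P' by simp
  have e: "m \<cdot> Ide M (Dom M m) = p\<^sub>0 \<cdot> (s \<cdot> m)" using m P' by (simp add: extend[OF P'(12)])
  obtain n where n: "n \<in> Arr M" "Dom M n = Dom M m" "Cod M n = Dom M u" "u \<cdot> n = Ide M (Dom M m)" "v \<cdot> n = s \<cdot> m"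
    by (rule pullback_lift[OF N _ _ _ _ _ e]) (use m P' in auto)
  have nw: "n \<in> Weq M" using weq_retract[of n u] n u N' by simp
  obtain c t where c: "c \<in> Cof M" "t \<in> Fib M" "t \<in> Weq M" "Cod M c = Dom M t" "t \<cdot> c = n"
    "Dom M c = Dom M n" "Cod M t = Cod M n" using factor_Cof_TFib[OF n(1)] by blast
  have cw: "c \<in> Weq M" using two_of_three(3)[of c t] c nw by simp
  obtain k where k: "k \<in> Arr M" "Dom M k = Dom M a" "Cod M k = Dom M u" "u \<cdot> k = a" "v \<cdot> k = H"
    by (rule pullback_lift[OF N, of a H]) (use a H DH m P' in auto)
  obtain y where y: "y \<in> Arr M" "Dom M y = Dom M a" "Cod M y = Dom M t" "t \<cdot> y = k"
    by (rule cofibrant_lift[of k t]) (use k c n a in auto)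
  have sq: "m \<cdot> Ide M (Dom M m) = (p\<^sub>1 \<cdot> (v \<cdot> t)) \<cdot> c"
    using m c n N' P' by (simp add: assoc extend[OF P'(13)])
  \<comment> \<open>Transport along paths: \<open>R\<close> is the identity on constant paths and
    lies over the end point of the path. It agrees with \<open>u \<cdot> t\<close> after
    \<open>c\<close>, hence equals it in \<open>Ho M\<close>.\<close>
  obtain R where R: "R \<in> Arr M" "Dom M R = Cod M c" "Cod M R = Dom M m" "R \<cdot> c = Ide M (Dom M m)"
    "m \<cdot> R = p\<^sub>1 \<cdot> (v \<cdot> t)"
    by (rule lift[OF c(1) m disjI1[OF cw] _ _ _ _ _ _ sq]) (use m c n N' P' in auto)
  have "\<gamma> R = \<gamma> (u \<cdot> t)"
    by (rule \<gamma>_sections[OF cw]) (use R c n N' in \<open>simp_all add: assoc\<close>)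
  then have "\<gamma> (R \<cdot> y) = \<gamma> ((u \<cdot> t) \<cdot> y)" using R y c n N' by (simp add: \<gamma>_comp)
  also have "(u \<cdot> t) \<cdot> y = a" using y c n k N' by (simp add: assoc)
  finally have g: "\<gamma> (R \<cdot> y) = \<gamma> a" .
  have "m \<cdot> (R \<cdot> y) = b" using R y c n k N' m P' H by (simp add: extend[OF R(5)] assoc)
  then show ?thesis using that[of "R \<cdot> y"] g R y c by simp
qed

lemma htp_weq:
  assumes "htp Y a b" "b \<in> Weq M"
  shows "a \<in> Weq M"
proof -
  obtain s p\<^sub>0 p\<^sub>1 H where P: "path_object Y s p\<^sub>0 p\<^sub>1" and H: "H \<in> Arr M" "Cod M H = Cod M s" "p\<^sub>0 \<cdot> H = a" "p\<^sub>1 \<cdot> H = b"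
    using assms(1) by (rule htpE)
  note P' = path_object_simps[OF P]
  have "H \<in> Weq M" using two_of_three(3)[of H p\<^sub>1] H P' assms(2) by simp
  then show ?thesis using two_of_three(1)[of H p\<^sub>0] H P' by simp
qed

text \<open>
  An inverse of \<open>\<gamma> p\<close> is represented by a strict section of the base change of \<open>p\<close> to a cofibrant
  replacement of its codomain; this exhibits the base change as a retract of a weak equivalence.
\<close>

lemma fib_iso_weq:
  assumes p: "p \<in> Fib M" and Y: "fibrant M (Cod M p)"
    and g: "g \<in> Arr (Ho M)" "Dom (Ho M) g = Cod M p" "Cod (Ho M) g = Dom M p"
      "g \<diamondop> \<gamma> p = cls (Dom M p) [] (Dom M p)" "\<gamma> p \<diamondop> g = cls (Cod M p) [] (Cod M p)"
  shows "p \<in> Weq M"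
proof -
  define e where "e = crep (Cod M p)"
  define e' where "e' = crep (Dom M p)"
  define k' where "k' = crep_map p"
  have E: "fibrant M (Dom M p)" using fibrant_fib[OF p Y] .
  have e: "e \<in> Fib M" "e \<in> Weq M" "e \<in> Arr M" "Cod M e = Cod M p" "cofibrant (Dom M e)"
    using p by (simp_all add: e_def)
  have e': "e' \<in> Weq M" "e' \<in> Arr M" "Cod M e' = Dom M p" "cofibrant (Dom M e')"
    using p by (simp_all add: e'_def)
  have k': "k' \<in> Arr M" "Dom M k' = Dom M e'" "Cod M k' = Dom M e" "e \<cdot> k' = p \<cdot> e'"
    using p crep_map_eq[of p] by (simp_all add: e_def e'_def k'_def)
  obtain y where y: "y \<in> Arr M" "Dom M y = Dom M e" "Cod M y = Dom M p" "g \<diamondop> \<gamma> e = \<gamma> y"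
    using Ho_represented[OF g(1)] E g by (auto simp: e_def)
  have "\<gamma> (p \<cdot> y) = \<gamma> p \<diamondop> (g \<diamondop> \<gamma> e)" using y p by (simp add: \<gamma>_comp)
  also have "\<dots> = \<gamma> e" using g e p by (simp flip: Ho.assoc)
  finally have h: "htp (Cod M p) (p \<cdot> y) e"
    by (intro \<gamma>_eq_htp[OF Y]) (use y e p in auto)
  obtain y' where y': "y' \<in> Arr M" "Dom M y' = Dom M e" "Cod M y' = Dom M p" "p \<cdot> y' = e" "\<gamma> y' = \<gamma> y"
    by (rule homotopy_lift[OF p _ _ _ h]) (use y e in auto)
  \<comment> \<open>The other inverse law: \<open>y' \<cdot> k'\<close> represents
    \<open>g \<diamondop> \<gamma> p\<close> on the replacement of \<open>Dom M p\<close>, so it is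
    homotopic to the weak equivalence \<open>e'\<close>.\<close>
  have "\<gamma> (y' \<cdot> k') = g \<diamondop> (\<gamma> e \<diamondop> \<gamma> k')"
    using y' k' e g by (simp add: \<gamma>_comp Ho.assoc flip: y(4))
  also have "\<gamma> e \<diamondop> \<gamma> k' = \<gamma> p \<diamondop> \<gamma> e'" using k' e e' p by (simp flip: \<gamma>_comp)
  also have "g \<diamondop> \<dots> = \<gamma> e'" using g e' p by (simp flip: Ho.assoc)
  finally have "htp (Dom M p) (y' \<cdot> k') e'"
    by (intro \<gamma>_eq_htp[OF E]) (use y' k' e' in auto)
  then have w1: "y' \<cdot> k' \<in> Weq M" using htp_weq e'(1) by blast
  obtain u v where N: "is_pullback M p e u v" using pb[of p e] p e by auto
  note N' = pullback_simps[OF N]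
  have u: "u \<in> Weq M" using tfib_pullback(2)[OF N e(1,2)] .
  obtain \<sigma> where \<sigma>: "\<sigma> \<in> Arr M" "Dom M \<sigma> = Dom M e" "Cod M \<sigma> = Dom M u" "u \<cdot> \<sigma> = y'" "v \<cdot> \<sigma> = Ide M (Dom M e)"
    by (rule pullback_lift[OF N, of y' "Ide M (Dom M e)"]) (use y' e in auto)
  obtain k where k: "k \<in> Arr M" "Dom M k = Dom M e'" "Cod M k = Dom M u" "u \<cdot> k = e'" "v \<cdot> k = k'"
    by (rule pullback_lift[OF N, of e' k']) (use e' k' in auto)
  have kw: "k \<in> Weq M" using two_of_three(3)[of k u] k u N' e' by simp
  have "u \<cdot> (\<sigma> \<cdot> k') = y' \<cdot> k'" using N' \<sigma> k' by (simp add: extend[OF \<sigma>(4)])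
  then have "\<sigma> \<cdot> k' \<in> Weq M" using two_of_three(3)[of "\<sigma> \<cdot> k'" u] u w1 N' \<sigma> k' by simp
  then have w2: "(\<sigma> \<cdot> v) \<cdot> k \<in> Weq M" using k \<sigma> N' by (simp add: assoc)
  have sv: "\<sigma> \<cdot> v \<in> Weq M" by (rule two_of_three(2)[OF _ _ _ kw w2]) (use k \<sigma> N' in simp_all)
  \<comment> \<open>The retract diagram has identities on domains, and the section
    \<open>\<sigma>\<close> followed by \<open>v\<close> on codomains.\<close>
  have "is_retract M v (\<sigma> \<cdot> v)"
    unfolding is_retract_def
  proof (intro conjI)
    show "\<exists>s\<in>hom M (Dom M v) (Dom M (\<sigma> \<cdot> v)). \<exists>r\<in>hom M (Dom M (\<sigma> \<cdot> v)) (Dom M v).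
       \<exists>s'\<in>hom M (Cod M v) (Cod M (\<sigma> \<cdot> v)). \<exists>r'\<in>hom M (Cod M (\<sigma> \<cdot> v)) (Cod M v).
        \<sigma> \<cdot> v \<cdot> s = s' \<cdot> v \<and> v \<cdot> r = r' \<cdot> (\<sigma> \<cdot> v) \<and> r \<cdot> s = Ide M (Dom M v) \<and> r' \<cdot> s' = Ide M (Cod M v)"
      by (rule bexI[of _ "Ide M (Dom M v)"], rule bexI[of _ "Ide M (Dom M v)"], rule bexI[of _ \<sigma>], rule bexI[of _ v])
        (use \<sigma> N' in \<open>simp_all add: extend[OF \<sigma>(5)]\<close>)
  qed (use \<sigma> N' in auto)
  moreover have "retract_closed M (Weq M)"
    using model unfolding model_category_def by (elim conjE) assumption
  ultimately have "v \<in> Weq M" using sv unfolding retract_closed_def by blast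
  then have "p \<cdot> u \<in> Weq M" using two_of_three(1)[of v e] N' e by simp
  then show ?thesis using two_of_three(2)[of u p] u N' by simp
qed

section \<open>Homotopy monomorphisms\<close>

text \<open>
  A fibration \<open>m : A \<rightarrow> Y\<close> satisfies this lifting condition exactly when the projections of
  \<open>A \<times>\<^sub>Y A\<close> are trivial fibrations, i.e. when its diagonal is a weak equivalence.
\<close>

definition hmono_fib :: "'a \<Rightarrow> bool" where
  "hmono_fib m \<longleftrightarrow> m \<in> Fib M \<and>
     (\<forall>i\<in>I. \<forall>u u'. u \<in> hom M (Dom M i) (Dom M m) \<and> u' \<in> hom M (Cod M i) (Dom M m) \<and> m \<cdot> u = m \<cdot> (u' \<cdot> i) \<longrightarrow>
        (\<exists>h. h \<in> hom M (Cod M i) (Dom M m) \<and> h \<cdot> i = u \<and> m \<cdot> h = m \<cdot> u'))"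

lemma hmono_fib_lift:
  assumes "hmono_fib m" "i \<in> I" "u \<in> Arr M" "u' \<in> Arr M" "Dom M u = Dom M i" "Cod M u = Dom M m"
    "Dom M u' = Cod M i" "Cod M u' = Dom M m" "m \<cdot> u = m \<cdot> (u' \<cdot> i)"
  obtains h where "h \<in> Arr M" "Dom M h = Cod M i" "Cod M h = Dom M m" "h \<cdot> i = u" "m \<cdot> h = m \<cdot> u'"
proof -
  have "u \<in> hom M (Dom M i) (Dom M m) \<and> u' \<in> hom M (Cod M i) (Dom M m) \<and> m \<cdot> u = m \<cdot> (u' \<cdot> i)"
    using assms(3-) by simp
  then have "\<exists>h. h \<in> hom M (Cod M i) (Dom M m) \<and> h \<cdot> i = u \<and> m \<cdot> h = m \<cdot> u'"
    using assms(1,2) unfolding hmono_fib_def by blast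
  then show ?thesis using that by auto
qed

definition lifting_maps :: "'a \<Rightarrow> 'a set" where
  "lifting_maps m = {m \<cdot> u | u i. i \<in> I \<and> u \<in> hom M (Cod M i) (Dom M m)}"

text \<open>For a square against \<open>q\<close> with bottom map \<open>v\<close>, the hypothesis
  on \<open>lifting_maps\<close> lifts \<open>n \<cdot> v\<close> to some \<open>u'\<close> that
  ignores the top map; the lifting condition of \<open>m\<close> then replaces \<open>u'\<close> by
  a lift that fits it. The case \<open>n = m\<close> treats the projection of the fiber product of
  \<open>m\<close> with itself.\<close>

lemma hmono_fib_compare:
  assumes m: "hmono_fib m" and n: "n \<in> Fib M" and L: "lifting_maps n \<subseteq> lifting_maps m"
    and P: "is_pullback M m n p q"
  shows "q \<in> Fib M" "q \<in> Weq M"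
proof -
  note P' = pullback_simps[OF P]
  have "q \<in> rlp M I"
  proof (rule rlpI)
    fix i u v assume i: "i \<in> I" and u: "u \<in> Arr M" "Dom M u = Dom M i" "Cod M u = Dom M q"
      and v: "v \<in> Arr M" "Dom M v = Cod M i" "Cod M v = Cod M q" and eq: "q \<cdot> u = v \<cdot> i"
    have i': "i \<in> Arr M" using i I_arr by auto
    have "n \<cdot> v \<in> lifting_maps n" using i v P' by (auto simp: lifting_maps_def)
    \<comment> \<open>The lift may be recorded for another generator \<open>j\<close>; only the
      equality of codomains, derived from \<open>n \<cdot> v = m \<cdot> u'\<close>, is
      used.\<close>
    then obtain u' j where u': "n \<cdot> v = m \<cdot> u'" "u' \<in> hom M (Cod M j) (Dom M m)"
      using L unfolding lifting_maps_def by blast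
    have "Dom M (n \<cdot> v) = Dom M (m \<cdot> u')" using u'(1) by simp
    then have D: "Dom M u' = Cod M i" using u'(2) v P' by auto
    have "m \<cdot> (p \<cdot> u) = n \<cdot> (v \<cdot> i)" using P' u eq by (simp add: extend[OF P'(9)] assoc)
    also have "\<dots> = m \<cdot> (u' \<cdot> i)"
      using P' v i' D u' by (simp add: extend[OF u'(1)] assoc)
    finally have sq: "m \<cdot> (p \<cdot> u) = m \<cdot> (u' \<cdot> i)" .
    obtain h where h: "h \<in> Arr M" "Dom M h = Cod M i" "Cod M h = Dom M m" "h \<cdot> i = p \<cdot> u" "m \<cdot> h = m \<cdot> u'"
      by (rule hmono_fib_lift[OF m i _ _ _ _ _ _ sq]) (use P' u u' D in auto)
    obtain w where w: "w \<in> Arr M" "Dom M w = Cod M i" "Cod M w = Dom M p" "p \<cdot> w = h" "q \<cdot> w = v"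
      by (rule pullback_lift[OF P, of h v]) (use h v P' u' in auto)
    have "w \<cdot> i = u"
      by (rule pullback_unique[OF P]) (use w i' u h eq P' in \<open>simp_all flip: assoc\<close>)
    then show "\<exists>h. h \<in> Arr M \<and> Dom M h = Cod M i \<and> Cod M h = Dom M q \<and> h \<cdot> i = u \<and> q \<cdot> h = v"
      using w P' by auto
  qed (rule P')
  then show "q \<in> Fib M" "q \<in> Weq M" using TFib_eq by auto
qed

lemma hmono_fib_diagonal:
  assumes m: "hmono_fib m"
  obtains p q d where "is_pullback M m m p q" "d \<in> Weq M" "Dom M d = Dom M m" "Cod M d = Dom M p"
    "p \<cdot> d = Ide M (Dom M m)" "q \<cdot> d = Ide M (Dom M m)"
proof -
  have mf: "m \<in> Fib M" using m by (simp add: hmono_fib_def)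
  obtain p q where P: "is_pullback M m m p q" using pb[of m m] mf by auto
  note P' = pullback_simps[OF P]
  obtain d where d: "d \<in> Arr M" "Dom M d = Dom M m" "Cod M d = Dom M p" "p \<cdot> d = Ide M (Dom M m)" "q \<cdot> d = Ide M (Dom M m)"
    by (rule pullback_lift[OF P, of "Ide M (Dom M m)" "Ide M (Dom M m)"]) (use mf in auto)
  have "d \<in> Weq M" using weq_retract[of d q] hmono_fib_compare[OF m mf _ P] d P' by simp
  then show ?thesis using that P d by blast
qed

text \<open>A fibration with fibrant target serves as its own fibrant replacement, with identities
  as comparison maps, so the ordinary diagonal can be used.\<close>

lemma hmono_fib_homotopy_mono:
  assumes m: "hmono_fib m" and Y: "fibrant M (Cod M m)"
  shows "homotopy_mono M m"
proof -
  have mf: "m \<in> Fib M" using m by (simp add: hmono_fib_def)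
  obtain p q d where P: "is_pullback M m m p q" and d: "d \<in> Weq M" "Dom M d = Dom M m" "Cod M d = Dom M p"
    "p \<cdot> d = Ide M (Dom M m)" "q \<cdot> d = Ide M (Dom M m)" using hmono_fib_diagonal[OF m] .
  have "is_homotopy_fiber_product M m m (Ide M (Dom M m)) (Ide M (Dom M m)) p q"
    unfolding is_homotopy_fiber_product_def
    by (intro conjI exI[of _ "Cod M m"] exI[of _ "Ide M (Cod M m)"] exI[of _ m] P Y) (use mf in auto)
  moreover have "is_iso (Ho M) (to_Ho M d)" using \<gamma>_weq_iso[OF d(1)] .
  ultimately show ?thesis unfolding homotopy_mono_def using mf d
    by (metis class_arr(1,3) in_hom)
qed

text \<open>Represent both morphisms by maps \<open>a\<close> and \<open>b\<close> from a cofibrant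
  replacement. Equality in \<open>Ho M\<close> makes \<open>m \<cdot> a\<close> and
  \<open>m \<cdot> b\<close> homotopic, and \<open>homotopy_lift\<close> corrects \<open>a\<close>
  to \<open>a'\<close> with \<open>m \<cdot> a' = m \<cdot> b\<close>. The pair then factors through
  the fiber product, whose projections agree in \<open>Ho M\<close> because they share the diagonal
  as a section.\<close>

lemma hmono_fib_mono:
  assumes m: "hmono_fib m" and Y: "fibrant M (Cod M m)"
    and h: "h \<in> Arr (Ho M)" "h' \<in> Arr (Ho M)" "Dom (Ho M) h = Dom (Ho M) h'" "Cod (Ho M) h = Dom M m"
      "Cod (Ho M) h' = Dom M m" "\<gamma> m \<diamondop> h = \<gamma> m \<diamondop> h'"
  shows "h = h'"
proof -
  have mf: "m \<in> Fib M" using m by (simp add: hmono_fib_def)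
  have A: "fibrant M (Dom M m)" using fibrant_fib[OF mf Y] .
  define e where "e = crep (Dom (Ho M) h)"
  have "Dom (Ho M) h \<in> Obj M" using Ho.Dom_Obj[OF h(1)] by simp
  then have e: "e \<in> Weq M" "e \<in> Arr M" "Cod M e = Dom (Ho M) h" "cofibrant (Dom M e)" by (simp_all add: e_def)
  obtain a where a: "a \<in> Arr M" "Dom M a = Dom M e" "Cod M a = Dom M m" "h \<diamondop> \<gamma> e = \<gamma> a"
    using Ho_represented[OF h(1)] h A by (auto simp: e_def)
  obtain b where b: "b \<in> Arr M" "Dom M b = Dom M e" "Cod M b = Dom M m" "h' \<diamondop> \<gamma> e = \<gamma> b"
    using Ho_represented[OF h(2)] h A by (auto simp: e_def)
  have "\<gamma> (m \<cdot> a) = (\<gamma> m \<diamondop> h) \<diamondop> \<gamma> e" using a mf h(1-5) e by (simp add: \<gamma>_comp Ho.assoc)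
  also have "\<dots> = \<gamma> (m \<cdot> b)" unfolding h(6) using b mf h(1-5) e by (simp add: \<gamma>_comp Ho.assoc)
  finally have h': "htp (Cod M m) (m \<cdot> a) (m \<cdot> b)"
    by (intro \<gamma>_eq_htp[OF Y]) (use a b mf e in auto)
  obtain a' where a': "a' \<in> Arr M" "Dom M a' = Dom M a" "Cod M a' = Dom M m" "m \<cdot> a' = m \<cdot> b" "\<gamma> a' = \<gamma> a"
    by (rule homotopy_lift[OF mf _ _ _ h']) (use a e in auto)
  obtain p q d where P: "is_pullback M m m p q" and d: "d \<in> Weq M" "Dom M d = Dom M m" "Cod M d = Dom M p"
    "p \<cdot> d = Ide M (Dom M m)" "q \<cdot> d = Ide M (Dom M m)" using hmono_fib_diagonal[OF m] .
  note P' = pullback_simps[OF P]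
  obtain k where k: "k \<in> Arr M" "Dom M k = Dom M a" "Cod M k = Dom M p" "p \<cdot> k = a'" "q \<cdot> k = b"
    by (rule pullback_lift[OF P, of a' b]) (use a' a b in auto)
  have "\<gamma> p = \<gamma> q" by (rule \<gamma>_sections[OF d(1)]) (use d P' in auto)
  then have "\<gamma> (p \<cdot> k) = \<gamma> (q \<cdot> k)" using k(1-3) P' by (simp add: \<gamma>_comp)
  then have he: "h \<diamondop> \<gamma> e = h' \<diamondop> \<gamma> e" using k a b a' by simp
  show ?thesis by (rule Ho_epi[OF e(1) _ _ _ _ he]) (use h e in auto)
qed

text \<open>
  The fibrant replacement \<open>A\<^sub>1 \<rightarrow> B' \<leftarrow> A\<^sub>2\<close> in the hypothesis need not be related to \<open>m\<close> over \<open>Y\<close>.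
  A lift found in \<open>A\<^sub>2\<close> is carried back to \<open>A\<close> by a retraction \<open>R\<close> lying over a retraction \<open>\<rho>\<close> of
  a replacement of \<open>Y \<rightarrow> B'\<close> by a trivial cofibration.
\<close>

lemma homotopy_mono_hmono_fib:
  assumes mono: "homotopy_mono M g" and Y: "fibrant M (Cod M g)"
    and j: "j \<in> Cof M" "j \<in> Weq M" and m: "m \<in> Fib M" "Cod M j = Dom M m" "m \<cdot> j = g"
  shows "hmono_fib m"
proof -
  obtain a a' p q d where hfp: "is_homotopy_fiber_product M g g a a' p q"
    and d: "d \<in> Arr M" "Dom M d = Dom M g" "Cod M d = Dom M p" "p \<cdot> d = a" "q \<cdot> d = a'" and iso: "is_iso (Ho M) (\<gamma> d)"
    and g: "g \<in> Arr M"
    using mono by (auto simp: homotopy_mono_def)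
  obtain B' b g' h' where B: "fibrant M B'" and b: "b \<in> Weq M" "Dom M b = Cod M g" "Cod M b = B'"
    and g': "g' \<in> Fib M" "Dom M g' = Cod M a" "Cod M g' = B'"
    and h': "h' \<in> Fib M" "Dom M h' = Cod M a'" "Cod M h' = B'"
    and a: "Dom M a = Dom M g" "Dom M a' = Dom M g" "a \<in> Weq M" "a' \<in> Weq M"
    and ga: "g' \<cdot> a = b \<cdot> g" "h' \<cdot> a' = b \<cdot> g" and P: "is_pullback M g' h' p q"
    using hfp by (auto simp: is_homotopy_fiber_product_def)
  note P' = pullback_simps[OF P]
  have jm: "Dom M j = Dom M g" "Cod M m = Cod M g" using j m by auto
  have pf: "p \<in> Fib M" using fib_pullback(2)[OF P h'(1)] .
  obtain \<delta> where \<delta>: "\<delta> \<in> Arr (Ho M)" "Dom (Ho M) \<delta> = Dom M p" "Cod (Ho M) \<delta> = Dom M g"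
    "\<gamma> d \<diamondop> \<delta> = cls (Dom M p) [] (Dom M p)"
    using iso d by (auto simp: is_iso_def)
  have \<gamma>a: "\<gamma> a = \<gamma> p \<diamondop> \<gamma> d" using d P' by (simp flip: \<gamma>_comp)
  \<comment> \<open>Since \<open>p \<cdot> d = a\<close> with \<open>a\<close> a weak equivalence
    and \<open>d\<close> invertible in \<open>Ho M\<close>, the class of \<open>p\<close> is
    invertible there, and \<open>fib_iso_weq\<close> applies.\<close>
  have "p \<in> Weq M"
  proof (rule fib_iso_weq[OF pf])
    let ?g = "\<gamma> d \<diamondop> \<gamma>_inv a"
    show "fibrant M (Cod M p)" using fibrant_fib[OF g'(1)] B g' P' by simp
    show "?g \<in> Arr (Ho M)" "Dom (Ho M) ?g = Cod M p" "Cod (Ho M) ?g = Dom M p"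
      using d a P' g' by simp_all
    show "\<gamma> p \<diamondop> ?g = cls (Cod M p) [] (Cod M p)"
      using d a P' g' by (simp flip: Ho.assoc \<gamma>a)
    have "\<gamma> d = (?g \<diamondop> \<gamma> p) \<diamondop> \<gamma> d" using d a P' g' by (simp add: Ho.assoc flip: \<gamma>a)
    then have "\<gamma> d \<diamondop> \<delta> = ((?g \<diamondop> \<gamma> p) \<diamondop> \<gamma> d) \<diamondop> \<delta>" by simp
    also have "\<dots> = (?g \<diamondop> \<gamma> p) \<diamondop> (\<gamma> d \<diamondop> \<delta>)" using d a P' g' \<delta> by (simp add: Ho.assoc)
    finally show "?g \<diamondop> \<gamma> p = cls (Dom M p) [] (Dom M p)" using d a P' g' \<delta> by simp
  qed
  then have p: "p \<in> rlp M I" using pf TFib_eq by auto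
  have sq: "g' \<cdot> a = (b \<cdot> m) \<cdot> j" "h' \<cdot> a' = (b \<cdot> m) \<cdot> j" using ga b j m jm by (simp_all add: assoc)
  \<comment> \<open>The comparison maps \<open>a\<close> and \<open>a'\<close> start at
    \<open>Dom M g\<close>; they extend over the trivial cofibration \<open>j\<close> to the domain
    of the fibration \<open>m\<close>.\<close>
  obtain \<alpha>\<^sub>1 where \<alpha>\<^sub>1: "\<alpha>\<^sub>1 \<in> Arr M" "Dom M \<alpha>\<^sub>1 = Dom M m" "Cod M \<alpha>\<^sub>1 = Dom M g'" "\<alpha>\<^sub>1 \<cdot> j = a" "g' \<cdot> \<alpha>\<^sub>1 = b \<cdot> m"
    by (rule lift[OF j(1) g'(1) disjI1[OF j(2)] _ _ _ _ _ _ sq(1)]) (use a b m j jm g' in auto)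
  obtain \<alpha>\<^sub>2 where \<alpha>\<^sub>2: "\<alpha>\<^sub>2 \<in> Arr M" "Dom M \<alpha>\<^sub>2 = Dom M m" "Cod M \<alpha>\<^sub>2 = Dom M h'" "\<alpha>\<^sub>2 \<cdot> j = a'" "h' \<cdot> \<alpha>\<^sub>2 = b \<cdot> m"
    by (rule lift[OF j(1) h'(1) disjI1[OF j(2)] _ _ _ _ _ _ sq(2)]) (use a b m j jm h' in auto)
  have \<alpha>\<^sub>2w: "\<alpha>\<^sub>2 \<in> Weq M" using two_of_three(2)[of j \<alpha>\<^sub>2] j m \<alpha>\<^sub>2 a by simp
  obtain cb tb where cb: "cb \<in> Cof M" "tb \<in> Fib M" "tb \<in> Weq M" "Cod M cb = Dom M tb" "tb \<cdot> cb = b"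
    "Dom M cb = Dom M b" "Cod M tb = Cod M b" using factor_Cof_TFib[of b] b by auto
  have cbw: "cb \<in> Weq M" using two_of_three(3)[of cb tb] cb b by simp
  obtain \<rho> where \<rho>: "\<rho> \<in> Arr M" "Dom M \<rho> = Cod M cb" "Cod M \<rho> = Cod M g" "\<rho> \<cdot> cb = Ide M (Cod M g)"
    by (rule fibrant_extend[OF Y cb(1) cbw, of "Ide M (Cod M g)"]) (use cb b g in auto)
  \<comment> \<open>Base change of \<open>h'\<close> to \<open>Cod M cb\<close>, where the
    retraction \<open>\<rho>\<close> onto \<open>Y\<close> is defined.\<close>
  obtain r\<^sub>1 r\<^sub>2 where Q: "is_pullback M h' tb r\<^sub>1 r\<^sub>2" using pb[of h' tb] h' cb b by auto
  note Q' = pullback_simps[OF Q]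
  have r\<^sub>1: "r\<^sub>1 \<in> Weq M" using tfib_pullback(2)[OF Q cb(2,3)] .
  have sq2: "h' \<cdot> \<alpha>\<^sub>2 = tb \<cdot> (cb \<cdot> m)" using \<alpha>\<^sub>2 cb b m jm by (simp add: extend[OF cb(5)])
  obtain \<alpha> where \<alpha>: "\<alpha> \<in> Arr M" "Dom M \<alpha> = Dom M m" "Cod M \<alpha> = Dom M r\<^sub>1" "r\<^sub>1 \<cdot> \<alpha> = \<alpha>\<^sub>2" "r\<^sub>2 \<cdot> \<alpha> = cb \<cdot> m"
    by (rule pullback_lift[OF Q _ _ _ _ _ sq2]) (use \<alpha>\<^sub>2 cb b m jm in auto)
  have \<alpha>w: "\<alpha> \<in> Weq M" using two_of_three(3)[of \<alpha> r\<^sub>1] \<alpha> r\<^sub>1 \<alpha>\<^sub>2w Q' by simp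
  obtain c t where c: "c \<in> Cof M" "t \<in> Fib M" "t \<in> Weq M" "Cod M c = Dom M t" "t \<cdot> c = \<alpha>"
    "Dom M c = Dom M \<alpha>" "Cod M t = Cod M \<alpha>" using factor_Cof_TFib[OF \<alpha>(1)] by blast
  have cw: "c \<in> Weq M" using two_of_three(3)[of c t] c \<alpha>w by simp
  have t: "t \<in> rlp M I" using c TFib_eq by auto
  have sq': "m \<cdot> Ide M (Dom M m) = (\<rho> \<cdot> (r\<^sub>2 \<cdot> t)) \<cdot> c"
    using \<rho> Q' c \<alpha> m cb b jm by (simp add: assoc extend[OF \<rho>(4)])
  obtain R where R: "R \<in> Arr M" "Dom M R = Cod M c" "Cod M R = Dom M m" "R \<cdot> c = Ide M (Dom M m)"
    "m \<cdot> R = \<rho> \<cdot> (r\<^sub>2 \<cdot> t)"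
    by (rule lift[OF c(1) m(1) disjI1[OF cw] _ _ _ _ _ _ sq']) (use \<rho> Q' c \<alpha> m cb b jm in auto)
  show ?thesis
    unfolding hmono_fib_def
  proof (intro conjI ballI allI impI m(1))
    fix i u u'
    assume i: "i \<in> I" and A: "u \<in> hom M (Dom M i) (Dom M m) \<and> u' \<in> hom M (Cod M i) (Dom M m) \<and> m \<cdot> u = m \<cdot> (u' \<cdot> i)"
    have i': "i \<in> Arr M" using i I_arr by auto
    have u: "u \<in> Arr M" "Dom M u = Dom M i" "Cod M u = Dom M m" and u': "u' \<in> Arr M" "Dom M u' = Cod M i" "Cod M u' = Dom M m"
      and eq: "m \<cdot> u = m \<cdot> (u' \<cdot> i)" using A by auto
    have sqk: "g' \<cdot> (\<alpha>\<^sub>1 \<cdot> (u' \<cdot> i)) = h' \<cdot> (\<alpha>\<^sub>2 \<cdot> u)"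
      using \<alpha>\<^sub>1 \<alpha>\<^sub>2 u u' i' g' h' m b jm by (simp add: extend[OF \<alpha>\<^sub>1(5)] extend[OF \<alpha>\<^sub>2(5)] assoc eq)
    obtain k where k: "k \<in> Arr M" "Dom M k = Dom M i" "Cod M k = Dom M p" "p \<cdot> k = \<alpha>\<^sub>1 \<cdot> (u' \<cdot> i)" "q \<cdot> k = \<alpha>\<^sub>2 \<cdot> u"
      by (rule pullback_lift[OF P _ _ _ _ _ sqk]) (use \<alpha>\<^sub>1 \<alpha>\<^sub>2 u u' i' in auto)
    \<comment> \<open>Lifting against \<open>p\<close> prescribes the first component
      \<open>\<alpha>\<^sub>1 \<cdot> u'\<close>. The second component \<open>q \<cdot> l\<close>
      then extends \<open>\<alpha>\<^sub>2 \<cdot> u\<close> over \<open>i\<close> and lies over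
      \<open>b \<cdot> (m \<cdot> u')\<close>.\<close>
    obtain l where l: "l \<in> Arr M" "Dom M l = Cod M i" "Cod M l = Dom M p" "l \<cdot> i = k" "p \<cdot> l = \<alpha>\<^sub>1 \<cdot> u'"
      by (rule rlp_lift[OF p i, of k "\<alpha>\<^sub>1 \<cdot> u'"]) (use k \<alpha>\<^sub>1 u' i' P' in \<open>simp_all add: assoc\<close>)
    have h1: "h' \<cdot> (q \<cdot> l) = tb \<cdot> (cb \<cdot> (m \<cdot> u'))"
    proof -
      have "h' \<cdot> (q \<cdot> l) = g' \<cdot> (p \<cdot> l)" using P'(1-8) l(1-3) by (simp add: extend[OF P'(9)[symmetric]] assoc)
      also have "\<dots> = b \<cdot> (m \<cdot> u')" using l \<alpha>\<^sub>1 u' g' m b jm by (simp add: extend[OF \<alpha>\<^sub>1(5)] assoc)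
      also have "\<dots> = tb \<cdot> (cb \<cdot> (m \<cdot> u'))" using cb b m jm u' by (simp add: extend[OF cb(5)])
      finally show ?thesis .
    qed
    obtain h\<^sub>1 where h\<^sub>1: "h\<^sub>1 \<in> Arr M" "Dom M h\<^sub>1 = Cod M i" "Cod M h\<^sub>1 = Dom M r\<^sub>1" "r\<^sub>1 \<cdot> h\<^sub>1 = q \<cdot> l" "r\<^sub>2 \<cdot> h\<^sub>1 = cb \<cdot> (m \<cdot> u')"
      by (rule pullback_lift[OF Q _ _ _ _ _ h1]) (use l P' u' m cb b jm in auto)
    have h\<^sub>1i: "h\<^sub>1 \<cdot> i = \<alpha> \<cdot> u"
    proof (rule pullback_unique[OF Q])
      have "r\<^sub>1 \<cdot> (h\<^sub>1 \<cdot> i) = q \<cdot> k" using h\<^sub>1 Q' i' l P' by (simp add: extend[OF h\<^sub>1(4)] assoc)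
      also have "\<dots> = r\<^sub>1 \<cdot> (\<alpha> \<cdot> u)" using k \<alpha> u Q' by (simp add: extend[OF \<alpha>(4)])
      finally show "r\<^sub>1 \<cdot> (h\<^sub>1 \<cdot> i) = r\<^sub>1 \<cdot> (\<alpha> \<cdot> u)" .
      have "r\<^sub>2 \<cdot> (h\<^sub>1 \<cdot> i) = cb \<cdot> (m \<cdot> (u' \<cdot> i))"
        using h\<^sub>1 Q' i' u' m cb b jm by (simp add: extend[OF h\<^sub>1(5)] assoc)
      also have "\<dots> = r\<^sub>2 \<cdot> (\<alpha> \<cdot> u)" using \<alpha> u Q' m cb b jm by (simp add: extend[OF \<alpha>(5)] assoc flip: eq)
      finally show "r\<^sub>2 \<cdot> (h\<^sub>1 \<cdot> i) = r\<^sub>2 \<cdot> (\<alpha> \<cdot> u)" .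
    qed (use h\<^sub>1 \<alpha> u i' Q' in auto)
    obtain h\<^sub>2 where h\<^sub>2: "h\<^sub>2 \<in> Arr M" "Dom M h\<^sub>2 = Cod M i" "Cod M h\<^sub>2 = Dom M t" "h\<^sub>2 \<cdot> i = c \<cdot> u" "t \<cdot> h\<^sub>2 = h\<^sub>1"
      by (rule rlp_lift[OF t i, of "c \<cdot> u" h\<^sub>1]) (use h\<^sub>1 h\<^sub>1i c u \<alpha> in \<open>simp_all add: extend[OF c(5)]\<close>)
    have "(R \<cdot> h\<^sub>2) \<cdot> i = u" using R h\<^sub>2 c u i' \<alpha> by (simp add: assoc extend[OF R(4)])
    moreover have "m \<cdot> (R \<cdot> h\<^sub>2) = m \<cdot> u'"
      using R h\<^sub>2 c \<alpha> Q' m \<rho> h\<^sub>1 cb b jm u' by (simp add: extend[OF R(5)] assoc extend[OF \<rho>(4)])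
    ultimately show "\<exists>h. h \<in> hom M (Cod M i) (Dom M m) \<and> h \<cdot> i = u \<and> m \<cdot> h = m \<cdot> u'"
      using R h\<^sub>2 c by (intro exI[of _ "R \<cdot> h\<^sub>2"]) simp
  qed
qed

end

section \<open>The homotopy image\<close>

context category
begin

lemma wide_pullback_simps:
  assumes "wide_pullback S Y m b \<pi>"
  shows "b \<in> Arr C" "Cod C b = Y" "\<And>s. s \<in> S \<Longrightarrow> \<pi> s \<in> Arr C" "\<And>s. s \<in> S \<Longrightarrow> Dom C (\<pi> s) = Dom C b"
    "\<And>s. s \<in> S \<Longrightarrow> Cod C (\<pi> s) = Dom C (m s)" "\<And>s. s \<in> S \<Longrightarrow> m s \<cdot> \<pi> s = b"
  using assms unfolding wide_pullback_def by auto

lemma wide_pullback_ex1: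
  assumes W: "wide_pullback S Y m b \<pi>" and v: "v \<in> Arr C" "Cod C v = Y"
    and k: "\<And>s. s \<in> S \<Longrightarrow> k s \<in> Arr C \<and> Dom C (k s) = Dom C v \<and> Cod C (k s) = Dom C (m s) \<and> m s \<cdot> k s = v"
  shows "\<exists>!u. u \<in> hom C (Dom C v) (Dom C b) \<and> b \<cdot> u = v \<and> (\<forall>s\<in>S. \<pi> s \<cdot> u = k s)"
proof -
  have "v \<in> hom C (Dom C v) Y \<and> (\<forall>s\<in>S. k s \<in> hom C (Dom C v) (Dom C (m s)) \<and> m s \<cdot> k s = v)"
    using v k by simp
  then show ?thesis using W unfolding wide_pullback_def by blast
qed

lemma wide_pullback_lift:
  assumes "wide_pullback S Y m b \<pi>" "v \<in> Arr C" "Cod C v = Y"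
    "\<And>s. s \<in> S \<Longrightarrow> k s \<in> Arr C \<and> Dom C (k s) = Dom C v \<and> Cod C (k s) = Dom C (m s) \<and> m s \<cdot> k s = v"
  obtains u where "u \<in> Arr C" "Dom C u = Dom C v" "Cod C u = Dom C b" "b \<cdot> u = v" "\<And>s. s \<in> S \<Longrightarrow> \<pi> s \<cdot> u = k s"
  using ex1_implies_ex[OF wide_pullback_ex1[OF assms]] by auto

lemma wide_pullback_unique:
  assumes W: "wide_pullback S Y m b \<pi>" and m: "\<And>s. s \<in> S \<Longrightarrow> m s \<in> Arr C"
    and u: "u \<in> Arr C" "Cod C u = Dom C b" and u': "u' \<in> Arr C" "Cod C u' = Dom C b"
    and eq: "Dom C u = Dom C u'" "b \<cdot> u = b \<cdot> u'" "\<And>s. s \<in> S \<Longrightarrow> \<pi> s \<cdot> u = \<pi> s \<cdot> u'"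
  shows "u = u'"
proof -
  note W' = wide_pullback_simps[OF W]
  have "\<exists>!w. w \<in> hom C (Dom C (b \<cdot> u')) (Dom C b) \<and> b \<cdot> w = b \<cdot> u' \<and> (\<forall>s\<in>S. \<pi> s \<cdot> w = \<pi> s \<cdot> u')"
    by (rule wide_pullback_ex1[OF W]) (use W' m u' in \<open>auto simp flip: assoc\<close>)
  moreover have "u \<in> hom C (Dom C (b \<cdot> u')) (Dom C b) \<and> b \<cdot> u = b \<cdot> u' \<and> (\<forall>s\<in>S. \<pi> s \<cdot> u = \<pi> s \<cdot> u')"
    "u' \<in> hom C (Dom C (b \<cdot> u')) (Dom C b) \<and> b \<cdot> u' = b \<cdot> u' \<and> (\<forall>s\<in>S. \<pi> s \<cdot> u' = \<pi> s \<cdot> u')"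
    using W' u u' eq by auto
  ultimately show ?thesis by blast
qed

end

context generated_model_category
begin

text \<open>Lifts are found in each factor separately. They assemble because all of them lie over
  the same map to \<open>Y\<close>, which the lifting condition prescribes.\<close>

lemma hmono_fib_wide_pullback:
  assumes W: "wide_pullback S Y m b \<pi>" and m: "\<And>s. s \<in> S \<Longrightarrow> hmono_fib (m s) \<and> Cod M (m s) = Y"
  shows "hmono_fib b"
proof -
  note W' = wide_pullback_simps[OF W]
  have mf: "\<And>s. s \<in> S \<Longrightarrow> m s \<in> Fib M" and ma: "\<And>s. s \<in> S \<Longrightarrow> m s \<in> Arr M"
    using m by (auto simp: hmono_fib_def)
  have "b \<in> rlp M J"
  proof (rule rlpI)
    fix i u v assume i: "i \<in> J" and u: "u \<in> Arr M" "Dom M u = Dom M i" "Cod M u = Dom M b"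
      and v: "v \<in> Arr M" "Dom M v = Cod M i" "Cod M v = Cod M b" and eq: "b \<cdot> u = v \<cdot> i"
    have i': "i \<in> Arr M" using i J_arr by auto
    have "\<exists>k. k \<in> Arr M \<and> Dom M k = Cod M i \<and> Cod M k = Dom M (m s) \<and> k \<cdot> i = \<pi> s \<cdot> u \<and> m s \<cdot> k = v"
      if s: "s \<in> S" for s
    proof -
      have sq: "m s \<cdot> (\<pi> s \<cdot> u) = v \<cdot> i" using W' s ma u eq by (simp add: extend[OF W'(6)])
      have "m s \<in> rlp M J" using mf[OF s] Fib_eq by simp
      from rlp_lift[OF this i _ _ _ _ _ _ sq] show ?thesis using W' s m u v by (metis comp_simps)
    qed
    then obtain k where k: "\<And>s. s \<in> S \<Longrightarrow> k s \<in> Arr M \<and> Dom M (k s) = Cod M i \<and> Cod M (k s) = Dom M (m s) \<and>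
      k s \<cdot> i = \<pi> s \<cdot> u \<and> m s \<cdot> k s = v" by metis
    obtain w where w: "w \<in> Arr M" "Dom M w = Dom M v" "Cod M w = Dom M b" "b \<cdot> w = v" "\<And>s. s \<in> S \<Longrightarrow> \<pi> s \<cdot> w = k s"
      by (rule wide_pullback_lift[OF W, of v k]) (use v k W' in auto)
    have "w \<cdot> i = u"
    proof (rule wide_pullback_unique[OF W ma])
      show "\<pi> s \<cdot> (w \<cdot> i) = \<pi> s \<cdot> u" if "s \<in> S" for s
        using that W' w(1-3) v i' k[OF that] by (simp add: extend[OF w(5)])
    qed (use w u v i' W' eq in \<open>auto simp: extend[OF w(4)]\<close>)
    then show "\<exists>h. h \<in> Arr M \<and> Dom M h = Cod M i \<and> Cod M h = Dom M b \<and> h \<cdot> i = u \<and> b \<cdot> h = v"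
      using w v by auto
  qed (rule W')
  moreover have "\<exists>h. h \<in> hom M (Cod M i) (Dom M b) \<and> h \<cdot> i = u \<and> b \<cdot> h = b \<cdot> u'"
    if i: "i \<in> I" and A: "u \<in> hom M (Dom M i) (Dom M b) \<and> u' \<in> hom M (Cod M i) (Dom M b) \<and> b \<cdot> u = b \<cdot> (u' \<cdot> i)"
    for i u u'
  proof -
    have i': "i \<in> Arr M" using i I_arr by auto
    have u: "u \<in> Arr M" "Dom M u = Dom M i" "Cod M u = Dom M b" and u': "u' \<in> Arr M" "Dom M u' = Cod M i" "Cod M u' = Dom M b"
      and eq: "b \<cdot> u = b \<cdot> (u' \<cdot> i)" using A by auto
    have "\<exists>k. k \<in> Arr M \<and> Dom M k = Cod M i \<and> Cod M k = Dom M (m s) \<and> k \<cdot> i = \<pi> s \<cdot> u \<and> m s \<cdot> k = b \<cdot> u'"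
      if s: "s \<in> S" for s
    proof -
      note Ws = W'(1,2) W'(3-6)[OF s]
      have sq: "m s \<cdot> (\<pi> s \<cdot> u) = m s \<cdot> ((\<pi> s \<cdot> u') \<cdot> i)"
        using Ws ma[OF s] u u' i' eq by (simp add: extend[OF Ws(6)] assoc)
      obtain k where k: "k \<in> Arr M" "Dom M k = Cod M i" "Cod M k = Dom M (m s)" "k \<cdot> i = \<pi> s \<cdot> u" "m s \<cdot> k = m s \<cdot> (\<pi> s \<cdot> u')"
        by (rule hmono_fib_lift[OF _ i _ _ _ _ _ _ sq]) (use m[OF s] Ws u u' in auto)
      then show ?thesis using Ws ma[OF s] u' by (auto simp: extend[OF Ws(6)])
    qed
    then obtain k where k: "\<And>s. s \<in> S \<Longrightarrow> k s \<in> Arr M \<and> Dom M (k s) = Cod M i \<and> Cod M (k s) = Dom M (m s) \<and>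
      k s \<cdot> i = \<pi> s \<cdot> u \<and> m s \<cdot> k s = b \<cdot> u'" by metis
    obtain w where w: "w \<in> Arr M" "Dom M w = Dom M (b \<cdot> u')" "Cod M w = Dom M b" "b \<cdot> w = b \<cdot> u'"
      "\<And>s. s \<in> S \<Longrightarrow> \<pi> s \<cdot> w = k s"
      by (rule wide_pullback_lift[OF W, of "b \<cdot> u'" k]) (use u' k W' in auto)
    have D: "Dom M w = Cod M i" using w u' W' by simp
    have "w \<cdot> i = u"
    proof (rule wide_pullback_unique[OF W ma])
      show "\<pi> s \<cdot> (w \<cdot> i) = \<pi> s \<cdot> u" if "s \<in> S" for s
        using that W' w(1,3) D i' k[OF that] by (simp add: extend[OF w(5)])
      show "b \<cdot> (w \<cdot> i) = b \<cdot> u"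
        using w(1,3) D u' i' W' by (simp add: extend[OF w(4)] eq assoc)
    qed (use w(1,3) D u i' W' in auto)
    then show ?thesis using w D by auto
  qed
  ultimately show ?thesis unfolding hmono_fib_def Fib_eq by blast
qed

lemma hmono_fib_tfib:
  assumes b: "hmono_fib b" and t: "t \<in> Fib M" "t \<in> Weq M" "Cod M t = Dom M b"
  shows "hmono_fib (b \<cdot> t)"
  unfolding hmono_fib_def
proof (intro conjI ballI allI impI)
  have bf: "b \<in> Fib M" using b by (simp add: hmono_fib_def)
  show "b \<cdot> t \<in> Fib M" using fib_comp[OF t(1) bf t(3)] .
  fix i u u'
  assume i: "i \<in> I" and A: "u \<in> hom M (Dom M i) (Dom M (b \<cdot> t)) \<and> u' \<in> hom M (Cod M i) (Dom M (b \<cdot> t)) \<and>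
    b \<cdot> t \<cdot> u = b \<cdot> t \<cdot> (u' \<cdot> i)"
  have i': "i \<in> Arr M" using i I_arr by auto
  have u: "u \<in> Arr M" "Dom M u = Dom M i" "Cod M u = Dom M t" and u': "u' \<in> Arr M" "Dom M u' = Cod M i" "Cod M u' = Dom M t"
    using A bf t by auto
  have eq: "b \<cdot> (t \<cdot> u) = b \<cdot> ((t \<cdot> u') \<cdot> i)" using A bf t u u' i' by (auto simp: assoc)
  obtain h where h: "h \<in> Arr M" "Dom M h = Cod M i" "Cod M h = Dom M b" "h \<cdot> i = t \<cdot> u" "b \<cdot> h = b \<cdot> (t \<cdot> u')"
    by (rule hmono_fib_lift[OF b i _ _ _ _ _ _ eq]) (use u u' t in auto)
  have tI: "t \<in> rlp M I" using t TFib_eq by auto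
  obtain l where "l \<in> Arr M" "Dom M l = Cod M i" "Cod M l = Dom M t" "l \<cdot> i = u" "t \<cdot> l = h"
    by (rule rlp_lift[OF tI i, of u h]) (use h u t in auto)
  then show "\<exists>h. h \<in> hom M (Cod M i) (Dom M (b \<cdot> t)) \<and> h \<cdot> i = u \<and> b \<cdot> t \<cdot> h = b \<cdot> t \<cdot> u'"
    using h bf t u' by (intro exI[of _ l]) (simp add: assoc)
qed

lemma homotopy_image_exists:
  assumes small_I: "small \<kappa> I" and small_hom: "\<And>X Y. X \<in> Obj M \<Longrightarrow> Y \<in> Obj M \<Longrightarrow> small \<kappa> (hom M X Y)"
    and Y: "fibrant M Y" and f: "f \<in> hom M X Y"
  shows "\<exists>i m. is_homotopy_image M f i m"
proof -
  have Yo: "Y \<in> Obj M" using fibrant_Obj[OF Y] .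
  \<comment> \<open>All competitors for the image, already replaced by fibrations.\<close>
  define G where "G = {m. hmono_fib m \<and> Cod M m = Y \<and> (\<exists>x. x \<in> hom M X (Dom M m) \<and> m \<cdot> x = f)}"
  define S where "S = lifting_maps ` G"
  have "small \<kappa> (\<Union>i\<in>I. hom M (Cod M i) Y)"
    by (rule small_UNION[OF universe small_I]) (use I_arr Yo in \<open>auto intro!: small_hom simp del: in_hom\<close>)
  moreover have "S \<subseteq> Pow (\<Union>i\<in>I. hom M (Cod M i) Y)"
    unfolding S_def
  proof (clarify)
    fix m v assume "m \<in> G" "v \<in> lifting_maps m"
    then show "v \<in> (\<Union>i\<in>I. hom M (Cod M i) Y)" by (auto simp: G_def lifting_maps_def hmono_fib_def)
  qed
  ultimately have S: "small \<kappa> S" using small_subset small_Pow[OF universe] by blast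
  \<comment> \<open>One competitor for each set of liftable maps; by
    \<open>hmono_fib_compare\<close> it stands for every other competitor with the same set.\<close>
  define m where "m = (\<lambda>s. SOME n. n \<in> G \<and> lifting_maps n = s)"
  have m: "m s \<in> G" "lifting_maps (m s) = s" if "s \<in> S" for s
    using someI_ex[of "\<lambda>n. n \<in> G \<and> lifting_maps n = s"] that by (auto simp: S_def m_def)
  have mh: "\<And>s. s \<in> S \<Longrightarrow> hmono_fib (m s) \<and> Cod M (m s) = Y" using m by (auto simp: G_def)
  have ma: "\<And>s. s \<in> S \<Longrightarrow> m s \<in> Arr M \<and> Cod M (m s) = Y" using mh by (auto simp: hmono_fib_def)
  obtain b \<pi> where W: "wide_pullback S Y m b \<pi>"
    using wide_pullback_exists[OF universe complete S Yo, of m] ma by blast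
  note W' = wide_pullback_simps[OF W]
  have "\<forall>s\<in>S. \<exists>x. x \<in> hom M X (Dom M (m s)) \<and> m s \<cdot> x = f" using m by (auto simp: G_def)
  then obtain xs where xs: "\<And>s. s \<in> S \<Longrightarrow> xs s \<in> hom M X (Dom M (m s)) \<and> m s \<cdot> xs s = f" by metis
  obtain x where x: "x \<in> Arr M" "Dom M x = Dom M f" "Cod M x = Dom M b" "b \<cdot> x = f"
    by (rule wide_pullback_lift[OF W, of f xs]) (use f xs in auto)
  obtain i t where i: "i \<in> Cof M" "t \<in> Fib M" "t \<in> Weq M" "Cod M i = Dom M t" "t \<cdot> i = x"
    "Dom M i = Dom M x" "Cod M t = Cod M x" using factor_Cof_TFib[OF x(1)] by blast
  have bt: "hmono_fib (b \<cdot> t)" using hmono_fib_tfib[OF hmono_fib_wide_pullback[OF W mh] i(2,3)] i x by simp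
  have fac: "cof_hmono_factorization M f i (b \<cdot> t)"
    unfolding cof_hmono_factorization_def
    using hmono_fib_homotopy_mono[OF bt] Y i x W' by (simp add: assoc)
  moreover have "\<exists>!h. h \<in> hom (Ho M) (Cod M i) (Cod M i') \<and> h \<diamondop> \<gamma> i = \<gamma> i' \<and> \<gamma> m' \<diamondop> h = \<gamma> (b \<cdot> t)"
    if fac': "cof_hmono_factorization M f i' m'" for i' m'
  proof -
    have i': "i' \<in> Cof M" "Cod M i' = Dom M m'" "m' \<cdot> i' = f" and mono: "homotopy_mono M m'" and m'a: "m' \<in> Arr M"
      using fac' by (auto simp: cof_hmono_factorization_def homotopy_mono_def)
    have m': "m' \<in> Arr M" "Cod M m' = Y" "Dom M i' = X" using i' m'a f by auto
    \<comment> \<open>The given homotopy monomorphism is replaced by a fibration \<open>n\<close>,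
      which belongs to \<open>G\<close> through the map \<open>j \<cdot> i'\<close> from
      \<open>X\<close>.\<close>
    obtain j n where j: "j \<in> Cof M" "j \<in> Weq M" "n \<in> Fib M" "Cod M j = Dom M n" "n \<cdot> j = m'"
      "Dom M j = Dom M m'" "Cod M n = Cod M m'" using factor_TCof_Fib[OF m'(1)] by blast
    have n: "hmono_fib n" using homotopy_mono_hmono_fib[OF mono _ j(1-5)] Y m' by simp
    have "n \<cdot> (j \<cdot> i') = f" using j i' by (simp add: extend[OF j(5)])
    then have "n \<in> G" using n j m' i' by (auto simp: G_def intro!: exI[of _ "j \<cdot> i'"])
    then have s: "lifting_maps n \<in> S" by (simp add: S_def)
    define s where "s = lifting_maps n"
    have s: "s \<in> S" using s by (simp add: s_def)
    note Ws = W'(1,2) W'(3-6)[OF s]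
    have msf: "m s \<in> Fib M" using mh[OF s] by (simp add: hmono_fib_def)
    obtain p q where P: "is_pullback M n (m s) p q" using pb[of n "m s"] j m' ma[OF s] by auto
    note P' = pullback_simps[OF P]
    have q: "q \<in> Weq M" using hmono_fib_compare(2)[OF n msf _ P] m(2)[OF s] by (simp add: s_def)
    \<comment> \<open>Being monic in \<open>Ho M\<close> passes from \<open>n\<close> to
      \<open>m'\<close> because \<open>j\<close> is invertible there.\<close>
    have mono': "h = h'" if h: "h \<in> Arr (Ho M)" "h' \<in> Arr (Ho M)" "Dom (Ho M) h = Dom (Ho M) h'" "Cod (Ho M) h = Dom M m'"
      "Cod (Ho M) h' = Dom M m'" and eq: "\<gamma> m' \<diamondop> h = \<gamma> m' \<diamondop> h'" for h h'
    proof -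
      have gm: "\<gamma> m' = \<gamma> n \<diamondop> \<gamma> j" using j by (simp flip: \<gamma>_comp)
      have e: "\<gamma> n \<diamondop> (\<gamma> j \<diamondop> h) = \<gamma> n \<diamondop> (\<gamma> j \<diamondop> h')" using eq h j unfolding gm by (simp add: Ho.assoc)
      have e': "\<gamma> j \<diamondop> h = \<gamma> j \<diamondop> h'"
        by (rule hmono_fib_mono[OF n _ _ _ _ _ _ e]) (use h j m' Y in auto)
      show ?thesis by (rule Ho_mono[OF j(2) _ _ _ _ e']) (use h j in auto)
    qed
    \<comment> \<open>Project to the chosen representative \<open>m s\<close>, pass to
      \<open>n\<close> through their fiber product, where \<open>q\<close> is invertible in
      \<open>Ho M\<close>, and return along \<open>j\<close>.\<close>
    define h where "h = \<gamma>_inv j \<diamondop> (\<gamma> p \<diamondop> (\<gamma>_inv q \<diamondop> \<gamma> (\<pi> s \<cdot> t)))"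
    have h: "h \<in> Arr (Ho M)" "Dom (Ho M) h = Dom M t" "Cod (Ho M) h = Dom M m'"
      using j P' q Ws i x by (simp_all add: h_def)
    have mh: "\<gamma> m' \<diamondop> h = \<gamma> (b \<cdot> t)"
    proof -
      define r where "r = \<gamma> p \<diamondop> (\<gamma>_inv q \<diamondop> \<gamma> (\<pi> s \<cdot> t))"
      have r: "r \<in> Arr (Ho M)" "Cod (Ho M) r = Dom M n" using P' q Ws i x by (simp_all add: r_def)
      have "\<gamma> m' \<diamondop> h = (\<gamma> n \<diamondop> \<gamma> j) \<diamondop> h" using j by (simp flip: \<gamma>_comp)
      also have "\<dots> = \<gamma> n \<diamondop> (\<gamma> j \<diamondop> h)" using j h by (simp add: Ho.assoc)
      also have "\<gamma> j \<diamondop> h = r" using j r by (simp add: h_def flip: r_def Ho.assoc)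
      also have "\<gamma> n \<diamondop> r = (\<gamma> n \<diamondop> \<gamma> p) \<diamondop> (\<gamma>_inv q \<diamondop> \<gamma> (\<pi> s \<cdot> t))"
        using P' q Ws i x by (simp add: r_def Ho.assoc)
      also have "\<gamma> n \<diamondop> \<gamma> p = \<gamma> (m s) \<diamondop> \<gamma> q" using P' by (simp flip: \<gamma>_comp)
      also have "(\<gamma> (m s) \<diamondop> \<gamma> q) \<diamondop> (\<gamma>_inv q \<diamondop> \<gamma> (\<pi> s \<cdot> t)) = \<gamma> (m s) \<diamondop> ((\<gamma> q \<diamondop> \<gamma>_inv q) \<diamondop> \<gamma> (\<pi> s \<cdot> t))"
        using P' q Ws i x by (simp add: Ho.assoc del: \<gamma>_inv(5))
      also have "\<dots> = \<gamma> (m s \<cdot> (\<pi> s \<cdot> t))" using P' q Ws i x by (simp add: \<gamma>_comp)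
      also have "m s \<cdot> (\<pi> s \<cdot> t) = b \<cdot> t" using P' Ws i x by (simp add: extend[OF Ws(6)])
      finally show ?thesis .
    qed
    have "\<gamma> m' \<diamondop> (h \<diamondop> \<gamma> i) = (\<gamma> m' \<diamondop> h) \<diamondop> \<gamma> i" using h m' i by (simp add: Ho.assoc)
    also have "\<dots> = \<gamma> ((b \<cdot> t) \<cdot> i)" unfolding mh using i(1-4,7) x(1-3) W'(1,2) by (simp add: \<gamma>_comp)
    also have "(b \<cdot> t) \<cdot> i = m' \<cdot> i'" using i x W'(1,2) i' by (simp add: assoc)
    also have "\<gamma> \<dots> = \<gamma> m' \<diamondop> \<gamma> i'" using i'(1,2) m'(1) by (simp add: \<gamma>_comp)
    finally have eq: "\<gamma> m' \<diamondop> (h \<diamondop> \<gamma> i) = \<gamma> m' \<diamondop> \<gamma> i'" .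
    have hi: "h \<diamondop> \<gamma> i = \<gamma> i'" by (rule mono'[OF _ _ _ _ _ eq]) (use h i i' m' x f in auto)
    show ?thesis
    proof (rule ex1I[of _ h])
      show "h \<in> hom (Ho M) (Cod M i) (Cod M i') \<and> h \<diamondop> \<gamma> i = \<gamma> i' \<and> \<gamma> m' \<diamondop> h = \<gamma> (b \<cdot> t)"
        using h hi mh i i' by simp
      fix h' assume A: "h' \<in> hom (Ho M) (Cod M i) (Cod M i') \<and> h' \<diamondop> \<gamma> i = \<gamma> i' \<and> \<gamma> m' \<diamondop> h' = \<gamma> (b \<cdot> t)"
      have eq: "\<gamma> m' \<diamondop> h' = \<gamma> m' \<diamondop> h" using A mh by simp
      show "h' = h" by (rule mono'[OF _ _ _ _ _ eq]) (use A h i i' in auto)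
    qed
  qed
  ultimately show ?thesis unfolding is_homotopy_image_def by blast
qed

end

theorem theorem2p37:
  fixes \<kappa> :: "'u rel" and M :: "('o, 'a) model" and X Y :: 'o and f :: 'a
  assumes "universe_cardinal \<kappa>"
    and "left_proper M"
    and "combinatorial_model_category \<kappa> M"
    and "fibrant M Y"
    and "f \<in> hom M X Y"
  shows "\<exists>i m. is_homotopy_image M f i m"
proof -
  have M: "model_category \<kappa> M" "cofibrantly_generated \<kappa> M" "locally_presentable \<kappa> M"
    using assms(3) by (auto simp: combinatorial_model_category_def)
  obtain I J where IJ: "small \<kappa> I" "I \<subseteq> Arr M" "J \<subseteq> Arr M" "Fib M = rlp M J" "Fib M \<inter> Weq M = rlp M I"
    using M(2) unfolding cofibrantly_generated_def by blast
  have "category M" using M(1) by (simp add: model_category_def)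
  then interpret category M .
  interpret generated_model_category M \<kappa> I J
    by unfold_locales (use assms(1) M(1) IJ in auto)
  show ?thesis
    using homotopy_image_exists[OF IJ(1) _ assms(4,5)] M(3) unfolding locally_presentable_def by blast
qed

end
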